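(* Let $G$ be a locally finite, infinite, connected graph. Then $\mathsf{WSF}\bigl(\overline{\mathfrak{F}_{\mathrm w}(G)}\bigr)=\mathsf{WSF}(G)$ if and only if, almost surely, each component $K$ of $\overline{\mathfrak{F}_{\mathrm w}(G)}$ has the property that $\mathsf{FSF}(K)=\mathsf{WSF}(K)$.
   Context: For a finite connected graph $K$, $\mathsf{UST}(K)$ is the uniform measure on spanning trees of $K$. Let $G$ be a locally finite, infinite, connected graph. An exhaustion of $G$ is a sequence $\langle G_n\rangle$ of finite connected subgraphs with $G_n\subset G_{n+1}$ and $\bigcup_n G_n=G$. Free spanning forest: given an exhaustion and a fixed finite subgraph $H$ of $G$, the weak limit of $\mathsf{UST}(G_n)\cap H$ exists; varying $H$ gives a probability measure $\mathsf{FSF}(G)$ on subgraphs of $G$. Wired spanning forest: for a finite connected subgraph $H$ of $G$, let $\widehat H$ be the finite graph obtained from $G$ by identifying all vertices not in $H$ to a single vertex, and $\mathsf{WSF}(H):=\mathsf{UST}(\widehat H)$. Given an exhaustion by induced subgraphs and a fixed finite subgraph $H$, the weak limit of $\mathsf{WSF}(G_n)\cap H$ exists; varying $H$ gives a probability measure $\mathsf{WSF}(G)$ on subgraphs of $G$. $\mathfrak{F}_{\mathrm w}(G)$ denotes a random sample with law $\mathsf{WSF}(G)$; its components are a.s. infinite. Induced-component graph: for a subgraph $H$ of $G$, $\overline H$ is the subgraph of $G$ with the same vertex set as $H$ in which an edge of $G$ is present iff both its endpoints lie in the same connected component of $H$. For a random subgraph $H$ of $G$ all of whose components are infinite, $\mathsf{WSF}(H)$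 denotes the unconditional law of the random subgraph of $G$ obtained by first sampling $H$ and then, given $H$, sampling a wired spanning forest independently on each component of $H$. *)

theory Defs
  imports "HOL-Probability.Probability"
begin

text \<open>
  Undirected multigraphs, with loops and parallel edges allowed: edges are labels, and
  \<open>ends\<close> gives the set of one or two endpoints of an edge. Labels survive identification of
  vertices, so a spanning tree of a contracted graph is literally a set of edges of the
  original graph.
\<close>

record ('v, 'e) mgraph =
  verts :: "'v set"
  edges :: "'e set"
  ends :: "'e \<Rightarrow> 'v set"

definition wf_mgraph :: "('v, 'e) mgraph \<Rightarrow> bool" where
  "wf_mgraph G \<longleftrightarrow>
     (\<forall>e\<in>edges G. ends G e \<subseteq> verts G \<and> (card (ends G e) = 1 \<or> card (ends G e) = 2))"

definition finite_mgraph :: "('v, 'e) mgraph \<Rightarrow> bool" where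
  "finite_mgraph G \<longleftrightarrow> finite (verts G) \<and> finite (edges G)"

definition locally_finite :: "('v, 'e) mgraph \<Rightarrow> bool" where
  "locally_finite G \<longleftrightarrow> (\<forall>v\<in>verts G. finite {e \<in> edges G. v \<in> ends G e})"

definition adjacency :: "('v, 'e) mgraph \<Rightarrow> ('v \<times> 'v) set" where
  "adjacency G = {(u, v). \<exists>e\<in>edges G. ends G e = {u, v}}"

definition joined :: "('v, 'e) mgraph \<Rightarrow> 'v \<Rightarrow> 'v \<Rightarrow> bool" where
  "joined G u v \<longleftrightarrow> (u, v) \<in> (adjacency G)\<^sup>*"

definition connected_mgraph :: "('v, 'e) mgraph \<Rightarrow> bool" where
  "connected_mgraph G \<longleftrightarrow> verts G \<noteq> {} \<and> (\<forall>u\<in>verts G. \<forall>v\<in>verts G. joined G u v)"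

definition subgraph :: "('v, 'e) mgraph \<Rightarrow> ('v, 'e) mgraph \<Rightarrow> bool" where
  "subgraph H G \<longleftrightarrow>
     wf_mgraph H \<and> verts H \<subseteq> verts G \<and> edges H \<subseteq> edges G \<and> ends H = ends G"

definition induced_subgraph :: "('v, 'e) mgraph \<Rightarrow> ('v, 'e) mgraph \<Rightarrow> bool" where
  "induced_subgraph H G \<longleftrightarrow>
     subgraph H G \<and> edges H = {e \<in> edges G. ends G e \<subseteq> verts H}"

definition spanning_subgraph :: "('v, 'e) mgraph \<Rightarrow> 'e set \<Rightarrow> ('v, 'e) mgraph" where
  "spanning_subgraph G F = \<lparr>verts = verts G, edges = F, ends = ends G\<rparr>"

definition component_of :: "('v, 'e) mgraph \<Rightarrow> 'v \<Rightarrow> ('v, 'e) mgraph" where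
  "component_of G v =
     \<lparr>verts = {u \<in> verts G. joined G v u},
      edges = {e \<in> edges G. ends G e \<subseteq> {u \<in> verts G. joined G v u}},
      ends = ends G\<rparr>"

definition graph_components :: "('v, 'e) mgraph \<Rightarrow> ('v, 'e) mgraph set" where
  "graph_components G = component_of G ` verts G"

text \<open>The induced-component graph of a subgraph \<open>H\<close> of \<open>G\<close>.\<close>

definition component_closure :: "('v, 'e) mgraph \<Rightarrow> ('v, 'e) mgraph \<Rightarrow> ('v, 'e) mgraph" where
  "component_closure G H =
     \<lparr>verts = verts H,
      edges = {e \<in> edges G. \<exists>K\<in>graph_components H. ends G e \<subseteq> verts K},
      ends = ends G\<rparr>"

text \<open>
  A cycle \<open>v\<^sub>0 e\<^sub>0 v\<^sub>1 e\<^sub>1 \<dots> v\<^sub>0\<close>. Length one is a loop and length two a pair of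
  parallel edges.
\<close>

definition is_cycle :: "('v, 'e) mgraph \<Rightarrow> 'v list \<Rightarrow> 'e list \<Rightarrow> bool" where
  "is_cycle G vs es \<longleftrightarrow>
     es \<noteq> [] \<and> length vs = length es \<and> distinct vs \<and> distinct es \<and>
     set vs \<subseteq> verts G \<and> set es \<subseteq> edges G \<and>
     (\<forall>i < length es. ends G (es ! i) = {vs ! i, vs ! (Suc i mod length vs)})"

definition is_tree :: "('v, 'e) mgraph \<Rightarrow> bool" where
  "is_tree G \<longleftrightarrow> connected_mgraph G \<and> \<not> (\<exists>vs es. is_cycle G vs es)"

definition spanning_trees :: "('v, 'e) mgraph \<Rightarrow> 'e set set" where
  "spanning_trees G = {T. T \<subseteq> edges G \<and> is_tree (spanning_subgraph G T)}"

definition UST :: "('v, 'e) mgraph \<Rightarrow> 'e set pmf" where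
  "UST G = pmf_of_set (spanning_trees G)"

text \<open>
  The graph obtained from \<open>G\<close> by identifying all vertices outside \<open>H\<close> to the single vertex
  \<open>None\<close>. The edges of \<open>G\<close> with no endpoint in \<open>H\<close>, which would become loops at \<open>None\<close>
  (possibly infinitely many), are discarded; a loop lies in no spanning tree.
\<close>

definition wired :: "('v, 'e) mgraph \<Rightarrow> ('v, 'e) mgraph \<Rightarrow> ('v option, 'e) mgraph" where
  "wired G H =
     (let \<pi> = (\<lambda>v. if v \<in> verts H then Some v else None) in
      \<lparr>verts = \<pi> ` verts G,
       edges = {e \<in> edges G. ends G e \<inter> verts H \<noteq> {}},
       ends = (\<lambda>e. \<pi> ` ends G e)\<rparr>)"

definition exhaustion :: "('v, 'e) mgraph \<Rightarrow> (nat \<Rightarrow> ('v, 'e) mgraph) \<Rightarrow> bool" where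
  "exhaustion G Gs \<longleftrightarrow>
     (\<forall>n. subgraph (Gs n) G \<and> finite_mgraph (Gs n) \<and> connected_mgraph (Gs n)) \<and>
     (\<forall>n. subgraph (Gs n) (Gs (Suc n))) \<and>
     (\<Union>n. verts (Gs n)) = verts G \<and> (\<Union>n. edges (Gs n)) = edges G"

definition induced_exhaustion :: "('v, 'e) mgraph \<Rightarrow> (nat \<Rightarrow> ('v, 'e) mgraph) \<Rightarrow> bool" where
  "induced_exhaustion G Gs \<longleftrightarrow> exhaustion G Gs \<and> (\<forall>n. induced_subgraph (Gs n) G)"

text \<open>
  The measurable space of (spanning) subgraphs of \<open>G\<close>, given by their edge sets, with the
  product \<open>\<sigma>\<close>-algebra.
\<close>

definition configs :: "('v, 'e) mgraph \<Rightarrow> 'e set measure" where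
  "configs G = sigma (Pow (edges G)) ((\<lambda>e. {F \<in> Pow (edges G). e \<in> F}) ` edges G)"

text \<open>
  \<open>\<mu>\<close> is the law on subgraphs of \<open>G\<close> whose restriction to every finite subgraph \<open>H\<close> is the
  weak limit of the restrictions to \<open>H\<close> of the laws \<open>P n\<close>. The restrictions take values in
  the finite set \<open>Pow (edges H)\<close>, where weak convergence is convergence of point masses.
\<close>

definition local_weak_limit ::
    "('v, 'e) mgraph \<Rightarrow> (nat \<Rightarrow> 'e set pmf) \<Rightarrow> 'e set measure \<Rightarrow> bool" where
  "local_weak_limit G P \<mu> \<longleftrightarrow>
     prob_space \<mu> \<and> sets \<mu> = sets (configs G) \<and>
     (\<forall>H. subgraph H G \<and> finite_mgraph H \<longrightarrow>
       (\<forall>A \<subseteq> edges H.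
         (\<lambda>n. measure_pmf.prob (P n) {T. T \<inter> edges H = A})
           \<longlonglongrightarrow> measure \<mu> {F \<in> space \<mu>. F \<inter> edges H = A}))"

definition FSF :: "('v, 'e) mgraph \<Rightarrow> 'e set measure" where
  "FSF G = (THE \<mu>. \<forall>Gs. exhaustion G Gs \<longrightarrow> local_weak_limit G (\<lambda>n. UST (Gs n)) \<mu>)"

definition WSF :: "('v, 'e) mgraph \<Rightarrow> 'e set measure" where
  "WSF G =
     (THE \<mu>. \<forall>Gs. induced_exhaustion G Gs \<longrightarrow> local_weak_limit G (\<lambda>n. UST (wired G (Gs n))) \<mu>)"

text \<open>
  The law, as a random subgraph of \<open>G\<close>, of the union of independent wired spanning forests
  of the components of a fixed spanning subgraph \<open>H\<close> of \<open>G\<close>.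
\<close>

definition WSF_components :: "('v, 'e) mgraph \<Rightarrow> ('v, 'e) mgraph \<Rightarrow> 'e set measure" where
  "WSF_components G H =
     distr (PiM (graph_components H) WSF) (configs G) (\<lambda>\<omega>. \<Union>K\<in>graph_components H. \<omega> K)"

text \<open>
  The unconditional law, when the fixed subgraph is replaced by a random one whose edge set has
  law \<open>\<nu>\<close>. It is intended for \<open>\<nu>\<close> under which almost surely all components are infinite; on
  a finite component \<open>K\<close>, \<open>WSF K\<close> is the uniform spanning tree.
\<close>

definition WSF_random :: "('v, 'e) mgraph \<Rightarrow> 'e set measure \<Rightarrow> 'e set measure" where
  "WSF_random G \<nu> = \<nu> \<bind> (\<lambda>F. WSF_components G (spanning_subgraph G F))"

end

theory Submission
  imports Defs
begin

text \<open>
  A law on configurations is determined by the probabilities of the events \<open>B \<subseteq> F\<close> for finite \<open>B\<close>, so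
  the whole proof compares these.

  The heart is that resampling a free spanning forest in each component of the induced-component
  graph of the wired spanning forest returns the wired spanning forest (\<open>WSF_eq_free_product\<close>). Let \<open>T\<close>
  be a uniform spanning tree of a large wired graph and \<open>S\<close> the edge set of a smaller piece of \<open>G\<close>. Given
  \<open>T - S\<close> and given the clusters of \<open>T \<inter> S\<close>, the forest \<open>T \<inter> S\<close> is uniform among the forests in \<open>S\<close> with
  these clusters, because whether the union with \<open>T - S\<close> is a spanning tree depends only on the clusters
  (\<open>card_trees_with_resample\<close>). Such a uniform forest consists of independent uniform spanning trees
  of the graphs induced on the clusters (\<open>forest_ratio_prod\<close>). This identity concerns only the trace on
  \<open>S\<close>, so it passes to the wired spanning forest of \<open>G\<close> (\<open>WSF_resample\<close>). When the piece then grows,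
  the graphs induced on its clusters exhaust the components of the induced-component graph, and the
  uniform spanning trees of an exhaustion converge to the free spanning forest
  (\<open>cluster_product_limit\<close>, \<open>free_product_limit\<close>).

  So both sides of the claimed equality of laws are averages over the same random graph, of wired
  forests on one side and of free forests on the other. On each component the wired forest is
  dominated by the free one on the events \<open>B \<subseteq> F\<close>; hence the averages agree if and only if almost
  surely the wired and the free forest of each component agree.

  Domination, and the existence and uniqueness of the two limits that define the forests, come from
  Rayleigh monotonicity: \<open>B \<subseteq> T\<close> becomes less likely when edges are added or vertices are identified
  (\<open>UST_prob_contracts\<close>). It is derived from Kirchhoff's description of the current by spanning trees
  (\<open>kirchhoff\<close>) and the Cauchy-Schwarz inequality for energies. The limit laws are built by Kolmogorov
  extension (\<open>configs_measure_exists\<close>).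
\<close>

section \<open>Connectivity and forests as edge sets\<close>

definition link :: "('e \<Rightarrow> 'v set) \<Rightarrow> 'e set \<Rightarrow> ('v \<times> 'v) set" where
  "link en F = {(u, v). \<exists>e\<in>F. en e = {u, v}}"

definition conn :: "('e \<Rightarrow> 'v set) \<Rightarrow> 'e set \<Rightarrow> ('v \<times> 'v) set" where
  "conn en F = (link en F)\<^sup>*"

text \<open>
  Every edge is a bridge. In this form, deleting and exchanging edges needs no lists of vertices;
  \<open>spanning_trees_iff\<close> connects it to the absence of cycles.
\<close>

definition acyc :: "('e \<Rightarrow> 'v set) \<Rightarrow> 'e set \<Rightarrow> bool" where
  "acyc en F \<longleftrightarrow> (\<forall>e\<in>F. \<forall>a b. en e = {a, b} \<longrightarrow> (a, b) \<notin> conn en (F - {e}))"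

lemma joined_iff_conn: "joined G u v \<longleftrightarrow> (u, v) \<in> conn (ends G) (edges G)"
  by (simp add: joined_def adjacency_def conn_def link_def)

lemma conn_refl [simp]: "(u, u) \<in> conn en F"
  by (simp add: conn_def)

lemma sym_link: "sym (link en F)"
  by (auto simp: link_def sym_def insert_commute)

lemma conn_sym: "(u, v) \<in> conn en F \<Longrightarrow> (v, u) \<in> conn en F"
  using sym_rtrancl[OF sym_link[of en F]] by (auto simp: conn_def sym_def)

lemma conn_trans: "(u, v) \<in> conn en F \<Longrightarrow> (v, w) \<in> conn en F \<Longrightarrow> (u, w) \<in> conn en F"
  unfolding conn_def by (rule rtrancl_trans)

lemma link_mono: "A \<subseteq> B \<Longrightarrow> link en A \<subseteq> link en B"
  by (auto simp: link_def)

lemma conn_mono: "A \<subseteq> B \<Longrightarrow> conn en A \<subseteq> conn en B"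
  unfolding conn_def by (intro rtrancl_mono link_mono)

lemma conn_edge: "e \<in> F \<Longrightarrow> en e = {a, b} \<Longrightarrow> (a, b) \<in> conn en F"
  unfolding conn_def link_def by blast

lemma conn_edge': "e \<in> F \<Longrightarrow> en e = {a, b} \<Longrightarrow> x \<in> en e \<Longrightarrow> y \<in> en e \<Longrightarrow> (x, y) \<in> conn en F"
  using conn_edge[of e F en a b] by (auto intro: conn_sym)

lemma conn_induct [consumes 1, case_names refl step]:
  assumes "(x, y) \<in> conn en F" "P x"
    and "\<And>y z g. (x, y) \<in> conn en F \<Longrightarrow> g \<in> F \<Longrightarrow> en g = {y, z} \<Longrightarrow> P y \<Longrightarrow> P z"
  shows "P y"
  using assms(1) unfolding conn_def
proof (induction rule: rtrancl_induct)
  case base show ?case by (rule assms(2))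
next
  case (step y z) then show ?case using assms(3)[of y _ z] by (auto simp: conn_def link_def)
qed

lemma conn_subsetI:
  assumes "\<And>e a b. e \<in> A \<Longrightarrow> en e = {a, b} \<Longrightarrow> (a, b) \<in> conn en B"
  shows "conn en A \<subseteq> conn en B"
proof -
  have "link en A \<subseteq> conn en B" using assms by (auto simp: link_def)
  then have "(link en A)\<^sup>* \<subseteq> (conn en B)\<^sup>*" by (rule rtrancl_mono)
  then show ?thesis by (simp add: conn_def)
qed

lemma conn_Un_cong:
  assumes "conn en A = conn en B" shows "conn en (C \<union> A) = conn en (C \<union> B)"
proof -
  have *: "conn en (C \<union> A) \<subseteq> conn en (C \<union> B)" if "conn en A = conn en B" for A B
  proof (rule conn_subsetI)
    fix e a b assume e: "e \<in> C \<union> A" "en e = {a, b}"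
    show "(a, b) \<in> conn en (C \<union> B)"
    proof (cases "e \<in> C")
      case True then show ?thesis using e by (intro conn_edge[of e]) auto
    next
      case False
      then have "(a, b) \<in> conn en A" using e by (intro conn_edge[of e]) auto
      then show ?thesis using that conn_mono[of B "C \<union> B" en] by blast
    qed
  qed
  show ?thesis using *[OF assms] *[OF assms[symmetric]] by blast
qed

text \<open>
  A walk that uses the new edge can be cut at its first and last use of it.
\<close>

lemma conn_insert:
  assumes e: "en e = {a, b}"
  shows "(x, y) \<in> conn en (insert e A) \<longleftrightarrow>
    (x, y) \<in> conn en A \<or> ((x, a) \<in> conn en A \<and> (b, y) \<in> conn en A) \<or>
    ((x, b) \<in> conn en A \<and> (a, y) \<in> conn en A)"
proof
  assume "(x, y) \<in> conn en (insert e A)"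
  then show "(x, y) \<in> conn en A \<or> ((x, a) \<in> conn en A \<and> (b, y) \<in> conn en A) \<or>
    ((x, b) \<in> conn en A \<and> (a, y) \<in> conn en A)"
  proof (induction rule: conn_induct)
    case refl then show ?case by simp
  next
    case (step y z g)
    show ?case
    proof (cases "g = e")
      case True
      then have "(y = a \<and> z = b) \<or> (y = b \<and> z = a)" using step(3) e by (auto simp: doubleton_eq_iff)
      then show ?thesis using step(4) by (auto intro: conn_trans conn_sym)
    next
      case False
      then have "(y, z) \<in> conn en A" using step conn_edge[of g A en y z] by auto
      then show ?thesis using step(4) by (blast intro: conn_trans)
    qed
  qed
next
  have 1: "(a, b) \<in> conn en (insert e A)" using e by (intro conn_edge[of e]) auto
  have 2: "conn en A \<subseteq> conn en (insert e A)" by (intro conn_mono) auto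
  show "(x, y) \<in> conn en (insert e A)" if "(x, y) \<in> conn en A \<or> ((x, a) \<in> conn en A \<and> (b, y) \<in> conn en A) \<or>
    ((x, b) \<in> conn en A \<and> (a, y) \<in> conn en A)"
    using that 1 2 by (meson conn_sym conn_trans subsetD)
qed

lemma conn_insert_redundant:
  assumes "en e = {a, b}" "(a, b) \<in> conn en A"
  shows "conn en (insert e A) = conn en A"
proof (rule set_eqI, clarify)
  fix x y
  show "(x, y) \<in> conn en (insert e A) \<longleftrightarrow> (x, y) \<in> conn en A"
    unfolding conn_insert[of en, OF assms(1)] using assms(2) by (meson conn_sym conn_trans)
qed

text \<open>
  If an old edge \<open>g\<close> stopped being a bridge, a walk around it would have to use \<open>e\<close>; closing this
  walk up by \<open>g\<close> would already join the endpoints of \<open>e\<close> inside \<open>A\<close>.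
\<close>

lemma acyc_insert:
  assumes e: "en e = {a, b}" and A: "acyc en A" and n: "(a, b) \<notin> conn en A"
  shows "acyc en (insert e A)"
  unfolding acyc_def
proof (intro ballI allI impI)
  fix g c d assume g: "g \<in> insert e A" "en g = {c, d}"
  have "e \<notin> A" using n conn_edge[of e A en a b] e by auto
  show "(c, d) \<notin> conn en (insert e A - {g})"
  proof (cases "g = e")
    case True
    then have "(c = a \<and> d = b) \<or> (c = b \<and> d = a)" using g e by (auto simp: doubleton_eq_iff)
    moreover have "insert e A - {g} = A" using True \<open>e \<notin> A\<close> by auto
    ultimately show ?thesis using n conn_sym by metis
  next
    case False
    then have gA: "g \<in> A" using g by auto
    have eq: "insert e A - {g} = insert e (A - {g})" using False by auto
    have nc: "(c, d) \<notin> conn en (A - {g})" using A gA g by (auto simp: acyc_def)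
    show ?thesis
    proof
      assume "(c, d) \<in> conn en (insert e A - {g})"
      then have "((c, a) \<in> conn en (A - {g}) \<and> (b, d) \<in> conn en (A - {g})) \<or>
        ((c, b) \<in> conn en (A - {g}) \<and> (a, d) \<in> conn en (A - {g}))"
        unfolding eq conn_insert[of en, OF e] using nc by auto
      moreover have "(c, d) \<in> conn en A" using gA g by (intro conn_edge)
      moreover have "conn en (A - {g}) \<subseteq> conn en A" by (intro conn_mono) auto
      ultimately have "(a, b) \<in> conn en A" by (meson conn_sym conn_trans subsetD)
      then show False using n by simp
    qed
  qed
qed

lemma acyc_subset: "acyc en A \<Longrightarrow> B \<subseteq> A \<Longrightarrow> acyc en B"
  unfolding acyc_def
proof (intro ballI allI impI)
  fix e a b assume *: "\<forall>e\<in>A. \<forall>a b. en e = {a, b} \<longrightarrow> (a, b) \<notin> conn en (A - {e})" "B \<subseteq> A" "e \<in> B" "en e = {a, b}"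
  then show "(a, b) \<notin> conn en (B - {e})"
    using conn_mono[of "B - {e}" "A - {e}" en] by blast
qed

lemma acyc_notin: "acyc en A \<Longrightarrow> e \<in> A \<Longrightarrow> en e = {a, b} \<Longrightarrow> (a, b) \<notin> conn en (A - {e})"
  by (auto simp: acyc_def)

lemma wf_ends: 
  assumes "wf_mgraph G" "e \<in> edges G" 
  obtains a b where "ends G e = {a, b}" "a \<in> verts G" "b \<in> verts G"
proof -
  have "card (ends G e) = 1 \<or> card (ends G e) = 2" "ends G e \<subseteq> verts G"
    using assms by (auto simp: wf_mgraph_def)
  then show ?thesis using that by (metis card_1_singletonE card_2_iff insert_absorb2 insert_subset)
qed

text \<open>
  Extending a simple path by an edge, the path is cut at the new endpoint if it was visited before.
\<close>

lemma simple_path_exists: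
  assumes "(x, y) \<in> conn en F"
  shows "\<exists>vs es. length vs = Suc (length es) \<and> vs ! 0 = x \<and> vs ! length es = y \<and> distinct vs \<and> set es \<subseteq> F \<and>
    (\<forall>i<length es. en (es ! i) = {vs ! i, vs ! Suc i})"
  using assms
proof (induction rule: conn_induct)
  case refl show ?case by (rule exI[of _ "[x]"], rule exI[of _ "[]"]) simp
next
  case (step y z g)
  then obtain vs es where p: "length vs = Suc (length es)" "vs ! 0 = x" "vs ! length es = y" "distinct vs"
    "set es \<subseteq> F" "\<forall>i<length es. en (es ! i) = {vs ! i, vs ! Suc i}" by blast
  show ?case
  proof (cases "z \<in> set vs")
    case True
    then obtain k where k: "k < length vs" "vs ! k = z" by (auto simp: in_set_conv_nth)
    show ?thesis
      by (rule exI[of _ "take (Suc k) vs"], rule exI[of _ "take k es"])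
         (use k p set_take_subset[of k es] in \<open>auto simp: min_def le_less_Suc_eq\<close>)
  next
    case False
    show ?thesis
    proof (rule exI[of _ "vs @ [z]"], rule exI[of _ "es @ [g]"], intro conjI)
      show "\<forall>i<length (es @ [g]). en ((es @ [g]) ! i) = {(vs @ [z]) ! i, (vs @ [z]) ! Suc i}"
      proof (intro allI impI)
        fix i assume "i < length (es @ [g])"
        then show "en ((es @ [g]) ! i) = {(vs @ [z]) ! i, (vs @ [z]) ! Suc i}"
          using p step(3) by (cases "i = length es") (auto simp: nth_append)
      qed
    qed (use p step False in \<open>auto simp: nth_append\<close>)
  qed
qed

lemma cycle_imp_not_acyc:
  assumes "is_cycle G vs es" shows "\<not> acyc (ends G) (edges G)"
proof
  assume ac: "acyc (ends G) (edges G)"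
  let ?n = "length vs" and ?en = "ends G" and ?e = "es ! 0"
  have n: "length es = ?n" "?n > 0" "distinct es" "set es \<subseteq> edges G"
    and en: "\<And>i. i < ?n \<Longrightarrow> ?en (es ! i) = {vs ! i, vs ! (Suc i mod ?n)}"
    using assms by (auto simp: is_cycle_def)
  have "(vs ! (1 mod ?n), vs ! (Suc j mod ?n)) \<in> conn ?en (edges G - {?e})" if "j < ?n" for j
    using that
  proof (induction j)
    case 0 show ?case by simp
  next
    case (Suc j)
    have "es ! Suc j \<in> edges G - {?e}" using Suc n by (auto simp: nth_eq_iff_index_eq)
    moreover have "?en (es ! Suc j) = {vs ! (Suc j mod ?n), vs ! (Suc (Suc j) mod ?n)}"
      using en[of "Suc j"] Suc by simp
    ultimately have "(vs ! (Suc j mod ?n), vs ! (Suc (Suc j) mod ?n)) \<in> conn ?en (edges G - {?e})"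
      by (rule conn_edge)
    then show ?case using Suc by (auto intro: conn_trans)
  qed
  from this[of "?n - 1"] have "(vs ! (1 mod ?n), vs ! 0) \<in> conn ?en (edges G - {?e})"
    using n by simp
  moreover have "?e \<in> edges G" using n by (metis nth_mem subsetD)
  moreover have "?en ?e = {vs ! (1 mod ?n), vs ! 0}" using en[of 0] n by auto
  ultimately show False using ac by (auto simp: acyc_def)
qed

lemma not_acyc_imp_cycle:
  assumes wf: "wf_mgraph G" and "\<not> acyc (ends G) (edges G)" shows "\<exists>vs es. is_cycle G vs es"
proof -
  let ?en = "ends G"
  obtain e a b where e: "e \<in> edges G" "?en e = {a, b}" "(a, b) \<in> conn ?en (edges G - {e})"
    using assms by (auto simp: acyc_def)
  obtain vs es where p: "length vs = Suc (length es)" "vs ! 0 = a" "vs ! length es = b" "distinct vs"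
    "set es \<subseteq> edges G - {e}" "\<forall>i<length es. ?en (es ! i) = {vs ! i, vs ! Suc i}" 
    using simple_path_exists[OF e(3)] by blast
  have "distinct es"
    unfolding distinct_conv_nth
  proof (intro allI impI)
    fix i j assume ij: "i < length es" "j < length es" "i \<noteq> j"
    have *: "es ! i \<noteq> es ! j" if "i < j" "j < length es" for i j
    proof -
      have "vs ! i \<notin> {vs ! j, vs ! Suc j}" using that p(1,4) by (auto simp: nth_eq_iff_index_eq)
      then show ?thesis using p(6) that by (metis insertI1 order_less_trans)
    qed
    show "es ! i \<noteq> es ! j" using *[of i j] *[of j i] ij by (metis nat_neq_iff)
  qed
  moreover have "set vs \<subseteq> verts G"
  proof
    fix v assume "v \<in> set vs"
    then obtain i where i: "i < length vs" "vs ! i = v" by (auto simp: in_set_conv_nth)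
    show "v \<in> verts G"
    proof (cases "i < length es")
      case True
      then have "v \<in> ?en (es ! i)" "es ! i \<in> edges G" using p(5,6) i True nth_mem[OF True] by (auto simp del: nth_mem)
      then show ?thesis using wf by (auto simp: wf_mgraph_def)
    next
      case False
      then have "v = b" using i p by (metis less_Suc_eq)
      then show ?thesis using wf e by (auto simp: wf_mgraph_def)
    qed
  qed
  moreover have "\<forall>i<length (es @ [e]). ?en ((es @ [e]) ! i) = {vs ! i, vs ! (Suc i mod length vs)}"
  proof (intro allI impI)
    fix i assume "i < length (es @ [e])"
    then show "?en ((es @ [e]) ! i) = {vs ! i, vs ! (Suc i mod length vs)}"
      using p e by (cases "i = length es") (auto simp: nth_append)
  qed
  ultimately have "is_cycle G vs (es @ [e])"
    using p e by (auto simp: is_cycle_def)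
  then show ?thesis by blast
qed

lemma spanning_subgraph_simps [simp]:
  "verts (spanning_subgraph G F) = verts G" "edges (spanning_subgraph G F) = F" "ends (spanning_subgraph G F) = ends G"
  by (simp_all add: spanning_subgraph_def)

lemma spanning_trees_iff:
  assumes "wf_mgraph G"
  shows "T \<in> spanning_trees G \<longleftrightarrow> T \<subseteq> edges G \<and> verts G \<noteq> {} \<and> acyc (ends G) T \<and>
    (\<forall>u\<in>verts G. \<forall>v\<in>verts G. (u, v) \<in> conn (ends G) T)"
proof (cases "T \<subseteq> edges G")
  case True
  then have "wf_mgraph (spanning_subgraph G T)" using assms by (auto simp: wf_mgraph_def)
  then have "(\<exists>vs es. is_cycle (spanning_subgraph G T) vs es) \<longleftrightarrow> \<not> acyc (ends G) T"
    using cycle_imp_not_acyc[of "spanning_subgraph G T"] not_acyc_imp_cycle[of "spanning_subgraph G T"] by auto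
  then show ?thesis using True
    by (auto simp: spanning_trees_def is_tree_def connected_mgraph_def joined_iff_conn)
qed (simp add: spanning_trees_def)

section \<open>Kirchhoff potentials and Rayleigh monotonicity\<close>

lemma conn_iff_right: "(a, b) \<in> conn en F \<Longrightarrow> (x, a) \<in> conn en F \<longleftrightarrow> (x, b) \<in> conn en F"
  using conn_sym[of a b en F] conn_trans[of x _ en F] by blast

text \<open>
  The difference of \<open>u\<close> along \<open>e\<close> in an arbitrary orientation. Only products of two gradients on the
  same edge occur, and these do not depend on the orientation.
\<close>

definition grad :: "('e \<Rightarrow> 'v set) \<Rightarrow> ('v \<Rightarrow> real) \<Rightarrow> 'e \<Rightarrow> real" where
  "grad en u e = (let p = (SOME p. en e = {fst p, snd p}) in u (fst p) - u (snd p))"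

lemma grad_cases:
  assumes "en e = {a, b}"
  shows "(\<forall>u. grad en u e = u a - u b) \<or> (\<forall>u. grad en u e = u b - u a)"
proof -
  define p where "p = (SOME p. en e = {fst p, snd p})"
  have "en e = {fst p, snd p}" unfolding p_def by (rule someI[of _ "(a, b)"]) (use assms in simp)
  then have "(fst p = a \<and> snd p = b) \<or> (fst p = b \<and> snd p = a)" using assms by (auto simp: doubleton_eq_iff)
  then show ?thesis by (auto simp: grad_def p_def[symmetric])
qed

lemma grad_mult: "en e = {a, b} \<Longrightarrow> grad en u e * grad en w e = (u a - u b) * (w a - w b)"
proof -
  assume "en e = {a, b}"
  from grad_cases[of en, OF this] obtain c :: real
    where c: "c * c = 1" "\<And>u. grad en u e = c * (u a - u b)"
  proof (elim disjE)
    assume "\<And>c. c * c = 1 \<Longrightarrow> (\<And>u. grad en u e = c * (u a - u b)) \<Longrightarrow> thesis" "\<forall>u. grad en u e = u a - u b"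
    then show thesis by (metis mult_1)
  next
    assume *: "\<And>c. c * c = 1 \<Longrightarrow> (\<And>u. grad en u e = c * (u a - u b)) \<Longrightarrow> thesis" "\<forall>u. grad en u e = u b - u a"
    show thesis by (rule *(1)[of "-1"]) (use *(2) in auto)
  qed
  have "grad en u e * grad en w e = (c * c) * ((u a - u b) * (w a - w b))"
    unfolding c(2) by (simp only: mult_ac)
  then show ?thesis using c(1) by simp
qed

lemma grad_eq_0: "en e = {a, b} \<Longrightarrow> u a = u b \<Longrightarrow> grad en u e = 0"
  using grad_cases[of en e a b] by auto

lemma grad_sum: "grad en (\<lambda>z. \<Sum>i\<in>I. u i z) e = (\<Sum>i\<in>I. grad en (u i) e)"
  by (simp add: grad_def Let_def sum_subtractf)

definition side :: "('e \<Rightarrow> 'v set) \<Rightarrow> 'v \<Rightarrow> 'e set \<Rightarrow> 'v \<Rightarrow> real" where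
  "side en x F z = of_bool ((x, z) \<in> conn en F)"

text \<open>
  The edges whose deletion separates \<open>x\<close> from \<open>y\<close> are those of the tree path, and the gradient of
  the indicator of the side of \<open>x\<close> orients them from \<open>x\<close> to \<open>y\<close>; so the sum telescopes.
\<close>

lemma potential_difference_along_tree:
  assumes "finite T" "acyc en T" "(x, y) \<in> conn en T"
  shows "u x - u y = (\<Sum>e\<in>T. if (x, y) \<in> conn en (T - {e}) then 0
    else grad en u e * grad en (side en x (T - {e})) e)"
  using assms(3)
proof (induction rule: conn_induct)
  case refl show ?case by simp
next
  case (step y z g)
  define c where "c y e = (if (x, y) \<in> conn en (T - {e}) then 0
    else grad en u e * grad en (side en x (T - {e})) e)" for y e
  have other: "c y e = c z e" if "e \<in> T - {g}" for e
  proof -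
    have "(y, z) \<in> conn en (T - {e})" using step that by (intro conn_edge[of g]) auto
    then have "(x, y) \<in> conn en (T - {e}) \<longleftrightarrow> (x, z) \<in> conn en (T - {e})" by (meson conn_sym conn_trans)
    then show ?thesis by (simp add: c_def)
  qed
  have n: "(y, z) \<notin> conn en (T - {g})" using acyc_notin[OF assms(2) step(2,3)] .
  have "insert g (T - {g}) = T" using step by auto
  then have "(x, y) \<in> conn en (T - {g}) \<or> (x, z) \<in> conn en (T - {g})"
    using step(1) conn_insert[of en g y z x y "T - {g}"] step(3) by auto
  moreover have "\<not> ((x, y) \<in> conn en (T - {g}) \<and> (x, z) \<in> conn en (T - {g}))"
    using n by (meson conn_sym conn_trans)
  ultimately have "c z g - c y g = u y - u z"
    using grad_mult[of en g y z u "side en x (T - {g})"] step(3) by (auto simp: c_def side_def)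
  then have "sum (c z) T - sum (c y) T = u y - u z"
    using assms(1) step(2) other sum.remove[of T g "c z"] sum.remove[of T g "c y"]
      sum.cong[of "T - {g}" "T - {g}" "c y" "c z"] by simp
  moreover have "u x - u y = sum (c y) T" using step(4) by (simp add: c_def)
  ultimately have "u x - u z = sum (c z) T" by simp
  then show ?case by (simp add: c_def)
qed

definition trees_with :: "('v, 'e) mgraph \<Rightarrow> 'e set \<Rightarrow> 'e set set" where
  "trees_with G B = {T \<in> spanning_trees G. B \<subseteq> T}"

text \<open>
  Adding \<open>f\<close> is a bijection to the spanning trees containing \<open>B\<close> and \<open>f\<close>. Seen without \<open>f\<close>, the members
  are the spanning forests with two components, containing \<open>B\<close> and separating the endpoints of \<open>f\<close>.
\<close>

definition cut_forests :: "('v, 'e) mgraph \<Rightarrow> 'e set \<Rightarrow> 'e \<Rightarrow> 'e set set" where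
  "cut_forests G B f = {F. F \<subseteq> edges G - {f} \<and> B \<subseteq> F \<and> insert f F \<in> spanning_trees G}"

text \<open>
  Kirchhoff's voltage in the graph without \<open>f\<close>, with \<open>B\<close> contracted, when a current flows from the
  endpoint \<open>x\<close> of \<open>f\<close> to the other one, up to the normalisation by the number of spanning trees.
\<close>

definition potential :: "('v, 'e) mgraph \<Rightarrow> 'e set \<Rightarrow> 'e \<Rightarrow> 'v \<Rightarrow> 'v \<Rightarrow> real" where
  "potential G B f x z = (\<Sum>F\<in>cut_forests G B f. side (ends G) x F z)"

lemma finite_spanning_trees [simp]: "finite_mgraph G \<Longrightarrow> finite (spanning_trees G)"
  by (rule finite_subset[of _ "Pow (edges G)"]) (auto simp: spanning_trees_def finite_mgraph_def)

lemma finite_trees_with [simp]: "finite_mgraph G \<Longrightarrow> finite (trees_with G B)"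
  by (simp add: trees_with_def)

lemma finite_cut_forests [simp]: "finite_mgraph G \<Longrightarrow> finite (cut_forests G B f)"
  by (rule finite_subset[of _ "Pow (edges G)"]) (auto simp: cut_forests_def finite_mgraph_def)

lemma cut_forest_separates:
  assumes "wf_mgraph G" "F \<in> cut_forests G B f" "ends G f = {x, y}"
  shows "(x, y) \<notin> conn (ends G) F"
proof -
  have "insert f F - {f} = F" "acyc (ends G) (insert f F)"
    using assms(2) spanning_trees_iff[OF assms(1)] by (auto simp: cut_forests_def)
  then show ?thesis using acyc_notin[of "ends G" "insert f F" f x y] assms(3) by simp
qed

lemma card_cut_forests: 
  assumes "f \<in> edges G" "f \<notin> B"
  shows "card (cut_forests G B f) = card (trees_with G (insert f B))"
proof (rule bij_betw_same_card[of "insert f"])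
  show "bij_betw (insert f) (cut_forests G B f) (trees_with G (insert f B))"
    by (rule bij_betw_byWitness[where f' = "\<lambda>T. T - {f}"])
       (use assms in \<open>auto simp: cut_forests_def trees_with_def spanning_trees_def insert_absorb\<close>)
qed

lemma potential_drop:
  assumes "wf_mgraph G" "ends G f = {x, y}"
  shows "potential G B f x x - potential G B f x y = card (cut_forests G B f)"
proof -
  have "potential G B f x x = card (cut_forests G B f)" by (simp add: potential_def side_def)
  moreover have "potential G B f x y = 0"
    using cut_forest_separates[OF assms(1) _ assms(2)] by (simp add: potential_def side_def)
  ultimately show ?thesis by simp
qed

lemma potential_const_on:
  assumes "e \<in> B" "ends G e = {a, b}"
  shows "potential G B f x a = potential G B f x b"
  unfolding potential_def
proof (rule sum.cong[OF refl])
  fix F assume "F \<in> cut_forests G B f"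
  then have "(a, b) \<in> conn (ends G) F" using assms by (intro conn_edge[of e]) (auto simp: cut_forests_def)
  then show "side (ends G) x F a = side (ends G) x F b"
    using conn_iff_right[of a b "ends G" F x] by (simp add: side_def)
qed

text \<open>
  A spanning tree minus \<open>f\<close> has two sides; any edge that crosses between them reconnects it.
\<close>

lemma tree_swap:
  assumes wf: "wf_mgraph G" and f: "ends G f = {x, y}" and e: "e \<in> edges G" "ends G e = {a, b}"
    and tree: "insert f F \<in> spanning_trees G" and F: "acyc (ends G) F"
    and xa: "(x, a) \<in> conn (ends G) F" and xb: "(x, b) \<notin> conn (ends G) F"
  shows "insert e F \<in> spanning_trees G"
proof -
  let ?en = "ends G"
  note ST = spanning_trees_iff[OF wf]
  have V: "a \<in> verts G" "b \<in> verts G" using wf e by (auto simp: wf_mgraph_def)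
  have conn_f: "\<forall>u\<in>verts G. \<forall>v\<in>verts G. (u, v) \<in> conn ?en (insert f F)" using tree ST by auto
  then have "(a, b) \<in> conn ?en (insert f F)" using V by auto
  moreover have nab: "(a, b) \<notin> conn ?en F" using conn_trans[OF xa] xb by blast
  ultimately have "(y, b) \<in> conn ?en F"
    using conn_insert[of ?en f x y a b F] f xb by blast
  then have "(b, y) \<in> conn ?en F" by (rule conn_sym)
  then have xy: "(x, y) \<in> conn ?en (insert e F)"
    using conn_insert[of ?en e a b x y F] e(2) xa by simp
  have "conn ?en (insert f F) \<subseteq> conn ?en (insert f (insert e F))" by (rule conn_mono) auto
  also have "\<dots> = conn ?en (insert e F)" using conn_insert_redundant[of ?en f x y "insert e F"] f xy by simp
  finally have "conn ?en (insert f F) \<subseteq> conn ?en (insert e F)" .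
  moreover have "acyc ?en (insert e F)"
    by (rule acyc_insert[of ?en, OF e(2) F nab])
  ultimately show ?thesis using ST tree e(1) conn_f by (auto simp: subset_iff)
qed

text \<open>
  The current identity: the potential has as flow the expected signed traversals, by the tree path
  from \<open>x\<close> to \<open>y\<close>, of a tree that avoids \<open>f\<close>. Deleting an edge of that path turns the pair of a tree
  and an edge into the pair of a cut forest and an edge crossing its cut, and this is reversible.
  Testing against functions constant on the edges of \<open>B\<close> replaces contracting \<open>B\<close>.
\<close>

lemma kirchhoff:
  assumes wf: "wf_mgraph G" and fin: "finite_mgraph G" and f: "f \<in> edges G" "ends G f = {x, y}" 
    and B: "f \<notin> B"
    and u: "\<And>e a b. e \<in> B \<Longrightarrow> ends G e = {a, b} \<Longrightarrow> u a = u b"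
  shows "(\<Sum>e\<in>edges G - {f}. grad (ends G) u e * grad (ends G) (potential G B f x) e) =
    real (card {T \<in> trees_with G B. f \<notin> T}) * (u x - u y)"
proof -
  let ?en = "ends G" and ?C = "cut_forests G B f"
  let ?T0 = "{T \<in> trees_with G B. f \<notin> T}"
  note ST = spanning_trees_iff[OF wf]
  have finE: "finite (edges G)" using fin by (simp add: finite_mgraph_def)
  define g where "g = (\<lambda>F e. grad ?en u e * grad ?en (side ?en x F) e)"
  define c where "c = (\<lambda>T e. if (x, y) \<in> conn ?en (T - {e}) then 0 else g (T - {e}) e)"
  \<comment> \<open>The two index sets matched by the bijection: a cut forest with a crossing edge, and a tree
    with a path edge outside \<open>B\<close>.\<close>
  define S1 where "S1 = {(F, e). F \<in> ?C \<and> e \<in> edges G - {f} \<and> e \<notin> F \<and> insert e F \<in> spanning_trees G}"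
  define S2 where "S2 = {(T, e). T \<in> ?T0 \<and> e \<in> T \<and> e \<notin> B \<and> T - {e} \<in> ?C}"
  have "(\<Sum>e\<in>edges G - {f}. grad ?en u e * grad ?en (potential G B f x) e) = (\<Sum>e\<in>edges G - {f}. \<Sum>F\<in>?C. g F e)"
    unfolding potential_def g_def by (simp add: grad_sum sum_distrib_left)
  also have "\<dots> = (\<Sum>F\<in>?C. \<Sum>e\<in>edges G - {f}. g F e)" by (rule sum.swap)
  also have "\<dots> = (\<Sum>(F, e)\<in>?C \<times> (edges G - {f}). g F e)" by (simp add: sum.cartesian_product)
  also have "\<dots> = (\<Sum>(F, e)\<in>S1. g F e)"
  proof (rule sum.mono_neutral_right)
    show "finite (?C \<times> (edges G - {f}))" using fin finE by auto
    show "S1 \<subseteq> ?C \<times> (edges G - {f})" by (auto simp: S1_def)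
    have "g F e = 0" if F: "F \<in> ?C" and e: "e \<in> edges G" "e \<noteq> f" "(F, e) \<notin> S1" for F e
    proof -
      obtain a b where ab: "?en e = {a, b}" using wf_ends[OF wf e(1)] .
      have "side ?en x F a = side ?en x F b"
      proof (cases "e \<in> F")
        case True
        then have "(a, b) \<in> conn ?en F" using ab by (rule conn_edge)
        then show ?thesis using conn_iff_right[of a b "ends G" F x] by (simp add: side_def)
      next
        case False
        then have no: "insert e F \<notin> spanning_trees G" using F e by (auto simp: S1_def)
        have t: "insert f F \<in> spanning_trees G" using F by (auto simp: cut_forests_def)
        then have ac: "acyc ?en F" using acyc_subset[of ?en "insert f F" F] ST by auto
        have ba: "?en e = {b, a}" using ab by auto
        show ?thesis
          using tree_swap[OF wf f(2) e(1) ab t ac] tree_swap[OF wf f(2) e(1) ba t ac] no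
          by (auto simp: side_def)
      qed
      then show ?thesis unfolding g_def using grad_eq_0[of "ends G", OF ab] by simp
    qed
    then show "\<forall>p\<in>?C \<times> (edges G - {f}) - S1. (case p of (F, e) \<Rightarrow> g F e) = 0" by auto
  qed
  also have "\<dots> = (\<Sum>(T, e)\<in>S2. g (T - {e}) e)"
  proof (rule sum.reindex_bij_witness[where i = "\<lambda>(T, e). (T - {e}, e)" and j = "\<lambda>(F, e). (insert e F, e)"])
    show "(\<lambda>(F, e). (insert e F, e)) p \<in> S2" if "p \<in> S1" for p
      using that by (auto simp: S1_def S2_def trees_with_def cut_forests_def)
    show "(\<lambda>(T, e). (T - {e}, e)) p \<in> S1" if "p \<in> S2" for p
      using that by (auto simp: S1_def S2_def trees_with_def spanning_trees_def insert_absorb)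
  qed (auto simp: S1_def S2_def insert_absorb)
  also have "\<dots> = (\<Sum>(T, e)\<in>S2. c T e)"
  proof (rule sum.cong[OF refl], clarify)
    fix T e assume "(T, e) \<in> S2"
    then show "g (T - {e}) e = c T e"
      using cut_forest_separates[OF wf, of "T - {e}" B f x y] f(2) by (auto simp: S2_def c_def)
  qed
  also have "\<dots> = (\<Sum>(T, e)\<in>Sigma ?T0 (\<lambda>T. T). c T e)"
  proof (rule sum.mono_neutral_left)
    show "finite (Sigma ?T0 (\<lambda>T. T))"
      using fin finE by (intro finite_SigmaI) (auto simp: trees_with_def spanning_trees_def intro: finite_subset)
    show "S2 \<subseteq> Sigma ?T0 (\<lambda>T. T)" by (auto simp: S2_def)
    have "c T e = 0" if T: "T \<in> trees_with G B" "f \<notin> T" and e: "e \<in> T" "(T, e) \<notin> S2" for T e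
    proof -
      have TS: "T \<in> spanning_trees G" "B \<subseteq> T" "T \<subseteq> edges G" "acyc ?en T"
        using T ST by (auto simp: trees_with_def)
      have eE: "e \<in> edges G" using TS e by auto
      obtain a b where ab: "?en e = {a, b}" using wf_ends[OF wf eE] .
      show ?thesis
      proof (cases "e \<in> B")
        case True
        then have "grad ?en u e = 0" using u[OF True ab] grad_eq_0[of "ends G", OF ab] by simp
        then show ?thesis by (simp add: c_def g_def)
      next
        case False
        then have no: "T - {e} \<notin> ?C" using e T by (auto simp: S2_def)
        have "(x, y) \<in> conn ?en (T - {e})"
        proof (rule ccontr)
          assume n: "(x, y) \<notin> conn ?en (T - {e})"
          have t: "insert e (T - {e}) \<in> spanning_trees G" using e TS by (simp add: insert_absorb)
          have ac: "acyc ?en (T - {e})" using acyc_subset[OF TS(4)] by auto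
          have "x \<in> verts G" "y \<in> verts G" using wf f by (auto simp: wf_mgraph_def)
          then have "(x, y) \<in> conn ?en (insert e (T - {e}))" using t ST by auto
          then consider "(x, a) \<in> conn ?en (T - {e})" | "(x, b) \<in> conn ?en (T - {e})"
            unfolding conn_insert[of ?en, OF ab] using n by blast
          then have "insert f (T - {e}) \<in> spanning_trees G"
          proof cases
            case 1
            have "(a, x) \<in> conn ?en (T - {e})" "(a, y) \<notin> conn ?en (T - {e})"
              using 1 n by (meson conn_sym conn_trans)+
            then show ?thesis by (rule tree_swap[OF wf ab f t ac])
          next
            case 2
            have ba: "?en e = {b, a}" using ab by auto
            have "(b, x) \<in> conn ?en (T - {e})" "(b, y) \<notin> conn ?en (T - {e})"
              using 2 n by (meson conn_sym conn_trans)+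
            then show ?thesis by (rule tree_swap[OF wf ba f t ac])
          qed
          then have "T - {e} \<in> ?C" using T TS e False by (auto simp: cut_forests_def)
          then show False using no by simp
        qed
        then show ?thesis by (simp add: c_def)
      qed
    qed
    then show "\<forall>p\<in>Sigma ?T0 (\<lambda>T. T) - S2. (case p of (T, e) \<Rightarrow> c T e) = 0" by auto
  qed
  also have "\<dots> = (\<Sum>T\<in>?T0. \<Sum>e\<in>T. c T e)"
    using fin finE by (intro sum.Sigma[symmetric]) (auto simp: trees_with_def spanning_trees_def intro: finite_subset)
  also have "\<dots> = (\<Sum>T\<in>?T0. u x - u y)"
  proof (rule sum.cong[OF refl])
    fix T assume "T \<in> ?T0"
    then have T: "T \<subseteq> edges G" "acyc ?en T" "\<forall>u\<in>verts G. \<forall>v\<in>verts G. (u, v) \<in> conn ?en T"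
      using ST by (auto simp: trees_with_def)
    have "x \<in> verts G" "y \<in> verts G" using wf f by (auto simp: wf_mgraph_def)
    then have "(x, y) \<in> conn ?en T" using T by auto
    moreover have "finite T" using T finE by (auto intro: finite_subset)
    ultimately show "(\<Sum>e\<in>T. c T e) = u x - u y"
      using potential_difference_along_tree[of T ?en x y u] T(2) by (simp add: c_def g_def cong: if_cong)
  qed
  finally show ?thesis by simp
qed

text \<open>
  The vertex map sends each edge either to the edge with the same label or to a single vertex. This
  covers adding edges and vertices as well as identifying vertices.
\<close>

definition contracts :: "('v \<Rightarrow> 'w) \<Rightarrow> ('v, 'e) mgraph \<Rightarrow> ('w, 'e) mgraph \<Rightarrow> bool" where
  "contracts \<pi> G G' \<longleftrightarrow> (\<forall>e\<in>edges G. (e \<in> edges G' \<and> ends G' e = \<pi> ` ends G e) \<or> (\<exists>c. \<pi> ` ends G e = {c}))"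

text \<open>
  Given \<open>B\<close>, the probability of \<open>f\<close> is \<open>R / (1 + R)\<close> with \<open>R\<close> the (possibly infinite) effective resistance
  between the endpoints of \<open>f\<close> once \<open>f\<close> is deleted and \<open>B\<close> contracted, and \<open>R\<close> can only drop from \<open>G\<close> to \<open>G'\<close>:
  the potential of \<open>G'\<close>, pulled back to \<open>G\<close>, has no more energy than in \<open>G'\<close>, and pairing it with the
  potential of \<open>G\<close> by Cauchy-Schwarz compares the two resistances.
\<close>

lemma rayleigh_step:
  fixes G :: "('v, 'e) mgraph" and G' :: "('w, 'e) mgraph"
  assumes wf: "wf_mgraph G" "wf_mgraph G'" and fin: "finite_mgraph G" "finite_mgraph G'"
    and con: "contracts \<pi> G G'"
    and B: "insert f B \<subseteq> edges G" "insert f B \<subseteq> edges G'" "\<And>e. e \<in> insert f B \<Longrightarrow> ends G' e = \<pi> ` ends G e"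
    and f: "f \<notin> B"
  shows "card (trees_with G' (insert f B)) * card (trees_with G B) \<le> card (trees_with G (insert f B)) * card (trees_with G' B)"
proof -
  have fE: "f \<in> edges G" "f \<in> edges G'" using B by auto
  obtain x y where xy: "ends G f = {x, y}" using wf_ends[OF wf(1) fE(1)] .
  have xy': "ends G' f = {\<pi> x, \<pi> y}" using B(3)[of f] xy by auto
  let ?h = "potential G B f x" and ?h' = "potential G' B f (\<pi> x)"
  \<comment> \<open>Resistances are \<open>n / t\<close> and \<open>n' / t'\<close>: trees with \<open>f\<close> against trees without it.\<close>
  define n where "n = real (card (trees_with G (insert f B)))"
  define n' where "n' = real (card (trees_with G' (insert f B)))"
  define t where "t = real (card {T \<in> trees_with G B. f \<notin> T})"
  define t' where "t' = real (card {T \<in> trees_with G' B. f \<notin> T})"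
  have split: "card (trees_with H B) = card {T \<in> trees_with H B. f \<notin> T} + card (trees_with H (insert f B))"
    if "finite_mgraph H" for H :: "('x, 'e) mgraph"
  proof -
    have "trees_with H B = {T \<in> trees_with H B. f \<notin> T} \<union> trees_with H (insert f B)" by (auto simp: trees_with_def)
    moreover have "{T \<in> trees_with H B. f \<notin> T} \<inter> trees_with H (insert f B) = {}" by (auto simp: trees_with_def)
    ultimately show ?thesis using that card_Un_disjoint[of "{T \<in> trees_with H B. f \<notin> T}" "trees_with H (insert f B)"] by simp
  qed
  have drop: "?h x - ?h y = n" "?h' (\<pi> x) - ?h' (\<pi> y) = n'"
    using potential_drop[OF wf(1) xy, of B] potential_drop[OF wf(2) xy', of B]
      card_cut_forests[OF fE(1) f] card_cut_forests[OF fE(2) f] by (auto simp: n_def n'_def)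
  have pull: "(?h' \<circ> \<pi>) a = (?h' \<circ> \<pi>) b" if "e \<in> B" "ends G e = {a, b}" for e a b
    using potential_const_on[of e B G' "\<pi> a" "\<pi> b" f "\<pi> x"] B(3)[of e] that by auto
  \<comment> \<open>The energies of the two potentials and, between them, the pairing of the first with the pulled
    back second one.\<close>
  have 1: "(\<Sum>e\<in>edges G - {f}. (grad (ends G) ?h e)\<^sup>2) = t * n"
    using kirchhoff[OF wf(1) fin(1) fE(1) xy f, of ?h] potential_const_on[of _ B G _ _ f x] drop
    by (simp add: power2_eq_square t_def)
  have 2: "(\<Sum>e\<in>edges G - {f}. grad (ends G) (?h' \<circ> \<pi>) e * grad (ends G) ?h e) = t * n'"
    using kirchhoff[OF wf(1) fin(1) fE(1) xy f, of "?h' \<circ> \<pi>"] pull drop by (simp add: t_def)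
  have 3: "(\<Sum>e\<in>edges G' - {f}. (grad (ends G') ?h' e)\<^sup>2) = t' * n'"
    using kirchhoff[OF wf(2) fin(2) fE(2) xy' f, of ?h'] potential_const_on[of _ B G' _ _ f "\<pi> x"] drop
    by (simp add: power2_eq_square t'_def)
  have 4: "(\<Sum>e\<in>edges G - {f}. (grad (ends G) (?h' \<circ> \<pi>) e)\<^sup>2) \<le> (\<Sum>e\<in>edges G' - {f}. (grad (ends G') ?h' e)\<^sup>2)"
  proof -
    have val: "(grad (ends G) (?h' \<circ> \<pi>) e)\<^sup>2 = 0 \<or> 
        (e \<in> edges G' \<and> (grad (ends G) (?h' \<circ> \<pi>) e)\<^sup>2 = (grad (ends G') ?h' e)\<^sup>2)" if e: "e \<in> edges G" for e
    proof -
      obtain a b where ab: "ends G e = {a, b}" using wf_ends[OF wf(1) e] .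
      show ?thesis
      proof (cases "e \<in> edges G' \<and> ends G' e = \<pi> ` ends G e")
        case True
        then have "ends G' e = {\<pi> a, \<pi> b}" using ab by auto
        then show ?thesis using grad_mult[of "ends G", OF ab, of "?h' \<circ> \<pi>" "?h' \<circ> \<pi>"] True
            grad_mult[of "ends G'" e "\<pi> a" "\<pi> b" ?h' ?h'] by (simp add: power2_eq_square)
      next
        case False
        then obtain c where "\<pi> ` ends G e = {c}" using con e by (auto simp: contracts_def)
        then have "\<pi> a = \<pi> b" using ab by auto
        then show ?thesis using grad_eq_0[of "ends G", OF ab, of "?h' \<circ> \<pi>"] by simp
      qed
    qed
    have "(\<Sum>e\<in>edges G - {f}. (grad (ends G) (?h' \<circ> \<pi>) e)\<^sup>2) = 
        (\<Sum>e\<in>{e\<in>edges G - {f}. (grad (ends G) (?h' \<circ> \<pi>) e)\<^sup>2 \<noteq> 0}. (grad (ends G) (?h' \<circ> \<pi>) e)\<^sup>2)"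
      using fin by (intro sum.mono_neutral_right) (auto simp: finite_mgraph_def)
    also have "\<dots> = (\<Sum>e\<in>{e\<in>edges G - {f}. (grad (ends G) (?h' \<circ> \<pi>) e)\<^sup>2 \<noteq> 0}. (grad (ends G') ?h' e)\<^sup>2)"
      using val by (intro sum.cong) auto
    also have "\<dots> \<le> (\<Sum>e\<in>edges G' - {f}. (grad (ends G') ?h' e)\<^sup>2)"
      using val fin by (intro sum_mono2) (auto simp: finite_mgraph_def)
    finally show ?thesis .
  qed
  have nn: "n \<ge> 0" "n' \<ge> 0" "t \<ge> 0" "t' \<ge> 0" by (auto simp: n_def n'_def t_def t'_def)
  have "(t * n')\<^sup>2 \<le> (\<Sum>e\<in>edges G - {f}. (grad (ends G) (?h' \<circ> \<pi>) e)\<^sup>2) * (t * n)"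
    unfolding 2[symmetric] 1[symmetric] by (rule Cauchy_Schwarz_ineq_sum)
  also have "\<dots> \<le> (t' * n') * (t * n)" using 4 3 nn by (intro mult_right_mono) auto
  finally have "(t * n') * (t * n') \<le> (t * n') * (t' * n)" by (simp add: power2_eq_square algebra_simps)
  then have "t * n' \<le> t' * n"
  proof (cases "t * n' = 0")
    case True
    then show ?thesis using mult_nonneg_nonneg[OF nn(4,1)] by linarith
  next
    case False
    then have "t * n' > 0" using nn by (simp add: less_le)
    then show ?thesis using \<open>(t * n') * (t * n') \<le> (t * n') * (t' * n)\<close> by (rule_tac mult_left_le_imp_le) auto
  qed
  then have "n' * (t + n) \<le> n * (t' + n')" by (simp add: algebra_simps)
  then have "real (card (trees_with G' (insert f B)) * card (trees_with G B)) \<le> real (card (trees_with G (insert f B)) * card (trees_with G' B))"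
    unfolding split[OF fin(1)] split[OF fin(2)] by (simp add: n_def n'_def t_def t'_def)
  then show ?thesis by (rule of_nat_le_iff[THEN iffD1])
qed

lemma trees_with_antimono: "A \<subseteq> B \<Longrightarrow> trees_with G B \<subseteq> trees_with G A"
  by (auto simp: trees_with_def)

text \<open>
  Multiply the comparisons of the conditional probabilities of the edges of \<open>B\<close>, revealed one by one.
\<close>

lemma rayleigh:
  fixes G :: "('v, 'e) mgraph" and G' :: "('w, 'e) mgraph"
  assumes wf: "wf_mgraph G" "wf_mgraph G'" and fin: "finite_mgraph G" "finite_mgraph G'"
    and con: "contracts \<pi> G G'"
    and "finite B" "B \<subseteq> edges G" "B \<subseteq> edges G'" "\<And>e. e \<in> B \<Longrightarrow> ends G' e = \<pi> ` ends G e"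
    and pos: "card (trees_with G {}) > 0"
  shows "card (trees_with G' B) * card (trees_with G {}) \<le> card (trees_with G B) * card (trees_with G' {})"
  using assms(6-9)
proof (induction rule: finite_induct)
  case empty show ?case by simp
next
  case (insert f B)
  let ?a = "card (trees_with G B)" and ?b = "card (trees_with G' B)"
  let ?c = "card (trees_with G (insert f B))" and ?d = "card (trees_with G' (insert f B))"
  let ?g = "card (trees_with G {})" and ?h = "card (trees_with G' {})"
  have IH: "?b * ?g \<le> ?a * ?h" using insert by auto
  have st: "?d * ?a \<le> ?c * ?b" by (rule rayleigh_step[OF wf fin con]) (use insert in auto)
  show ?case
  proof (cases "?a = 0")
    case True
    then have "?b = 0" using IH pos by simp
    moreover have "?d \<le> ?b" using fin by (intro card_mono trees_with_antimono) auto
    ultimately show ?thesis by simp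
  next
    case False
    have "(?d * ?g) * ?a = (?d * ?a) * ?g" by simp
    also have "\<dots> \<le> (?c * ?b) * ?g" using st by (intro mult_right_mono) auto
    also have "\<dots> = ?c * (?b * ?g)" by simp
    also have "\<dots> \<le> ?c * (?a * ?h)" using IH by (intro mult_left_mono) auto
    also have "\<dots> = (?c * ?h) * ?a" by simp
    finally show ?thesis using False by simp
  qed
qed

text \<open>
  In a minimal edge set joining all the vertices, every edge is a bridge.
\<close>

lemma spanning_tree_exists:
  assumes wf: "wf_mgraph G" and fin: "finite_mgraph G" and con: "connected_mgraph G"
  shows "spanning_trees G \<noteq> {}"
proof -
  let ?en = "ends G"
  define S where "S = {F. F \<subseteq> edges G \<and> (\<forall>u\<in>verts G. \<forall>v\<in>verts G. (u, v) \<in> conn ?en F)}"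
  have "edges G \<in> S" using con by (auto simp: S_def connected_mgraph_def joined_iff_conn)
  moreover have "finite S" 
    using fin by (intro finite_subset[of S "Pow (edges G)"]) (auto simp: S_def finite_mgraph_def)
  ultimately obtain T where T: "T \<in> S" "\<And>F. F \<in> S \<Longrightarrow> F \<subseteq> T \<Longrightarrow> F = T"
    using finite_has_minimal[of S] by blast
  have "acyc ?en T"
    unfolding acyc_def
  proof (intro ballI allI impI notI)
    fix e a b assume e: "e \<in> T" "?en e = {a, b}" "(a, b) \<in> conn ?en (T - {e})"
    have "conn ?en (insert e (T - {e})) = conn ?en (T - {e})" using conn_insert_redundant[of ?en, OF e(2,3)] .
    then have "T - {e} \<in> S" using T(1) e by (auto simp: S_def insert_absorb)
    then show False using T(2)[of "T - {e}"] e by auto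
  qed
  then have "T \<in> spanning_trees G"
    using spanning_trees_iff[OF wf] T(1) con by (auto simp: S_def connected_mgraph_def)
  then show ?thesis by auto
qed

text \<open>
  The events \<open>B \<subseteq> T\<close> determine the law of \<open>T\<close>, and they are the ones that Rayleigh monotonicity compares.
\<close>

definition UST_prob :: "('v, 'e) mgraph \<Rightarrow> 'e set \<Rightarrow> real" where
  "UST_prob G B = measure_pmf.prob (UST G) {T. B \<subseteq> T}"

lemma UST_prob_eq:
  assumes "wf_mgraph G" "finite_mgraph G" "connected_mgraph G"
  shows "UST_prob G B = real (card (trees_with G B)) / real (card (spanning_trees G))"
proof -
  have "spanning_trees G \<inter> {T. B \<subseteq> T} = trees_with G B" by (auto simp: trees_with_def)
  then show ?thesis using spanning_tree_exists[OF assms] assms(2)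
    by (simp add: UST_prob_def UST_def measure_pmf_of_set)
qed

lemma UST_prob_contracts:
  fixes G :: "('v, 'e) mgraph" and G' :: "('w, 'e) mgraph"
  assumes G: "wf_mgraph G" "finite_mgraph G" "connected_mgraph G"
    and G': "wf_mgraph G'" "finite_mgraph G'" "connected_mgraph G'"
    and con: "contracts \<pi> G G'"
    and B: "B \<subseteq> edges G" "B \<subseteq> edges G'" "\<And>e. e \<in> B \<Longrightarrow> ends G' e = \<pi> ` ends G e"
  shows "UST_prob G' B \<le> UST_prob G B"
proof -
  have [simp]: "trees_with G {} = spanning_trees G" "trees_with G' {} = spanning_trees G'" by (auto simp: trees_with_def)
  have pos: "card (spanning_trees G) > 0" "card (spanning_trees G') > 0"
    using spanning_tree_exists[OF G] spanning_tree_exists[OF G'] G G' by (auto simp: card_gt_0_iff)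
  have finB: "finite B" using B G by (auto simp: finite_mgraph_def intro: finite_subset)
  have "card (trees_with G' B) * card (spanning_trees G) \<le> card (trees_with G B) * card (spanning_trees G')"
    using rayleigh[OF G(1) G'(1) G(2) G'(2) con finB B] pos by simp
  then have "real (card (trees_with G' B)) * card (spanning_trees G) \<le> real (card (trees_with G B)) * card (spanning_trees G')"
    by (metis of_nat_le_iff of_nat_mult)
  then show ?thesis using pos
    by (simp add: UST_prob_eq[OF G] UST_prob_eq[OF G'] field_simps)
qed

section \<open>Resampling a uniform spanning tree inside an edge set\<close>

text \<open>
  A spanning forest of the clusters of \<open>F\<close> may replace \<open>F\<close> inside any larger forest: \<open>F'\<close> is turned
  into a subset of \<open>F\<close> by exchanging one edge at a time, and each exchange keeps the clusters.
\<close>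

lemma forest_exchange:
  assumes wf: "\<And>e. e \<in> F \<union> F' \<Longrightarrow> \<exists>a b. en e = {a, b}"
    and F: "acyc en (Q \<union> F)" "Q \<inter> F = {}"
    and F': "acyc en F'" "finite F'" "conn en F' = conn en F"
  shows "acyc en (Q \<union> F')"
  using F' wf
proof (induction "card (F' - F)" arbitrary: F')
  case 0
  then have "F' \<subseteq> F" by simp
  then show ?case by (intro acyc_subset[OF F(1)]) auto
next
  case (Suc n)
  then obtain e where e: "e \<in> F'" "e \<notin> F" by (metis Diff_iff card.empty ex_in_conv old.nat.distinct(2))
  obtain a b where ab: "en e = {a, b}" using Suc.prems(4)[of e] e by auto
  let ?D = "F' - {e}"
  have F'_eq: "insert e ?D = F'" using e by auto
  have nab: "(a, b) \<notin> conn en ?D" using acyc_notin[OF Suc.prems(1) e(1) ab] .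
  have "(a, b) \<in> conn en F" using conn_edge[of e F' en a b] e ab Suc.prems(3) by auto
  then have "\<not> conn en F \<subseteq> conn en ?D" using nab by auto
  then obtain f c d where f: "f \<in> F" "en f = {c, d}" "(c, d) \<notin> conn en ?D"
    using conn_subsetI[of F en ?D] by metis
  have "f \<noteq> e" using f e by auto
  have fF': "f \<notin> F'" using f conn_edge[of f ?D en c d] \<open>f \<noteq> e\<close> by auto
  let ?F2 = "insert f ?D"
  \<comment> \<open>The edge \<open>f\<close> of \<open>F\<close> crosses the cut that deleting \<open>e\<close> makes in \<open>F'\<close>, so it can take the place of \<open>e\<close>.\<close>
  have cd: "(c, d) \<in> conn en F'" using f conn_edge[of f F en c d] Suc.prems(3) by auto
  then have "(c, d) \<in> conn en (insert e ?D)" unfolding F'_eq .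
  then have "((c, a) \<in> conn en ?D \<and> (b, d) \<in> conn en ?D) \<or> ((c, b) \<in> conn en ?D \<and> (a, d) \<in> conn en ?D)"
    using conn_insert[of en e a b c d ?D] ab f(3) by auto
  then have ab2: "(a, b) \<in> conn en ?F2"
    using conn_insert[of en f c d a b ?D] f(2) conn_sym[of _ _ en ?D] by meson
  have ac2: "acyc en ?F2" using acyc_insert[of en f c d ?D] f(2,3) acyc_subset[OF Suc.prems(1)] by auto
  have "conn en ?F2 = conn en (insert e ?F2)" using conn_insert_redundant[of en e a b ?F2] ab ab2 by simp
  also have "insert e ?F2 = insert f F'" using e by auto
  also have "conn en (insert f F') = conn en F'" using conn_insert_redundant[of en f c d F'] f(2) cd by simp
  finally have "conn en ?F2 = conn en F'" .
  moreover have "?F2 - F = (F' - F) - {e}" using f by auto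
  then have "n = card (?F2 - F)" using Suc.hyps(2) e Suc.prems(2) by simp
  moreover have "\<exists>a b. en g = {a, b}" if "g \<in> F \<union> ?F2" for g using Suc.prems(4)[of g] that f by auto
  ultimately have IH: "acyc en (Q \<union> ?F2)"
    using Suc.hyps(1)[of ?F2] Suc.prems ac2 by auto
  let ?A = "Q \<union> ?D"
  show ?case
  proof (cases "e \<in> Q")
    case True
    then show ?thesis by (intro acyc_subset[OF IH]) auto
  next
    case False
    have "f \<notin> ?A" using fF' f F(2) by auto
    then have "Q \<union> ?F2 - {f} = ?A" by auto
    then have ncd: "(c, d) \<notin> conn en ?A" using acyc_notin[OF IH, of f c d] f by auto
    have "(a, b) \<notin> conn en ?A"
    proof
      assume "(a, b) \<in> conn en ?A"
      then have "conn en (insert e ?A) = conn en ?A" using conn_insert_redundant[of en e a b ?A] ab by simp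
      moreover have "conn en F' \<subseteq> conn en (insert e ?A)" using e by (intro conn_mono) auto
      ultimately show False using cd ncd by auto
    qed
    moreover have "acyc en ?A" by (intro acyc_subset[OF IH]) auto
    ultimately have "acyc en (insert e ?A)" using acyc_insert[of en e a b ?A] ab by simp
    moreover have "insert e ?A = Q \<union> F'" using e by auto
    ultimately show ?thesis by simp
  qed
qed

definition forests_clustered_as :: "('e \<Rightarrow> 'v set) \<Rightarrow> 'e set \<Rightarrow> 'e set \<Rightarrow> 'e set set" where
  "forests_clustered_as en S A = {F. F \<subseteq> S \<and> acyc en F \<and> conn en F = conn en A}"

text \<open>
  The probability that a uniform forest with the clusters of \<open>A\<close> contains \<open>B\<close>.
\<close>

definition forest_ratio :: "('e \<Rightarrow> 'v set) \<Rightarrow> 'e set \<Rightarrow> 'e set \<Rightarrow> 'e set \<Rightarrow> real" where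
  "forest_ratio en S A B =
     real (card {F \<in> forests_clustered_as en S A. B \<subseteq> F}) / real (card (forests_clustered_as en S A))"

lemma spanning_tree_resample:
  assumes wf: "wf_mgraph G" and fin: "finite_mgraph G" and S: "S \<subseteq> edges G"
    and T: "T \<in> spanning_trees G" and F: "F \<in> forests_clustered_as (ends G) S (T \<inter> S)"
  shows "(T - S) \<union> F \<in> spanning_trees G"
proof -
  let ?en = "ends G"
  note ST = spanning_trees_iff[OF wf]
  have F': "F \<subseteq> S" "acyc ?en F" "conn ?en F = conn ?en (T \<inter> S)" using F by (auto simp: forests_clustered_as_def)
  have TT: "(T - S) \<union> (T \<inter> S) = T" by auto
  have "finite F" using F'(1) S fin by (auto simp: finite_mgraph_def intro: finite_subset)
  moreover have "\<exists>a b. ?en e = {a, b}" if "e \<in> T \<inter> S \<union> F" for e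
  proof -
    have eG: "e \<in> edges G" using that F'(1) S by auto
    show ?thesis using wf_ends[OF wf eG] by metis
  qed
  ultimately have "acyc ?en ((T - S) \<union> F)"
    using forest_exchange[of "T \<inter> S" F ?en "T - S"] F' T ST TT by auto
  moreover have "conn ?en ((T - S) \<union> F) = conn ?en T"
    using conn_Un_cong[OF F'(3), of "T - S"] TT by simp
  ultimately show ?thesis using T ST F'(1) S by auto
qed

text \<open>
  Whether a forest in \<open>S\<close> completes a given set outside \<open>S\<close> to a spanning tree depends only on its
  clusters. So a uniform spanning tree, given its part outside \<open>S\<close> and the clusters of its part inside,
  is uniform inside \<open>S\<close> among the forests with these clusters.
\<close>

lemma card_trees_with_resample:
  assumes wf: "wf_mgraph G" and fin: "finite_mgraph G" and S: "S \<subseteq> edges G" and B: "B \<subseteq> S"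
  shows "real (card (trees_with G B)) = (\<Sum>T\<in>spanning_trees G. forest_ratio (ends G) S (T \<inter> S) B)"
proof -
  let ?en = "ends G" and ?ST = "spanning_trees G"
  define \<kappa> where "\<kappa> T = (T - S, conn ?en (T \<inter> S))" for T
  have finST: "finite ?ST" using fin by simp
  have "real (card (trees_with G B)) = (\<Sum>T\<in>?ST. of_bool (B \<subseteq> T))"
    using finST by (simp add: trees_with_def Int_def)
  also have "\<dots> = (\<Sum>y\<in>\<kappa> ` ?ST. \<Sum>T\<in>{T\<in>?ST. \<kappa> T = y}. of_bool (B \<subseteq> T))"
    using finST by (rule sum.image_gen)
  also have "\<dots> = (\<Sum>y\<in>\<kappa> ` ?ST. \<Sum>T\<in>{T\<in>?ST. \<kappa> T = y}. forest_ratio ?en S (T \<inter> S) B)"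
  proof (rule sum.cong[OF refl])
    fix y assume "y \<in> \<kappa> ` ?ST"
    then obtain T0 where T0: "T0 \<in> ?ST" "y = \<kappa> T0" by auto
    let ?fib = "{T\<in>?ST. \<kappa> T = y}" and ?LF = "forests_clustered_as ?en S (T0 \<inter> S)"
    have finLF: "finite ?LF" using S fin
      by (intro finite_subset[of ?LF "Pow S"]) (auto simp: forests_clustered_as_def finite_mgraph_def intro: finite_subset)
    have acT: "acyc ?en (T \<inter> S)" if "T \<in> ?ST" for T
    proof -
      have "acyc ?en T" using that spanning_trees_iff[OF wf, of T] by simp
      then show ?thesis by (rule acyc_subset) auto
    qed
    have restr: "(T0 - S) \<union> F \<in> ?fib" "((T0 - S) \<union> F) \<inter> S = F" if "F \<in> ?LF" for F
    proof -
      have "F \<subseteq> S" "conn ?en F = conn ?en (T0 \<inter> S)" using that by (auto simp: forests_clustered_as_def)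
      moreover have i: "((T0 - S) \<union> F) \<inter> S = F" using \<open>F \<subseteq> S\<close> by auto
      moreover have "((T0 - S) \<union> F) - S = T0 - S" using \<open>F \<subseteq> S\<close> by auto
      ultimately show "(T0 - S) \<union> F \<in> ?fib"
        using spanning_tree_resample[OF wf fin S T0(1) that] T0(2) by (simp add: \<kappa>_def)
      show "((T0 - S) \<union> F) \<inter> S = F" by (rule i)
    qed
    have bij: "bij_betw (\<lambda>T. T \<inter> S) ?fib ?LF"
    proof (rule bij_betw_byWitness[where f' = "\<lambda>F. (T0 - S) \<union> F"])
      have "(T0 - S) \<union> (T \<inter> S) = T" if "T \<in> ?fib" for T
        using that T0(2) by (auto simp: \<kappa>_def)
      then show "\<forall>T\<in>?fib. (T0 - S) \<union> (T \<inter> S) = T" by blast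
      have "T \<inter> S \<in> ?LF" if "T \<in> ?fib" for T
        using that T0(2) acT[of T] by (simp add: \<kappa>_def forests_clustered_as_def)
      then show "(\<lambda>T. T \<inter> S) ` ?fib \<subseteq> ?LF" by blast
    qed (use restr in blast)+
    have "(\<Sum>T\<in>?fib. of_bool (B \<subseteq> T)) = (\<Sum>T\<in>?fib. of_bool (B \<subseteq> T \<inter> S))"
      using B by (intro sum.cong) auto
    also have "\<dots> = (\<Sum>F\<in>?LF. of_bool (B \<subseteq> F))"
      by (rule sum.reindex_bij_betw[OF bij])
    also have "\<dots> = real (card {F \<in> ?LF. B \<subseteq> F})" using finLF by (simp add: Int_def)
    also have "\<dots> = real (card ?LF) * forest_ratio ?en S (T0 \<inter> S) B"
    proof (cases "card ?LF = 0")
      case True then show ?thesis using finLF by simp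
    qed (simp add: forest_ratio_def)
    also have "\<dots> = (\<Sum>T\<in>?fib. forest_ratio ?en S (T0 \<inter> S) B)"
      using bij_betw_same_card[OF bij] by simp
    also have "\<dots> = (\<Sum>T\<in>?fib. forest_ratio ?en S (T \<inter> S) B)"
      by (rule sum.cong[OF refl]) (use T0 in \<open>simp add: \<kappa>_def forest_ratio_def forests_clustered_as_def\<close>)
    finally show "(\<Sum>T\<in>?fib. of_bool (B \<subseteq> T)) = (\<Sum>T\<in>?fib. forest_ratio ?en S (T \<inter> S) B)" .
  qed
  also have "\<dots> = (\<Sum>T\<in>?ST. forest_ratio ?en S (T \<inter> S) B)"
    using finST by (rule sum.image_gen[symmetric])
  finally show ?thesis .
qed

lemma UST_prob_resample:
  assumes G: "wf_mgraph G" "finite_mgraph G" "connected_mgraph G" and S: "S \<subseteq> edges G" and B: "B \<subseteq> S"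
  shows "UST_prob G B =
    (\<Sum>A\<in>Pow S. measure_pmf.prob (UST G) {T. T \<inter> S = A} * forest_ratio (ends G) S A B)"
proof -
  let ?ST = "spanning_trees G" and ?r = "\<lambda>A. forest_ratio (ends G) S A B"
  have fin: "finite ?ST" "?ST \<noteq> {}" using spanning_tree_exists[OF G] G by auto
  have finS: "finite (Pow S)" using S G by (auto simp: finite_mgraph_def intro: finite_subset)
  have "(\<Sum>T\<in>?ST. ?r (T \<inter> S)) = (\<Sum>A\<in>Pow S. \<Sum>T\<in>{T\<in>?ST. T \<inter> S = A}. ?r (T \<inter> S))"
    using fin finS by (intro sum.group[symmetric]) auto
  also have "\<dots> = (\<Sum>A\<in>Pow S. real (card {T\<in>?ST. T \<inter> S = A}) * ?r A)"
    by (intro sum.cong refl) simp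
  finally have "UST_prob G B = (\<Sum>A\<in>Pow S. real (card {T\<in>?ST. T \<inter> S = A}) * ?r A) / card ?ST"
    using card_trees_with_resample[OF G(1,2) S B] UST_prob_eq[OF G] by simp
  moreover have "measure_pmf.prob (UST G) {T. T \<inter> S = A} = real (card {T\<in>?ST. T \<inter> S = A}) / card ?ST" for A
    using fin by (simp add: UST_def measure_pmf_of_set Int_def)
  ultimately show ?thesis by (simp add: sum_divide_distrib)
qed

lemma conn_image:
  assumes inj: "inj \<pi>" and im: "\<And>e. e \<in> F \<Longrightarrow> en' e = \<pi> ` en e"
  shows "(\<pi> u, w) \<in> conn en' F \<longleftrightarrow> (\<exists>v. w = \<pi> v \<and> (u, v) \<in> conn en F)"
proof
  assume "(\<pi> u, w) \<in> conn en' F"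
  then show "\<exists>v. w = \<pi> v \<and> (u, v) \<in> conn en F"
  proof (induction rule: conn_induct)
    case refl then show ?case by auto
  next
    case (step y z g)
    then obtain v where v: "y = \<pi> v" "(u, v) \<in> conn en F" by auto
    have g: "\<pi> ` en g = {\<pi> v, z}" using step im v by auto
    then have "z \<in> \<pi> ` en g" by auto
    then obtain t where t: "z = \<pi> t" by auto
    have "en g = {v, t}" using g t inj_image_eq_iff[OF inj, of "en g" "{v, t}"] by simp
    then have "(v, t) \<in> conn en F" using step by (intro conn_edge[of g])
    then show ?case using v t conn_trans by metis
  qed
next
  assume "\<exists>v. w = \<pi> v \<and> (u, v) \<in> conn en F"
  then obtain v where v: "w = \<pi> v" "(u, v) \<in> conn en F" by auto
  from v(2) have "(\<pi> u, \<pi> v) \<in> conn en' F"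
  proof (induction rule: conn_induct)
    case refl then show ?case by simp
  next
    case (step y z g)
    then have "en' g = {\<pi> y, \<pi> z}" using im by auto
    then have "(\<pi> y, \<pi> z) \<in> conn en' F" using step by (intro conn_edge[of g])
    then show ?case using step conn_trans by metis
  qed
  then show "(\<pi> u, w) \<in> conn en' F" using v by simp
qed

lemma conn_outside:
  assumes "u \<notin> range \<pi>" and im: "\<And>e. e \<in> F \<Longrightarrow> en' e = \<pi> ` en e"
  shows "(u, w) \<in> conn en' F \<longleftrightarrow> u = w"
proof
  assume "(u, w) \<in> conn en' F"
  then show "u = w"
  proof (induction rule: conn_induct)
    case (step y z g)
    then have "u \<in> \<pi> ` en g" using im by auto
    then show ?case using assms(1) by auto
  qed simp
qed simp

text \<open>
  Wiring the outside of a finite piece only renames the vertices seen by the edges of the piece.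
\<close>

lemma forests_clustered_as_image:
  assumes inj: "inj \<pi>" and im: "\<And>e. e \<in> S \<Longrightarrow> en' e = \<pi> ` en e" and A: "A \<subseteq> S"
  shows "forests_clustered_as en' S A = forests_clustered_as en S A"
proof -
  have c: "conn en' F = conn en' A \<longleftrightarrow> conn en F = conn en A" if "F \<subseteq> S" for F
  proof
    assume *: "conn en' F = conn en' A"
    have "(u, v) \<in> conn en X \<longleftrightarrow> (\<pi> u, \<pi> v) \<in> conn en' X" if "X \<subseteq> S" for X u v
      using conn_image[OF inj, where F = X and en' = en' and en = en and u = u and w = "\<pi> v"] im that inj
      by (metis injD subsetD)
    then show "conn en F = conn en A" using * that A by (auto simp: set_eq_iff)
  next
    assume *: "conn en F = conn en A"
    have "(x, y) \<in> conn en' X \<longleftrightarrow> (x = y \<or> (\<exists>u v. x = \<pi> u \<and> y = \<pi> v \<and> (u, v) \<in> conn en X))" if "X \<subseteq> S" for X x y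
    proof (cases "x \<in> range \<pi>")
      case True
      then obtain u where "x = \<pi> u" by auto
      have "(\<pi> u, y) \<in> conn en' X \<longleftrightarrow> (\<exists>v. y = \<pi> v \<and> (u, v) \<in> conn en X)"
        by (rule conn_image[OF inj]) (use im that in auto)
      then show ?thesis using inj \<open>x = \<pi> u\<close> by (auto dest: injD)
    next
      case False
      then show ?thesis using conn_outside[of x \<pi> X en' en y] im that by auto
    qed
    then show "conn en' F = conn en' A" using * that A by (auto simp: set_eq_iff)
  qed
  have a: "acyc en' F \<longleftrightarrow> acyc en F" if "F \<subseteq> S" for F
  proof -
    have c1: "(\<pi> a, \<pi> b) \<in> conn en' (F - {e}) \<longleftrightarrow> (a, b) \<in> conn en (F - {e})" for a b e
    proof -
      have "(\<pi> a, \<pi> b) \<in> conn en' (F - {e}) \<longleftrightarrow> (\<exists>v. \<pi> b = \<pi> v \<and> (a, v) \<in> conn en (F - {e}))"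
        by (rule conn_image[OF inj]) (use im that in auto)
      then show ?thesis using inj by (auto dest: injD)
    qed
    have c2: "en' e = {x, y} \<longleftrightarrow> (\<exists>a b. x = \<pi> a \<and> y = \<pi> b \<and> en e = {a, b})" if "e \<in> F" for e x y
    proof
      assume *: "en' e = {x, y}"
      then have eq: "\<pi> ` en e = {x, y}" using im \<open>F \<subseteq> S\<close> that by auto
      then have "x \<in> \<pi> ` en e" "y \<in> \<pi> ` en e" by auto
      then obtain a b where "x = \<pi> a" "y = \<pi> b" by auto
      moreover from this have "en e = {a, b}" using eq inj_image_eq_iff[OF inj, of "en e" "{a, b}"] by simp
      ultimately show "\<exists>a b. x = \<pi> a \<and> y = \<pi> b \<and> en e = {a, b}" by blast
    qed (use im \<open>F \<subseteq> S\<close> that in auto)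
    have "(\<forall>x y. en' e = {x, y} \<longrightarrow> (x, y) \<notin> conn en' (F - {e})) \<longleftrightarrow>
      (\<forall>a b. en e = {a, b} \<longrightarrow> (a, b) \<notin> conn en (F - {e}))" if "e \<in> F" for e
      unfolding c2[OF that] c1[symmetric] by blast
    then show ?thesis unfolding acyc_def by simp
  qed
  show ?thesis using a c by (auto simp: forests_clustered_as_def)
qed

section \<open>Forests as products over components\<close>

definition max_forests :: "('v, 'e) mgraph \<Rightarrow> 'e set set" where
  "max_forests X = forests_clustered_as (ends X) (edges X) (edges X)"

lemma component_of_simps [simp]:
  "verts (component_of X v) = {u \<in> verts X. (v, u) \<in> conn (ends X) (edges X)}"
  "edges (component_of X v) = {e \<in> edges X. ends X e \<subseteq> verts (component_of X v)}"
  "ends (component_of X v) = ends X"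
  by (auto simp: component_of_def joined_iff_conn)

declare component_of_simps(2) [simp del]

lemma wf_component_of: "wf_mgraph X \<Longrightarrow> wf_mgraph (component_of X v)"
  by (auto simp: wf_mgraph_def component_of_simps(2))

lemma finite_component_of: "finite_mgraph X \<Longrightarrow> finite_mgraph (component_of X v)"
  by (auto simp: finite_mgraph_def component_of_simps(2))

text \<open>
  A walk starting in a component never leaves it.
\<close>

lemma conn_in_component:
  assumes wf: "wf_mgraph X" and F: "F \<subseteq> edges X" and u: "u \<in> verts (component_of X v)" 
  shows "(u, w) \<in> conn (ends X) F \<longleftrightarrow> (u, w) \<in> conn (ends X) (F \<inter> edges (component_of X v))"
proof
  let ?K = "component_of X v"
  assume "(u, w) \<in> conn (ends X) F"
  then have "(u, w) \<in> conn (ends X) (F \<inter> edges ?K) \<and> w \<in> verts ?K"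
  proof (induction rule: conn_induct)
    case refl then show ?case using u by simp
  next
    case (step y z g)
    have gX: "g \<in> edges X" using F step by auto
    then have "z \<in> verts X" using wf step by (auto simp: wf_mgraph_def)
    moreover have "(y, z) \<in> conn (ends X) (edges X)" using gX step by (intro conn_edge[of g])
    then have "(v, z) \<in> conn (ends X) (edges X)" using step conn_trans[of v y _ _ z] by auto
    ultimately have z: "z \<in> verts ?K" by simp
    then have "g \<in> edges ?K" using gX step by (auto simp: component_of_simps(2))
    then have "(y, z) \<in> conn (ends X) (F \<inter> edges ?K)" using step by (intro conn_edge[of g]) auto
    then show ?case using z step conn_trans by metis
  qed
  then show "(u, w) \<in> conn (ends X) (F \<inter> edges ?K)" by simp
next
  let ?K = "component_of X v"
  assume "(u, w) \<in> conn (ends X) (F \<inter> edges ?K)"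
  then show "(u, w) \<in> conn (ends X) F" using conn_mono[of "F \<inter> edges ?K" F "ends X"] by auto
qed

lemma connected_component_of:
  assumes wf: "wf_mgraph X" and v: "v \<in> verts X" shows "connected_mgraph (component_of X v)"
proof -
  have "edges X \<inter> edges (component_of X v) = edges (component_of X v)" by (auto simp: component_of_simps(2))
  then have "(u, w) \<in> conn (ends X) (edges (component_of X v))"
    if "u \<in> verts (component_of X v)" "w \<in> verts (component_of X v)" for u w
  proof -
    have "(v, u) \<in> conn (ends X) (edges X)" "(v, w) \<in> conn (ends X) (edges X)" using that by auto
    then have "(u, w) \<in> conn (ends X) (edges X)" by (meson conn_sym conn_trans)
    then show ?thesis using conn_in_component[OF wf order_refl that(1), of w]
      \<open>edges X \<inter> edges (component_of X v) = edges (component_of X v)\<close> by simp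
  qed
  then show ?thesis using v by (auto simp: connected_mgraph_def joined_iff_conn)
qed

lemma component_of_eq_iff:
  assumes "v \<in> verts X" "w \<in> verts X"
  shows "component_of X v = component_of X w \<longleftrightarrow> (v, w) \<in> conn (ends X) (edges X)"
proof
  assume "component_of X v = component_of X w"
  then have "w \<in> verts (component_of X v)" using assms by simp
  then show "(v, w) \<in> conn (ends X) (edges X)" by simp
next
  assume *: "(v, w) \<in> conn (ends X) (edges X)"
  have "(v, u) \<in> conn (ends X) (edges X) \<longleftrightarrow> (w, u) \<in> conn (ends X) (edges X)" for u
    using conn_trans[OF *] conn_trans[OF conn_sym[OF *]] by blast
  then show "component_of X v = component_of X w"
    by (simp add: component_of_def joined_iff_conn)
qed

lemma edge_in_component:
  assumes wf: "wf_mgraph X" and e: "e \<in> edges X" and v: "v \<in> verts X"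
  shows "e \<in> edges (component_of X v) \<longleftrightarrow> (\<exists>a\<in>ends X e. (v, a) \<in> conn (ends X) (edges X))"
proof -
  obtain a b where ab: "ends X e = {a, b}" "a \<in> verts X" "b \<in> verts X" using wf_ends[OF wf e] .
  have "(a, b) \<in> conn (ends X) (edges X)" using e ab by (intro conn_edge)
  then have "(v, a) \<in> conn (ends X) (edges X) \<longleftrightarrow> (v, b) \<in> conn (ends X) (edges X)" by (rule conn_iff_right)
  then show ?thesis using e ab by (auto simp: component_of_simps(2))
qed

lemma ends_nonempty: "wf_mgraph X \<Longrightarrow> e \<in> edges X \<Longrightarrow> ends X e \<noteq> {}"
  by (metis insert_not_empty wf_ends)

lemma edges_disjoint_components:
  assumes wf: "wf_mgraph X" and K: "K \<in> graph_components X" "K' \<in> graph_components X"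
    and e: "e \<in> edges K" "e \<in> edges K'"
  shows "K = K'"
proof -
  obtain v w where v: "v \<in> verts X" "K = component_of X v" and w: "w \<in> verts X" "K' = component_of X w"
    using K by (auto simp: graph_components_def)
  have eX: "e \<in> edges X" using e v by (simp add: component_of_simps(2))
  obtain a where a: "a \<in> ends X e" using ends_nonempty[OF wf eX] by auto
  have "(v, a) \<in> conn (ends X) (edges X)" "(w, a) \<in> conn (ends X) (edges X)"
    using e a v w by (auto simp: component_of_simps(2))
  then have "(v, w) \<in> conn (ends X) (edges X)" by (meson conn_sym conn_trans)
  then show ?thesis using component_of_eq_iff[OF v(1) w(1)] v w by simp
qed

lemma edges_Union_components:
  assumes wf: "wf_mgraph X" shows "edges X = (\<Union>K\<in>graph_components X. edges K)"
proof
  show "edges X \<subseteq> (\<Union>K\<in>graph_components X. edges K)"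
  proof
    fix e assume e: "e \<in> edges X"
    obtain a b where ab: "ends X e = {a, b}" "a \<in> verts X" "b \<in> verts X" using wf_ends[OF wf e] .
    then have "e \<in> edges (component_of X a)" using edge_in_component[OF wf e ab(2)] by auto
    then show "e \<in> (\<Union>K\<in>graph_components X. edges K)" using ab by (auto simp: graph_components_def)
  qed
qed (auto simp: graph_components_def component_of_simps(2))

text \<open>
  A maximal forest is an arbitrary choice of a spanning tree in each component.
\<close>

lemma max_forest_bij:
  assumes wf: "wf_mgraph X" and B: "B \<subseteq> edges X"
  shows "bij_betw (\<lambda>F. \<lambda>K\<in>graph_components X. F \<inter> edges K) {F \<in> max_forests X. B \<subseteq> F}
    (\<Pi>\<^sub>E K\<in>graph_components X. trees_with K (B \<inter> edges K))"
proof (rule bij_betw_byWitness[where f' = "\<lambda>t. \<Union>K\<in>graph_components X. t K"])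
  let ?C = "graph_components X" and ?en = "ends X"
  note EU = edges_Union_components[OF wf]
  have wfK: "wf_mgraph K" if "K \<in> ?C" for K using that wf_component_of[OF wf] by (auto simp: graph_components_def)
  have eK: "ends K = ?en" if "K \<in> ?C" for K using that by (auto simp: graph_components_def)
  have neK: "verts K \<noteq> {}" if "K \<in> ?C" for K using that by (force simp: graph_components_def)
  have stays: "(u, w) \<in> conn ?en F \<longleftrightarrow> (u, w) \<in> conn ?en (F \<inter> edges K)"
    if K: "K \<in> ?C" "F \<subseteq> edges X" "u \<in> verts K" for K F u w
  proof -
    obtain v where "K = component_of X v" using K by (auto simp: graph_components_def)
    then show ?thesis using conn_in_component[OF wf K(2), of u v w] K(3) by simp
  qed
  have restr: "(\<Union>K\<in>?C. t K) \<inter> edges K = t K" if "\<And>K. K \<in> ?C \<Longrightarrow> t K \<subseteq> edges K" "K \<in> ?C" for t K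
    using that edges_disjoint_components[OF wf] by blast
  show "\<forall>F\<in>{F \<in> max_forests X. B \<subseteq> F}. (\<Union>K\<in>?C. (\<lambda>K\<in>?C. F \<inter> edges K) K) = F"
    using EU by (auto simp: max_forests_def forests_clustered_as_def)
  have tsub: "t K \<subseteq> edges K" if "t \<in> (\<Pi>\<^sub>E K\<in>?C. trees_with K (B \<inter> edges K))" "K \<in> ?C" for t K
    using that by (auto simp: PiE_def Pi_def trees_with_def spanning_trees_def)
  show "\<forall>t\<in>(\<Pi>\<^sub>E K\<in>?C. trees_with K (B \<inter> edges K)). (\<lambda>K\<in>?C. (\<Union>K\<in>?C. t K) \<inter> edges K) = t"
  proof
    fix t assume t: "t \<in> (\<Pi>\<^sub>E K\<in>?C. trees_with K (B \<inter> edges K))"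
    show "(\<lambda>K\<in>?C. (\<Union>K\<in>?C. t K) \<inter> edges K) = t"
    proof
      fix K show "(\<lambda>K\<in>?C. (\<Union>K\<in>?C. t K) \<inter> edges K) K = t K"
        using restr[of t K] tsub[OF t] t by (cases "K \<in> ?C") (auto simp: PiE_def extensional_def)
    qed
  qed
  show "(\<lambda>F. \<lambda>K\<in>?C. F \<inter> edges K) ` {F \<in> max_forests X. B \<subseteq> F} \<subseteq> (\<Pi>\<^sub>E K\<in>?C. trees_with K (B \<inter> edges K))"
  proof clarify
    fix F assume F: "F \<in> max_forests X" "B \<subseteq> F"
    then have F': "F \<subseteq> edges X" "acyc ?en F" "conn ?en F = conn ?en (edges X)"
      by (auto simp: max_forests_def forests_clustered_as_def)
    have "F \<inter> edges K \<in> trees_with K (B \<inter> edges K)" if K: "K \<in> ?C" for K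
    proof -
      have "(u, w) \<in> conn ?en (F \<inter> edges K)" if uw: "u \<in> verts K" "w \<in> verts K" for u w
      proof -
        obtain v where "(v, u) \<in> conn ?en (edges X)" "(v, w) \<in> conn ?en (edges X)"
          using uw K by (auto simp: graph_components_def)
        then have "(u, w) \<in> conn ?en (edges X)" by (meson conn_sym conn_trans)
        then show ?thesis using stays[OF K F'(1) uw(1)] F'(3) by auto
      qed
      moreover have "acyc ?en (F \<inter> edges K)" using acyc_subset[OF F'(2)] by auto
      ultimately have "F \<inter> edges K \<in> spanning_trees K"
        using spanning_trees_iff[OF wfK[OF K]] neK[OF K] eK[OF K] by auto
      then show ?thesis using F by (auto simp: trees_with_def)
    qed
    then show "(\<lambda>K\<in>?C. F \<inter> edges K) \<in> (\<Pi>\<^sub>E K\<in>?C. trees_with K (B \<inter> edges K))" by auto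
  qed
  show "(\<lambda>t. \<Union>K\<in>?C. t K) ` (\<Pi>\<^sub>E K\<in>?C. trees_with K (B \<inter> edges K)) \<subseteq> {F \<in> max_forests X. B \<subseteq> F}"
  proof clarify
    fix t assume t: "t \<in> (\<Pi>\<^sub>E K\<in>?C. trees_with K (B \<inter> edges K))"
    let ?F = "\<Union>K\<in>?C. t K"
    have tST: "t K \<in> spanning_trees K" "B \<inter> edges K \<subseteq> t K" if "K \<in> ?C" for K
      using t that by (auto simp: PiE_def Pi_def trees_with_def)
    have Fsub: "?F \<subseteq> edges X" using tsub[OF t] EU by blast
    have "acyc ?en ?F"
      unfolding acyc_def
    proof (intro ballI allI impI notI)
      fix e a b assume e: "e \<in> ?F" "?en e = {a, b}" "(a, b) \<in> conn ?en (?F - {e})"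
      then obtain K where K: "K \<in> ?C" "e \<in> t K" by auto
      have "a \<in> verts K" using wfK[OF K(1)] eK[OF K(1)] e(2) K tsub[OF t K(1)] by (auto simp: wf_mgraph_def)
      then have "(a, b) \<in> conn ?en ((?F - {e}) \<inter> edges K)" using stays[OF K(1), of "?F - {e}"] Fsub e(3) by blast
      moreover have "(?F - {e}) \<inter> edges K = t K - {e}" using restr[of t K] tsub[OF t] K(1) by blast
      moreover have "acyc ?en (t K)" using spanning_trees_iff[OF wfK[OF K(1)]] tST[OF K(1)] eK[OF K(1)] by simp
      ultimately show False using acyc_notin[of ?en "t K" e a b] K e by simp
    qed
    moreover have "conn ?en ?F = conn ?en (edges X)"
    proof
      show "conn ?en ?F \<subseteq> conn ?en (edges X)" by (rule conn_mono[OF Fsub])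
      show "conn ?en (edges X) \<subseteq> conn ?en ?F"
      proof (rule conn_subsetI)
        fix e a b assume e: "e \<in> edges X" "?en e = {a, b}"
        then obtain K where K: "K \<in> ?C" "e \<in> edges K" using EU by auto
        have "a \<in> verts K" "b \<in> verts K" using wfK[OF K(1)] eK[OF K(1)] e(2) K by (auto simp: wf_mgraph_def)
        then have "(a, b) \<in> conn ?en (t K)" using spanning_trees_iff[OF wfK[OF K(1)]] tST[OF K(1)] eK[OF K(1)] by simp
        moreover have "conn ?en (t K) \<subseteq> conn ?en ?F" using K by (intro conn_mono) auto
        ultimately show "(a, b) \<in> conn ?en ?F" by auto
      qed
    qed
    moreover have "B \<subseteq> ?F"
    proof
      fix e assume e: "e \<in> B"
      then obtain K where K: "K \<in> ?C" "e \<in> edges K" using B EU by auto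
      then have "e \<in> t K" using tST(2)[OF K(1)] e by auto
      then show "e \<in> ?F" using K by auto
    qed
    ultimately show "?F \<in> max_forests X \<and> B \<subseteq> ?F" using Fsub by (auto simp: max_forests_def forests_clustered_as_def)
  qed
qed

lemma max_forest_ratio:
  assumes wf: "wf_mgraph X" and fin: "finite_mgraph X" and B: "B \<subseteq> edges X"
  shows "forest_ratio (ends X) (edges X) (edges X) B = (\<Prod>K\<in>graph_components X. UST_prob K (B \<inter> edges K))"
proof -
  let ?C = "graph_components X"
  have fC: "finite ?C" using fin by (auto simp: graph_components_def finite_mgraph_def)
  have c: "card {F \<in> max_forests X. D \<subseteq> F} = (\<Prod>K\<in>?C. card (trees_with K (D \<inter> edges K)))" if "D \<subseteq> edges X" for D
    using bij_betw_same_card[OF max_forest_bij[OF wf that]] fC by (simp add: card_PiE)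
  have "UST_prob K (B \<inter> edges K) = real (card (trees_with K (B \<inter> edges K))) / real (card (trees_with K {}))" if K: "K \<in> ?C" for K
  proof -
    have "wf_mgraph K" "finite_mgraph K" "connected_mgraph K"
      using K wf_component_of[OF wf] finite_component_of[OF fin] connected_component_of[OF wf] by (auto simp: graph_components_def)
    moreover have "trees_with K {} = spanning_trees K" by (auto simp: trees_with_def)
    ultimately show ?thesis using UST_prob_eq[of K] by simp
  qed
  then have "(\<Prod>K\<in>?C. UST_prob K (B \<inter> edges K)) =
      real (\<Prod>K\<in>?C. card (trees_with K (B \<inter> edges K))) / real (\<Prod>K\<in>?C. card (trees_with K {}))"
    by (simp add: prod_dividef)
  then show ?thesis using c[OF B] c[of "{}"] by (simp add: forest_ratio_def max_forests_def)
qed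

abbreviation clusters :: "('v, 'e) mgraph \<Rightarrow> 'e set \<Rightarrow> ('v, 'e) mgraph set" where
  "clusters G F \<equiv> graph_components (spanning_subgraph G F)"

abbreviation cluster :: "('v, 'e) mgraph \<Rightarrow> 'e set \<Rightarrow> 'v \<Rightarrow> ('v, 'e) mgraph" where
  "cluster G F v \<equiv> component_of (spanning_subgraph G F) v"

definition closure_edges :: "('v, 'e) mgraph \<Rightarrow> 'e set \<Rightarrow> 'e set" where
  "closure_edges G A = edges (component_closure G (spanning_subgraph G A))"

lemma closure_edges_iff:
  assumes wf: "wf_mgraph G" and e: "e \<in> edges G" "ends G e = {a, b}"
  shows "e \<in> closure_edges G A \<longleftrightarrow> (a, b) \<in> conn (ends G) A"
proof -
  have V: "a \<in> verts G" "b \<in> verts G" using wf e by (auto simp: wf_mgraph_def)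
  have "(\<exists>v\<in>verts G. (v, a) \<in> conn (ends G) A \<and> (v, b) \<in> conn (ends G) A) \<longleftrightarrow> (a, b) \<in> conn (ends G) A"
    using V conn_sym[of _ a "ends G" A] conn_trans[of a _ "ends G" A b] by (metis conn_refl)
  then show ?thesis using e V by (auto simp: closure_edges_def component_closure_def graph_components_def)
qed

lemma closure_edges_subset: "closure_edges G A \<subseteq> edges G"
  by (auto simp: closure_edges_def component_closure_def)

lemma subset_closure_edges:
  assumes wf: "wf_mgraph G" and A: "A \<subseteq> edges G" shows "A \<subseteq> closure_edges G A"
proof
  fix e assume e: "e \<in> A"
  then have eG: "e \<in> edges G" using A by auto
  obtain a b where ab: "ends G e = {a, b}" using wf_ends[OF wf eG] .
  then show "e \<in> closure_edges G A" using closure_edges_iff[OF wf eG ab] conn_edge[of e A "ends G" a b] e by auto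
qed

lemma conn_closure_edges:
  assumes wf: "wf_mgraph G" and A: "A \<subseteq> edges G" 
  shows "conn (ends G) (closure_edges G A) = conn (ends G) A"
proof
  show "conn (ends G) A \<subseteq> conn (ends G) (closure_edges G A)" by (intro conn_mono subset_closure_edges[OF wf A])
  show "conn (ends G) (closure_edges G A) \<subseteq> conn (ends G) A"
  proof (rule conn_subsetI)
    fix e a b assume e: "e \<in> closure_edges G A" "ends G e = {a, b}"
    then show "(a, b) \<in> conn (ends G) A" using closure_edges_iff[OF wf _ e(2)] closure_edges_subset[of G A] by auto
  qed
qed

lemma wf_spanning_subgraph: "wf_mgraph G \<Longrightarrow> F \<subseteq> edges G \<Longrightarrow> wf_mgraph (spanning_subgraph G F)"
  by (auto simp: wf_mgraph_def)

lemma finite_spanning_subgraph: "finite_mgraph G \<Longrightarrow> F \<subseteq> edges G \<Longrightarrow> finite_mgraph (spanning_subgraph G F)"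
  by (auto simp: finite_mgraph_def intro: finite_subset)

text \<open>
  A forest with the clusters of \<open>A\<close> is a maximal forest of the graph obtained by keeping all the edges
  inside these clusters.
\<close>

lemma forest_ratio_prod:
  assumes wf: "wf_mgraph H" and fin: "finite_mgraph H" and A: "A \<subseteq> edges H" and B: "B \<subseteq> edges H"
  shows "forest_ratio (ends H) (edges H) A B = (if B \<subseteq> closure_edges H A then
    (\<Prod>K\<in>clusters H (closure_edges H A). UST_prob K (B \<inter> edges K)) else 0)"
proof -
  let ?C = "closure_edges H A"
  have sub: "F \<subseteq> ?C" if "F \<in> forests_clustered_as (ends H) (edges H) A" for F
  proof
    fix e assume e: "e \<in> F"
    then have eH: "e \<in> edges H" using that by (auto simp: forests_clustered_as_def)
    obtain a b where ab: "ends H e = {a, b}" using wf_ends[OF wf eH] .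
    have "(a, b) \<in> conn (ends H) F" using e ab by (rule conn_edge)
    then show "e \<in> ?C" using closure_edges_iff[OF wf eH ab] that by (auto simp: forests_clustered_as_def)
  qed
  have eq: "forests_clustered_as (ends H) (edges H) A = forests_clustered_as (ends H) ?C ?C"
    using sub closure_edges_subset[of H A] conn_closure_edges[OF wf A] by (auto simp: forests_clustered_as_def)
  show ?thesis
  proof (cases "B \<subseteq> ?C")
    case True
    then show ?thesis
      using max_forest_ratio[of "spanning_subgraph H ?C" B] wf_spanning_subgraph[OF wf closure_edges_subset]
        finite_spanning_subgraph[OF fin closure_edges_subset] eq by (simp add: forest_ratio_def)
  next
    case False
    then have "{F \<in> forests_clustered_as (ends H) (edges H) A. B \<subseteq> F} = {}" using sub by auto
    then have "card {F \<in> forests_clustered_as (ends H) (edges H) A. B \<subseteq> F} = 0" by (metis card.empty)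
    then show ?thesis using False by (simp only: forest_ratio_def) simp
  qed
qed

section \<open>Laws on configurations\<close>

lemma space_configs [simp]: "space (configs G) = Pow (edges G)"
  by (auto simp: configs_def space_measure_of_conv)

lemma configs_gen_subset: "(\<lambda>e. {F \<in> Pow (edges G). e \<in> F}) ` edges G \<subseteq> Pow (Pow (edges G))"
  by auto

lemma sets_configs: "sets (configs G) = sigma_sets (Pow (edges G)) ((\<lambda>e. {F \<in> Pow (edges G). e \<in> F}) ` edges G)"
  unfolding configs_def by (rule sets_measure_of[OF configs_gen_subset])

lemma edge_event [measurable]: "{F \<in> space (configs G). e \<in> F} \<in> sets (configs G)"
proof (cases "e \<in> edges G")
  case True
  then show ?thesis unfolding sets_configs by (auto intro: sigma_sets.Basic)
next
  case False
  then have "{F \<in> space (configs G). e \<in> F} = {}" by auto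
  then show ?thesis by (metis sets.empty_sets)
qed

lemma pred_edge [measurable]: "Measurable.pred (configs G) (\<lambda>F. e \<in> F)"
  unfolding pred_def by (rule edge_event)

lemma pred_subset_edges [measurable]: "finite B \<Longrightarrow> Measurable.pred (configs G) (\<lambda>F. B \<subseteq> F)"
  unfolding subset_eq by (intro pred_intros_finite pred_edge)

text \<open>
  The \<sigma>-algebra is generated by single edges.
\<close>

lemma measurable_configsI:
  assumes "\<And>x. x \<in> space M \<Longrightarrow> f x \<subseteq> edges G"
    and "\<And>e. e \<in> edges G \<Longrightarrow> Measurable.pred M (\<lambda>x. e \<in> f x)"
  shows "f \<in> measurable M (configs G)"
  unfolding configs_def
proof (rule measurable_measure_of[OF configs_gen_subset])
  show "f \<in> space M \<rightarrow> Pow (edges G)" using assms(1) by auto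
  fix A assume "A \<in> (\<lambda>e. {F \<in> Pow (edges G). e \<in> F}) ` edges G"
  then obtain e where e: "e \<in> edges G" "A = {F \<in> Pow (edges G). e \<in> F}" by auto
  have "f -` A \<inter> space M = {x \<in> space M. e \<in> f x}" using e assms(1) by auto
  then show "f -` A \<inter> space M \<in> sets M" using assms(2)[OF e(1)] by (simp add: pred_def)
qed

definition cylinders :: "('v, 'e) mgraph \<Rightarrow> 'e set set set" where
  "cylinders G = (\<lambda>B. {F \<in> Pow (edges G). B \<subseteq> F}) ` {B. finite B \<and> B \<subseteq> edges G}"

lemma cylinders_subset: "cylinders G \<subseteq> Pow (Pow (edges G))"
  by (auto simp: cylinders_def)

lemma sets_configs_cylinders: "sets (configs G) = sigma_sets (Pow (edges G)) (cylinders G)"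
  unfolding sets_configs
proof (rule sigma_sets_eqI)
  fix A assume "A \<in> (\<lambda>e. {F \<in> Pow (edges G). e \<in> F}) ` edges G"
  then obtain e where e: "e \<in> edges G" "A = {F \<in> Pow (edges G). {e} \<subseteq> F}" by auto
  then have "A \<in> cylinders G" unfolding cylinders_def by blast
  then show "A \<in> sigma_sets (Pow (edges G)) (cylinders G)" by (rule sigma_sets.Basic)
next
  fix A assume "A \<in> cylinders G"
  then obtain B where B: "finite B" "A = {F \<in> space (configs G). B \<subseteq> F}" by (auto simp: cylinders_def)
  then have "A \<in> sets (configs G)" using pred_subset_edges[OF B(1), of G] by (simp add: pred_def)
  then show "A \<in> sigma_sets (Pow (edges G)) ((\<lambda>e. {F \<in> Pow (edges G). e \<in> F}) ` edges G)"
    by (simp add: sets_configs)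
qed

lemma Int_stable_cylinders: "Int_stable (cylinders G)"
proof (rule Int_stableI)
  fix a b assume "a \<in> cylinders G" "b \<in> cylinders G"
  then obtain A B where "finite A" "A \<subseteq> edges G" "a = {F \<in> Pow (edges G). A \<subseteq> F}"
    "finite B" "B \<subseteq> edges G" "b = {F \<in> Pow (edges G). B \<subseteq> F}" by (auto simp: cylinders_def)
  then show "a \<inter> b \<in> cylinders G"
    unfolding cylinders_def by (intro image_eqI[of _ _ "A \<union> B"]) auto
qed

definition incl_prob :: "'e set measure \<Rightarrow> 'e set \<Rightarrow> real" where
  "incl_prob \<mu> B = measure \<mu> {F \<in> space \<mu>. B \<subseteq> F}"

text \<open>
  The cylinders \<open>B \<subseteq> F\<close> with \<open>B\<close> finite form a generating \<pi>-system.
\<close>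

lemma configs_measure_eqI:
  assumes \<mu>: "prob_space \<mu>" "sets \<mu> = sets (configs G)" and \<nu>: "prob_space \<nu>" "sets \<nu> = sets (configs G)"
    and eq: "\<And>B. finite B \<Longrightarrow> B \<subseteq> edges G \<Longrightarrow> incl_prob \<mu> B = incl_prob \<nu> B"
  shows "\<mu> = \<nu>"
proof (rule measure_eqI_generator_eq[OF Int_stable_cylinders cylinders_subset])
  interpret \<mu>: prob_space \<mu> by fact
  interpret \<nu>: prob_space \<nu> by fact
  have sp: "space \<mu> = Pow (edges G)" "space \<nu> = Pow (edges G)"
    using sets_eq_imp_space_eq[OF \<mu>(2)] sets_eq_imp_space_eq[OF \<nu>(2)] by simp_all
  show "emeasure \<mu> X = emeasure \<nu> X" if X: "X \<in> cylinders G" for X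
  proof -
    obtain B where B: "finite B" "B \<subseteq> edges G" "X = {F \<in> Pow (edges G). B \<subseteq> F}" using X by (auto simp: cylinders_def)
    show ?thesis using eq[OF B(1,2)] B(3) sp by (simp add: incl_prob_def \<mu>.emeasure_eq_measure \<nu>.emeasure_eq_measure)
  qed
  show "sets \<mu> = sigma_sets (Pow (edges G)) (cylinders G)" "sets \<nu> = sigma_sets (Pow (edges G)) (cylinders G)"
    using \<mu> \<nu> sets_configs_cylinders by auto
  show "range (\<lambda>i::nat. Pow (edges G)) \<subseteq> cylinders G" by (auto simp: cylinders_def intro!: image_eqI[of _ _ "{}"])
  show "(\<Union>i::nat. Pow (edges G)) = Pow (edges G)" by simp
  show "emeasure \<mu> (Pow (edges G)) \<noteq> \<infinity>" for i :: nat by simp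
qed

text \<open>
  One step of inclusion-exclusion, from required edges to forbidden ones.
\<close>

lemma prob_avoid_insert:
  "measure_pmf.prob p {T. B \<subseteq> T \<and> T \<inter> insert d D = {}} =
   measure_pmf.prob p {T. B \<subseteq> T \<and> T \<inter> D = {}} - measure_pmf.prob p {T. insert d B \<subseteq> T \<and> T \<inter> D = {}}"
proof -
  have "{T. B \<subseteq> T \<and> T \<inter> insert d D = {}} = {T. B \<subseteq> T \<and> T \<inter> D = {}} - {T. insert d B \<subseteq> T \<and> T \<inter> D = {}}" by auto
  then show ?thesis by (simp add: measure_pmf.finite_measure_Diff subset_eq)
qed

lemma trace_eq_iff_avoid:
  assumes "A \<subseteq> S"
  shows "{T. T \<inter> S = A} = {T. A \<subseteq> T \<and> T \<inter> (S - A) = {}}"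
  using assms by auto

lemma convergent_prob_avoid:
  assumes conv: "\<And>B. finite B \<Longrightarrow> B \<subseteq> E \<Longrightarrow> convergent (\<lambda>n. measure_pmf.prob (P n) {T. B \<subseteq> T})"
    and "finite D" "D \<subseteq> E" "finite B" "B \<subseteq> E"
  shows "convergent (\<lambda>n. measure_pmf.prob (P n) {T. B \<subseteq> T \<and> T \<inter> D = {}})"
  using assms(2-)
proof (induction D arbitrary: B rule: finite_induct)
  case empty then show ?case using conv by simp
next
  case (insert d D)
  have "convergent (\<lambda>n. measure_pmf.prob (P n) {T. C \<subseteq> T \<and> T \<inter> D = {}})" if "finite C" "C \<subseteq> E" for C
    using insert that by auto
  from this[of B] this[of "insert d B"] show ?case
    unfolding prob_avoid_insert using insert.prems by (intro convergent_diff) blast+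
qed

lemma tendsto_prob_avoid:
  fixes P :: "nat \<Rightarrow> 'e set pmf"
  assumes \<mu>: "prob_space \<mu>" "sets \<mu> = sets (configs G)"
    and lim: "\<And>B. finite B \<Longrightarrow> B \<subseteq> edges G \<Longrightarrow> (\<lambda>n. measure_pmf.prob (P n) {T. B \<subseteq> T}) \<longlonglongrightarrow> incl_prob \<mu> B"
    and "finite D" "D \<subseteq> edges G" "finite B" "B \<subseteq> edges G"
  shows "(\<lambda>n. measure_pmf.prob (P n) {T. B \<subseteq> T \<and> T \<inter> D = {}}) \<longlonglongrightarrow> measure \<mu> {F \<in> space \<mu>. B \<subseteq> F \<and> F \<inter> D = {}}"
  using assms(4-)
proof (induction D arbitrary: B rule: finite_induct)
  case empty then show ?case using lim by (simp add: incl_prob_def)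
next
  case (insert d D)
  interpret \<mu>: prob_space \<mu> by fact
  have m: "{F \<in> space \<mu>. C \<subseteq> F \<and> F \<inter> D = {}} \<in> sets \<mu>" if "finite C" for C
  proof -
    have [measurable]: "Measurable.pred \<mu> (\<lambda>F. e \<in> F)" for e
      using pred_edge[where G = G and e = e] measurable_cong_sets[OF \<mu>(2) refl] by blast
    have "Measurable.pred \<mu> (\<lambda>F. (\<forall>e\<in>C. e \<in> F) \<and> (\<forall>e\<in>D. e \<notin> F))"
      using that insert.hyps(1) by measurable
    moreover have "(\<lambda>F. (\<forall>e\<in>C. e \<in> F) \<and> (\<forall>e\<in>D. e \<notin> F)) = (\<lambda>F. C \<subseteq> F \<and> F \<inter> D = {})" by auto
    ultimately show ?thesis by (simp add: pred_def)
  qed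
  have "{F \<in> space \<mu>. B \<subseteq> F \<and> F \<inter> insert d D = {}} =
    {F \<in> space \<mu>. B \<subseteq> F \<and> F \<inter> D = {}} - {F \<in> space \<mu>. insert d B \<subseteq> F \<and> F \<inter> D = {}}" by auto
  then have "measure \<mu> {F \<in> space \<mu>. B \<subseteq> F \<and> F \<inter> insert d D = {}} =
    measure \<mu> {F \<in> space \<mu>. B \<subseteq> F \<and> F \<inter> D = {}} - measure \<mu> {F \<in> space \<mu>. insert d B \<subseteq> F \<and> F \<inter> D = {}}"
    using m[of B] m[of "insert d B"] insert.prems by (simp add: \<mu>.finite_measure_Diff subset_eq)
  moreover have "(\<lambda>n. measure_pmf.prob (P n) {T. C \<subseteq> T \<and> T \<inter> D = {}}) \<longlonglongrightarrow>
      measure \<mu> {F \<in> space \<mu>. C \<subseteq> F \<and> F \<inter> D = {}}" if "finite C" "C \<subseteq> edges G" for C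
    using insert that by auto
  from this[of B] this[of "insert d B"]
  have "(\<lambda>n. measure_pmf.prob (P n) {T. B \<subseteq> T \<and> T \<inter> insert d D = {}}) \<longlonglongrightarrow>
      measure \<mu> {F \<in> space \<mu>. B \<subseteq> F \<and> F \<inter> D = {}} - measure \<mu> {F \<in> space \<mu>. insert d B \<subseteq> F \<and> F \<inter> D = {}}"
    unfolding prob_avoid_insert using insert.prems by (intro tendsto_diff) blast+
  ultimately show ?case by simp
qed

text \<open>
  By inclusion-exclusion, the probabilities of the finite traces and those of the events \<open>B \<subseteq> T\<close>
  are linear combinations of each other.
\<close>

lemma local_weak_limit_iff:
  assumes wf: "wf_mgraph G" and \<mu>: "prob_space \<mu>" "sets \<mu> = sets (configs G)"
  shows "local_weak_limit G P \<mu> \<longleftrightarrow>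
    (\<forall>B. finite B \<and> B \<subseteq> edges G \<longrightarrow> (\<lambda>n. measure_pmf.prob (P n) {T. B \<subseteq> T}) \<longlonglongrightarrow> incl_prob \<mu> B)"
proof
  assume L: "local_weak_limit G P \<mu>"
  show "\<forall>B. finite B \<and> B \<subseteq> edges G \<longrightarrow> (\<lambda>n. measure_pmf.prob (P n) {T. B \<subseteq> T}) \<longlonglongrightarrow> incl_prob \<mu> B"
  proof clarify
    fix B assume B: "finite B" "B \<subseteq> edges G"
    define H where "H = \<lparr>verts = (\<Union>e\<in>B. ends G e), edges = B, ends = ends G\<rparr>"
    have fe: "finite (ends G e)" if "e \<in> B" for e
      using wf that B by (metis (no_types, lifting) card.infinite one_neq_zero subsetD wf_mgraph_def zero_neq_numeral)
    have "subgraph H G" using wf B by (auto simp: subgraph_def H_def wf_mgraph_def)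
    moreover have "finite_mgraph H" using B fe by (auto simp: finite_mgraph_def H_def)
    ultimately have "(\<lambda>n. measure_pmf.prob (P n) {T. T \<inter> B = B}) \<longlonglongrightarrow> measure \<mu> {F \<in> space \<mu>. F \<inter> B = B}"
      using L unfolding local_weak_limit_def by (auto simp: H_def)
    moreover have "T \<inter> B = B \<longleftrightarrow> B \<subseteq> T" for T by auto
    ultimately show "(\<lambda>n. measure_pmf.prob (P n) {T. B \<subseteq> T}) \<longlonglongrightarrow> incl_prob \<mu> B" by (simp add: incl_prob_def)
  qed
next
  assume R: "\<forall>B. finite B \<and> B \<subseteq> edges G \<longrightarrow> (\<lambda>n. measure_pmf.prob (P n) {T. B \<subseteq> T}) \<longlonglongrightarrow> incl_prob \<mu> B"
  show "local_weak_limit G P \<mu>"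
    unfolding local_weak_limit_def
  proof (intro conjI allI impI)
    fix H :: "('a, 'b) mgraph" and A assume H: "subgraph H G \<and> finite_mgraph H" and A: "A \<subseteq> edges H"
    have S: "edges H \<subseteq> edges G" "finite (edges H)" using H by (auto simp: subgraph_def finite_mgraph_def)
    have "(\<lambda>n. measure_pmf.prob (P n) {T. A \<subseteq> T \<and> T \<inter> (edges H - A) = {}}) \<longlonglongrightarrow>
      measure \<mu> {F \<in> space \<mu>. A \<subseteq> F \<and> F \<inter> (edges H - A) = {}}"
      using R S A by (intro tendsto_prob_avoid[OF \<mu>]) (auto intro: finite_subset)
    moreover have "{F \<in> space \<mu>. A \<subseteq> F \<and> F \<inter> (edges H - A) = {}} = {F \<in> space \<mu>. F \<inter> edges H = A}" using A by auto
    ultimately show "(\<lambda>n. measure_pmf.prob (P n) {T. T \<inter> edges H = A}) \<longlonglongrightarrow> measure \<mu> {F \<in> space \<mu>. F \<inter> edges H = A}"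
      using trace_eq_iff_avoid[OF A] by simp
  qed (use \<mu> in auto)
qed

text \<open>
  The limits of the laws of the traces on finite edge sets are consistent, so Kolmogorov's extension
  theorem applies. Edge sets are coded by their real-valued indicators to have Polish coordinates.
\<close>

lemma configs_measure_exists:
  fixes P :: "nat \<Rightarrow> 'e set pmf"
  assumes conv: "\<And>B. finite B \<Longrightarrow> B \<subseteq> edges G \<Longrightarrow> convergent (\<lambda>n. measure_pmf.prob (P n) {T. B \<subseteq> T})"
  shows "\<exists>\<mu>. prob_space \<mu> \<and> sets \<mu> = sets (configs G) \<and>
    (\<forall>B. finite B \<and> B \<subseteq> edges G \<longrightarrow> (\<lambda>n. measure_pmf.prob (P n) {T. B \<subseteq> T}) \<longlonglongrightarrow> incl_prob \<mu> B)"
proof -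
  let ?E = "edges G"
  \<comment> \<open>\<open>L J\<close> is the limit law of the trace on \<open>J\<close>, and \<open>q J\<close> is the same law as a probability mass function.\<close>
  define L where "L J A = (if A \<subseteq> J then lim (\<lambda>n. measure_pmf.prob (P n) {T. T \<inter> J = A}) else 0)" for J A
  have tend: "(\<lambda>n. measure_pmf.prob (P n) {T. T \<inter> J = A}) \<longlonglongrightarrow> L J A" if J: "finite J" "J \<subseteq> ?E" for J A
  proof (cases "A \<subseteq> J")
    case True
    have "convergent (\<lambda>n. measure_pmf.prob (P n) {T. A \<subseteq> T \<and> T \<inter> (J - A) = {}})"
      using True J by (intro convergent_prob_avoid[OF conv]) (auto intro: finite_subset)
    then show ?thesis using True trace_eq_iff_avoid[OF True] by (simp add: L_def convergent_LIMSEQ_iff)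
  next
    case False
    then have "{T. T \<inter> J = A} = {}" by auto
    then show ?thesis using False by (simp add: L_def)
  qed
  have L_nonneg: "L J A \<ge> 0" if "finite J" "J \<subseteq> ?E" for J A
    by (rule LIMSEQ_le_const[OF tend[OF that]]) auto
  have margin: "(\<Sum>A\<in>{A \<in> Pow H. A \<inter> J = C}. L H A) = L J C" if "finite H" "H \<subseteq> ?E" "J \<subseteq> H" for J H C
  proof -
    have fin: "finite {A \<in> Pow H. A \<inter> J = C}" using that by auto
    have "(\<Sum>A\<in>{A \<in> Pow H. A \<inter> J = C}. measure_pmf.prob (P n) {T. T \<inter> H = A}) =
        measure_pmf.prob (P n) {T. T \<inter> J = C}" for n
    proof -
      have u1: "{T. T \<inter> J = C} = (\<Union>A\<in>{A \<in> Pow H. A \<inter> J = C}. {T. T \<inter> H = A})" using that(3) by auto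
      have u2: "measure_pmf.prob (P n) (\<Union>A\<in>{A \<in> Pow H. A \<inter> J = C}. {T. T \<inter> H = A}) =
          (\<Sum>A\<in>{A \<in> Pow H. A \<inter> J = C}. measure_pmf.prob (P n) {T. T \<inter> H = A})"
        by (rule measure_pmf.finite_measure_finite_Union[OF fin], simp, unfold disjoint_family_on_def, blast)
      show ?thesis unfolding u1 by (rule u2[symmetric])
    qed
    moreover have "(\<lambda>n. \<Sum>A\<in>{A \<in> Pow H. A \<inter> J = C}. measure_pmf.prob (P n) {T. T \<inter> H = A}) \<longlonglongrightarrow>
      (\<Sum>A\<in>{A \<in> Pow H. A \<inter> J = C}. L H A)" using that by (intro tendsto_sum tend) auto
    ultimately have "(\<lambda>n. measure_pmf.prob (P n) {T. T \<inter> J = C}) \<longlonglongrightarrow> (\<Sum>A\<in>{A \<in> Pow H. A \<inter> J = C}. L H A)" by simp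
    then show ?thesis using tend[of J C] that by (auto intro: LIMSEQ_unique finite_subset)
  qed
  have L_empty: "L {} {} = 1" using tend[of "{}" "{}"] by (simp add: L_def)
  define q where "q J = embed_pmf (L J)" for J
  have pmf_q: "pmf (q J) A = L J A" if J: "finite J" "J \<subseteq> ?E" for J A
    unfolding q_def
  proof (rule pmf_embed_pmf)
    show "L J x \<ge> 0" for x by (rule L_nonneg[OF J])
    have "(\<integral>\<^sup>+ x. ennreal (L J x) \<partial>count_space UNIV) = (\<integral>\<^sup>+ x. ennreal (L J x) \<partial>count_space (Pow J))"
      by (intro nn_integral_count_space_eq) (auto simp: L_def)
    also have "\<dots> = (\<Sum>x\<in>Pow J. ennreal (L J x))" using J by (intro nn_integral_count_space_finite) auto
    also have "\<dots> = ennreal (\<Sum>x\<in>Pow J. L J x)" by (intro sum_ennreal L_nonneg[OF J])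
    also have "(\<Sum>x\<in>Pow J. L J x) = 1"
    proof -
      have "{A \<in> Pow J. A \<inter> {} = {}} = Pow J" by auto
      then show ?thesis using margin[of J "{}" "{}"] J L_empty by (simp only:) simp
    qed
    finally show "(\<integral>\<^sup>+ x. ennreal (L J x) \<partial>count_space UNIV) = 1" by simp
  qed
  have q_marg: "q J = map_pmf (\<lambda>A. A \<inter> J) (q H)" if H: "finite H" "H \<subseteq> ?E" "J \<subseteq> H" for J H
  proof (rule pmf_eqI)
    fix C
    have J: "finite J" "J \<subseteq> ?E" using H by (auto intro: finite_subset)
    have supp: "A \<subseteq> H" if "A \<in> set_pmf (q H)" for A
      using that pmf_q[OF H(1,2), of A] by (auto simp: set_pmf_iff L_def split: if_splits)
    have "pmf (map_pmf (\<lambda>A. A \<inter> J) (q H)) C = measure_pmf.prob (q H) ((\<lambda>A. A \<inter> J) -` {C})" by (rule pmf_map)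
    also have "\<dots> = measure_pmf.prob (q H) {A \<in> Pow H. A \<inter> J = C}"
      using supp by (intro measure_pmf.finite_measure_eq_AE) (auto simp: AE_measure_pmf_iff)
    also have "\<dots> = (\<Sum>A\<in>{A \<in> Pow H. A \<inter> J = C}. pmf (q H) A)" using H by (intro measure_measure_pmf_finite) auto
    also have "\<dots> = pmf (q J) C" using margin[OF H] pmf_q[OF H(1,2)] pmf_q[OF J] by simp
    finally show "pmf (q J) C = pmf (map_pmf (\<lambda>A. A \<inter> J) (q H)) C" by simp
  qed
  define ind where "ind J = (\<lambda>A. \<lambda>i\<in>J. indicator A i :: real)" for J :: "'e set"
  have ind_m: "ind J \<in> measurable (measure_pmf p) (PiM J (\<lambda>_. borel))" for J p
    by (auto simp: ind_def space_PiM)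
  define Q where "Q J = distr (measure_pmf (q J)) (PiM J (\<lambda>_. borel)) (ind J)" for J
  interpret polish_projective ?E Q
    unfolding polish_projective_def projective_family_def
  proof (intro conjI allI impI)
    fix J H assume H: "J \<subseteq> H" "finite H" "H \<subseteq> ?E"
    have "distr (Q H) (PiM J (\<lambda>_. borel)) (\<lambda>f. restrict f J) =
        distr (measure_pmf (q H)) (PiM J (\<lambda>_. borel)) ((\<lambda>f. restrict f J) \<circ> ind H)"
      unfolding Q_def by (rule distr_distr[OF measurable_restrict_subset[OF H(1)] ind_m])
    also have "(\<lambda>f. restrict f J) \<circ> ind H = ind J \<circ> (\<lambda>A. A \<inter> J)"
      using H by (auto simp: ind_def fun_eq_iff indicator_def)
    also have "distr (measure_pmf (q H)) (PiM J (\<lambda>_. borel)) (ind J \<circ> (\<lambda>A. A \<inter> J)) =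
        distr (distr (measure_pmf (q H)) (count_space UNIV) (\<lambda>A. A \<inter> J)) (PiM J (\<lambda>_. borel)) (ind J)"
      by (rule distr_distr[symmetric]) (auto simp: ind_def space_PiM)
    also have "distr (measure_pmf (q H)) (count_space UNIV) (\<lambda>A. A \<inter> J) = measure_pmf (q J)"
      unfolding q_marg[OF H(2,3,1)] by (simp add: map_pmf_rep_eq)
    finally show "Q J = distr (Q H) (PiM J (\<lambda>_. borel)) (\<lambda>f. restrict f J)"
      unfolding Q_def[of J] by (rule sym)
  next
    fix J assume "finite J" "J \<subseteq> ?E"
    show "prob_space (Q J)" unfolding Q_def by (rule measure_pmf.prob_space_distr[OF ind_m])
  qed
  define \<mu> where "\<mu> = distr lim (configs G) (\<lambda>\<omega>. {e \<in> ?E. \<omega> e = (1::real)})"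
  have sets_lim: "sets lim = sets (PiM ?E (\<lambda>_. borel))" by simp
  have m: "(\<lambda>\<omega>. {e \<in> ?E. \<omega> e = (1::real)}) \<in> measurable lim (configs G)"
  proof (rule measurable_configsI)
    fix e assume e: "e \<in> ?E"
    then have [measurable]: "(\<lambda>\<omega>. \<omega> e) \<in> borel_measurable lim"
      unfolding measurable_cong_sets[OF sets_lim refl] by (rule measurable_component_singleton)
    have "Measurable.pred lim (\<lambda>\<omega>. \<omega> e = (1::real))" by measurable
    then show "Measurable.pred lim (\<lambda>\<omega>. e \<in> {e \<in> ?E. \<omega> e = (1::real)})" using e by simp
  qed auto
  have ps: "prob_space \<mu>" unfolding \<mu>_def by (rule P.prob_space_distr[OF m])
  have "incl_prob \<mu> B = L B B" if B: "finite B" "B \<subseteq> ?E" for B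
  proof -
    define X where "X = (\<Pi>\<^sub>E e\<in>B. {1::real})"
    have X_iff: "x \<in> X \<longleftrightarrow> (\<forall>e\<in>B. x e = 1) \<and> x \<in> extensional B" for x
      unfolding X_def by (simp only: PiE_iff singleton_iff)
    have X: "X \<in> sets (PiM B (\<lambda>_. borel))" unfolding X_def using B by (intro sets_PiM_I_finite) auto
    have ev: "{F \<in> space (configs G). B \<subseteq> F} \<in> sets (configs G)" using pred_subset_edges[OF B(1), of G] by (simp add: pred_def)
    have "incl_prob \<mu> B = measure lim ((\<lambda>\<omega>. {e \<in> ?E. \<omega> e = (1::real)}) -` {F \<in> space (configs G). B \<subseteq> F} \<inter> space lim)"
      unfolding incl_prob_def \<mu>_def space_distr by (rule measure_distr[OF m ev])
    also have "(\<lambda>\<omega>. {e \<in> ?E. \<omega> e = (1::real)}) -` {F \<in> space (configs G). B \<subseteq> F} \<inter> space lim = prod_emb ?E (\<lambda>_. borel) B X"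
      using B by (auto simp: prod_emb_def X_iff space_PiM subset_eq)
    also have "measure lim \<dots> = measure (Q B) X" using B X by (intro measure_lim_emb)
    also have "\<dots> = measure_pmf.prob (q B) (ind B -` X \<inter> space (measure_pmf (q B)))"
      unfolding Q_def by (rule measure_distr[OF ind_m X])
    also have "ind B -` X \<inter> space (measure_pmf (q B)) = {A. B \<subseteq> A}"
      by (auto simp: ind_def X_iff indicator_def)
    also have "measure_pmf.prob (q B) {A. B \<subseteq> A} = measure_pmf.prob (q B) {B}"
      using pmf_q[OF B] by (intro measure_pmf.finite_measure_eq_AE) (auto simp: AE_measure_pmf_iff set_pmf_iff L_def split: if_splits)
    also have "\<dots> = L B B" using pmf_q[OF B] by (simp add: measure_pmf_single)
    finally show ?thesis .
  qed
  moreover have "(\<lambda>n. measure_pmf.prob (P n) {T. B \<subseteq> T}) \<longlonglongrightarrow> L B B" if "finite B" "B \<subseteq> ?E" for B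
  proof -
    have "T \<inter> B = B \<longleftrightarrow> B \<subseteq> T" for T by auto
    then show ?thesis using tend[OF that, of B] by simp
  qed
  ultimately show ?thesis using ps by (intro exI[of _ \<mu>]) (auto simp: \<mu>_def)
qed

section \<open>Free and wired limits along exhaustions\<close>

definition lf_connected :: "('v, 'e) mgraph \<Rightarrow> bool" where
  "lf_connected K \<longleftrightarrow> wf_mgraph K \<and> locally_finite K \<and> connected_mgraph K"

lemma subgraph_trans: "subgraph A B \<Longrightarrow> subgraph B C \<Longrightarrow> subgraph A C"
  by (auto simp: subgraph_def)

lemma subgraph_refl: "wf_mgraph A \<Longrightarrow> subgraph A A"
  by (auto simp: subgraph_def)

lemma subgraph_wf: "subgraph H K \<Longrightarrow> wf_mgraph H"
  by (simp add: subgraph_def)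

lemma UST_prob_subgraph:
  assumes "subgraph H H'" "finite_mgraph H" "connected_mgraph H" "wf_mgraph H'" "finite_mgraph H'" "connected_mgraph H'"
    and "B \<subseteq> edges H"
  shows "UST_prob H' B \<le> UST_prob H B"
  by (rule UST_prob_contracts[where \<pi> = id]) (use assms in \<open>auto simp: subgraph_def contracts_def\<close>)

definition wire :: "('v, 'e) mgraph \<Rightarrow> 'v \<Rightarrow> 'v option" where
  "wire H v = (if v \<in> verts H then Some v else None)"

lemma wired_simps:
  "verts (wired G H) = wire H ` verts G"
  "edges (wired G H) = {e \<in> edges G. ends G e \<inter> verts H \<noteq> {}}"
  "ends (wired G H) e = wire H ` ends G e"
  by (simp_all add: wired_def Let_def wire_def[abs_def])

lemma wf_wired:
  assumes wf: "wf_mgraph G" shows "wf_mgraph (wired G H)"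
  unfolding wf_mgraph_def
proof
  fix e assume "e \<in> edges (wired G H)"
  then have e: "e \<in> edges G" by (simp add: wired_simps)
  obtain a b where "ends G e = {a, b}" "a \<in> verts G" "b \<in> verts G" using wf_ends[OF wf e] .
  then show "ends (wired G H) e \<subseteq> verts (wired G H) \<and> (card (ends (wired G H) e) = 1 \<or> card (ends (wired G H) e) = 2)"
    by (cases "wire H a = wire H b") (auto simp: wired_simps)
qed

lemma finite_wired:
  assumes lf: "locally_finite G" and H: "finite (verts H)" "verts H \<subseteq> verts G" shows "finite_mgraph (wired G H)"
proof -
  have "verts (wired G H) \<subseteq> insert None (Some ` verts H)" by (auto simp: wired_simps wire_def)
  moreover have "edges (wired G H) \<subseteq> (\<Union>v\<in>verts H. {e \<in> edges G. v \<in> ends G e})" by (auto simp: wired_simps)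
  moreover have "finite (\<Union>v\<in>verts H. {e \<in> edges G. v \<in> ends G e})" using assms by (auto simp: locally_finite_def)
  ultimately show ?thesis using H by (auto simp: finite_mgraph_def intro: finite_subset)
qed

lemma connected_wired:
  assumes con: "connected_mgraph G" shows "connected_mgraph (wired G H)"
proof -
  let ?\<pi> = "wire H" and ?W = "wired G H"
  have "(?\<pi> u, ?\<pi> v) \<in> conn (ends ?W) (edges ?W)" if "(u, v) \<in> conn (ends G) (edges G)" for u v
    using that
  proof (induction rule: conn_induct)
    case refl show ?case by simp
  next
    case (step y z g)
    have "(?\<pi> y, ?\<pi> z) \<in> conn (ends ?W) (edges ?W)"
    proof (cases "ends G g \<inter> verts H = {}")
      case True
      then show ?thesis using step(3) by (auto simp: wire_def)
    next
      case False
      then show ?thesis using step(2,3) by (intro conn_edge[of g]) (auto simp: wired_simps)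
    qed
    then show ?case using step conn_trans by metis
  qed
  then show ?thesis using con by (auto simp: connected_mgraph_def joined_iff_conn wired_simps(1))
qed

definition fin_connected :: "('v, 'e) mgraph \<Rightarrow> ('v, 'e) mgraph \<Rightarrow> bool" where
  "fin_connected K H \<longleftrightarrow> subgraph H K \<and> finite_mgraph H \<and> connected_mgraph H"

text \<open>
  Local finiteness of \<open>K\<close> leaves finitely many edges at the wired vertex.
\<close>

lemma wired_finite_connected:
  assumes "lf_connected K" "fin_connected K H"
  shows "wf_mgraph (wired K H)" "finite_mgraph (wired K H)" "connected_mgraph (wired K H)"
  using assms wf_wired[of K H] finite_wired[of K H] connected_wired[of K H]
  by (auto simp: lf_connected_def fin_connected_def subgraph_def finite_mgraph_def)

lemma subgraph_edges_touch:
  assumes "subgraph H K" "e \<in> edges H"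
  shows "e \<in> edges K" "ends K e \<subseteq> verts H" "ends K e \<inter> verts H \<noteq> {}"
proof -
  have "wf_mgraph H" "edges H \<subseteq> edges K" "ends H = ends K" using assms by (auto simp: subgraph_def)
  then show "e \<in> edges K" "ends K e \<subseteq> verts H" using assms(2) by (auto simp: wf_mgraph_def)
  moreover have "ends K e \<noteq> {}" using ends_nonempty[OF \<open>wf_mgraph H\<close> assms(2)] \<open>ends H = ends K\<close> by simp
  ultimately show "ends K e \<inter> verts H \<noteq> {}" by auto
qed

text \<open>
  The wired graph of the smaller piece arises from that of the larger one by identifying more vertices.
\<close>

lemma UST_prob_wired_mono:
  assumes K: "lf_connected K" and H: "fin_connected K H" "fin_connected K H'" "verts H \<subseteq> verts H'"
    and B: "B \<subseteq> edges H"
  shows "UST_prob (wired K H) B \<le> UST_prob (wired K H') B"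
proof (rule UST_prob_contracts[OF wired_finite_connected[OF K H(2)] wired_finite_connected[OF K H(1)]])
  let ?\<pi> = "\<lambda>x. Option.bind x (wire H)"
  have wf: "wf_mgraph K" and s: "subgraph H K" using K H by (auto simp: lf_connected_def fin_connected_def)
  have im: "ends (wired K H) e = ?\<pi> ` ends (wired K H') e" for e
  proof -
    have "wire H v = ?\<pi> (wire H' v)" for v using H(3) by (auto simp: wire_def)
    then show ?thesis by (simp add: wired_simps image_image)
  qed
  show "contracts ?\<pi> (wired K H') (wired K H)"
    unfolding contracts_def
  proof
    fix e assume e: "e \<in> edges (wired K H')"
    show "e \<in> edges (wired K H) \<and> ends (wired K H) e = ?\<pi> ` ends (wired K H') e \<or> (\<exists>c. ?\<pi> ` ends (wired K H') e = {c})"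
    proof (cases "ends K e \<inter> verts H = {}")
      case True
      have "ends K e \<noteq> {}" using e ends_nonempty[OF wf] by (auto simp: wired_simps)
      then have "ends (wired K H) e = {None}" using True by (auto simp: wired_simps wire_def)
      then show ?thesis using im by auto
    next
      case False
      then show ?thesis using e im[of e] by (simp add: wired_simps(2))
    qed
  qed
  show "B \<subseteq> edges (wired K H')" "B \<subseteq> edges (wired K H)"
    using subgraph_edges_touch(1)[OF s] subgraph_edges_touch(3)[OF s] B H(3) unfolding wired_simps by blast+
  show "ends (wired K H) e = ?\<pi> ` ends (wired K H') e" for e by (rule im)
qed

text \<open>
  The piece is a subgraph of its wired graph.
\<close>

lemma UST_prob_wired_le_free:
  assumes K: "lf_connected K" and H: "fin_connected K H" and B: "B \<subseteq> edges H"
  shows "UST_prob (wired K H) B \<le> UST_prob H B"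
proof (rule UST_prob_contracts[OF _ _ _ wired_finite_connected[OF K H]])
  have s: "subgraph H K" using H by (auto simp: fin_connected_def)
  then show "wf_mgraph H" "finite_mgraph H" "connected_mgraph H" using H by (auto simp: fin_connected_def subgraph_def)
  have im: "ends (wired K H) e = Some ` ends H e" if "e \<in> edges H" for e
  proof -
    have "\<forall>v\<in>ends H e. wire H v = Some v" "ends K e = ends H e"
      using subgraph_edges_touch(2)[OF s that] s by (auto simp: wire_def subgraph_def)
    then show ?thesis by (simp add: wired_simps)
  qed
  have ed: "edges H \<subseteq> edges (wired K H)" using subgraph_edges_touch[OF s] by (auto simp: wired_simps)
  show "contracts Some H (wired K H)" using im ed by (auto simp: contracts_def)
  show "B \<subseteq> edges H" "B \<subseteq> edges (wired K H)" using B ed by auto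
  show "e \<in> B \<Longrightarrow> ends (wired K H) e = Some ` ends H e" for e using im B by auto
qed

lemma UST_prob_bounds: "0 \<le> UST_prob G B" "UST_prob G B \<le> 1"
  by (auto simp: UST_prob_def)

lemma exhaustion_mono:
  assumes ex: "exhaustion K Gs" and "n \<le> m" shows "subgraph (Gs n) (Gs m)"
  using assms(2)
proof (induction m rule: dec_induct)
  case base show ?case using ex by (auto simp: exhaustion_def intro: subgraph_refl subgraph_wf)
next
  case (step m) then show ?case using ex by (auto simp: exhaustion_def intro: subgraph_trans)
qed

lemma eventually_subset_incseq:
  assumes "finite B" "B \<subseteq> (\<Union>n. f n)" "\<And>n m. n \<le> m \<Longrightarrow> f n \<subseteq> f m"
  shows "eventually (\<lambda>n::nat. B \<subseteq> f n) sequentially"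
proof -
  have "eventually (\<lambda>n. x \<in> f n) sequentially" if "x \<in> B" for x
  proof -
    obtain N where "x \<in> f N" using assms(2) \<open>x \<in> B\<close> by auto
    then show ?thesis using assms(3)[of N] by (auto simp: eventually_sequentially intro!: exI[of _ N])
  qed
  then have "eventually (\<lambda>n. \<forall>x\<in>B. x \<in> f n) sequentially" using assms(1) by (simp add: eventually_ball_finite_distrib)
  then show ?thesis by (simp add: subset_eq)
qed

lemma exhaustion_edges:
  assumes "exhaustion K Gs" "finite B" "B \<subseteq> edges K" shows "eventually (\<lambda>n. B \<subseteq> edges (Gs n)) sequentially"
  using assms exhaustion_mono[OF assms(1)] by (intro eventually_subset_incseq) (auto simp: exhaustion_def subgraph_def)

lemma exhaustion_verts:
  assumes "exhaustion K Gs" "finite B" "B \<subseteq> verts K" shows "eventually (\<lambda>n. B \<subseteq> verts (Gs n)) sequentially"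
  using assms exhaustion_mono[OF assms(1)] by (intro eventually_subset_incseq) (auto simp: exhaustion_def subgraph_def)

lemma exhaustion_fin_connected: "exhaustion K Gs \<Longrightarrow> fin_connected K (Gs n)"
  by (auto simp: exhaustion_def fin_connected_def)

lemma exhaustion_subgraph:
  assumes ex: "exhaustion K Gs" and H: "fin_connected K H" shows "eventually (\<lambda>n. subgraph H (Gs n)) sequentially"
proof -
  have "eventually (\<lambda>n. edges H \<subseteq> edges (Gs n)) sequentially" "eventually (\<lambda>n. verts H \<subseteq> verts (Gs n)) sequentially"
    using H by (auto intro!: exhaustion_edges[OF ex] exhaustion_verts[OF ex] simp: fin_connected_def subgraph_def finite_mgraph_def)
  then show ?thesis
  proof eventually_elim
    case (elim n)
    then show ?case using H exhaustion_fin_connected[OF ex, of n] by (auto simp: fin_connected_def subgraph_def)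
  qed
qed

text \<open>
  By Rayleigh monotonicity, the probabilities decrease along an exhaustion, so the infimum over all
  finite pieces is the common limit of all exhaustions. For wired pieces they increase.
\<close>

definition free_prob :: "('v, 'e) mgraph \<Rightarrow> 'e set \<Rightarrow> real" where
  "free_prob K B = Inf {UST_prob H B | H. fin_connected K H \<and> B \<subseteq> edges H}"

definition wired_prob :: "('v, 'e) mgraph \<Rightarrow> 'e set \<Rightarrow> real" where
  "wired_prob K B = Sup {UST_prob (wired K H) B | H. fin_connected K H \<and> B \<subseteq> edges H}"

lemma free_limit:
  assumes K: "lf_connected K" and ex: "exhaustion K Gs" and B: "finite B" "B \<subseteq> edges K"
  shows "(\<lambda>n. UST_prob (Gs n) B) \<longlonglongrightarrow> free_prob K B"
proof -
  let ?S = "{UST_prob H B | H. fin_connected K H \<and> B \<subseteq> edges H}"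
  have bdd: "bdd_below ?S" by (rule bdd_belowI[of _ 0]) (auto simp: UST_prob_bounds)
  have ev: "eventually (\<lambda>n. B \<subseteq> edges (Gs n)) sequentially" by (rule exhaustion_edges[OF ex B])
  then have ne: "?S \<noteq> {}" using exhaustion_fin_connected[OF ex] by (auto simp: eventually_sequentially)
  show ?thesis
  proof (rule order_tendstoI)
    fix a assume a: "a < free_prob K B"
    show "eventually (\<lambda>n. a < UST_prob (Gs n) B) sequentially"
      using ev
    proof eventually_elim
      case (elim n)
      then have "UST_prob (Gs n) B \<in> ?S" using exhaustion_fin_connected[OF ex] by auto
      then show ?case using a cInf_lower[OF _ bdd] unfolding free_prob_def by fastforce
    qed
  next
    fix a assume "free_prob K B < a"
    then obtain H where H: "fin_connected K H" "B \<subseteq> edges H" "UST_prob H B < a"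
      unfolding free_prob_def cInf_less_iff[OF ne bdd] by auto
    show "eventually (\<lambda>n. UST_prob (Gs n) B < a) sequentially"
      using exhaustion_subgraph[OF ex H(1)]
    proof eventually_elim
      case (elim n)
      have "UST_prob (Gs n) B \<le> UST_prob H B"
        using exhaustion_fin_connected[OF ex, of n] H elim
        by (intro UST_prob_subgraph) (auto simp: fin_connected_def subgraph_def)
      then show ?case using H(3) by simp
    qed
  qed
qed

lemma wired_limit:
  assumes K: "lf_connected K" and ex: "exhaustion K Gs" and B: "finite B" "B \<subseteq> edges K"
  shows "(\<lambda>n. UST_prob (wired K (Gs n)) B) \<longlonglongrightarrow> wired_prob K B"
proof -
  let ?S = "{UST_prob (wired K H) B | H. fin_connected K H \<and> B \<subseteq> edges H}"
  have bdd: "bdd_above ?S" by (rule bdd_aboveI[of _ 1]) (auto simp: UST_prob_bounds)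
  have ev: "eventually (\<lambda>n. B \<subseteq> edges (Gs n)) sequentially" by (rule exhaustion_edges[OF ex B])
  then have ne: "?S \<noteq> {}" using exhaustion_fin_connected[OF ex] by (auto simp: eventually_sequentially)
  show ?thesis
  proof (rule order_tendstoI)
    fix a assume a: "wired_prob K B < a"
    show "eventually (\<lambda>n. UST_prob (wired K (Gs n)) B < a) sequentially"
      using ev
    proof eventually_elim
      case (elim n)
      then have "UST_prob (wired K (Gs n)) B \<in> ?S" using exhaustion_fin_connected[OF ex] by auto
      then show ?case using a cSup_upper[OF _ bdd] unfolding wired_prob_def by fastforce
    qed
  next
    fix a assume "a < wired_prob K B"
    then obtain H where H: "fin_connected K H" "B \<subseteq> edges H" "a < UST_prob (wired K H) B"
      unfolding wired_prob_def less_cSup_iff[OF ne bdd] by auto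
    show "eventually (\<lambda>n. a < UST_prob (wired K (Gs n)) B) sequentially"
      using exhaustion_subgraph[OF ex H(1)]
    proof eventually_elim
      case (elim n)
      have "UST_prob (wired K H) B \<le> UST_prob (wired K (Gs n)) B"
        using exhaustion_fin_connected[OF ex, of n] H elim
        by (intro UST_prob_wired_mono[OF K]) (auto simp: subgraph_def)
      then show ?case using H(3) by simp
    qed
  qed
qed

definition induced_on :: "('v, 'e) mgraph \<Rightarrow> 'v set \<Rightarrow> ('v, 'e) mgraph" where
  "induced_on K X = \<lparr>verts = X, edges = {e \<in> edges K. ends K e \<subseteq> X}, ends = ends K\<rparr>"

primrec graph_ball :: "('v, 'e) mgraph \<Rightarrow> 'v \<Rightarrow> nat \<Rightarrow> 'v set" where
  "graph_ball K v 0 = {v}"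
| "graph_ball K v (Suc n) = graph_ball K v n \<union> (\<Union>e\<in>{e\<in>edges K. ends K e \<inter> graph_ball K v n \<noteq> {}}. ends K e)"

text \<open>
  The subgraphs induced on the balls around a vertex: they are finite because the graph is locally
  finite, and they cover it because it is connected.
\<close>

lemma induced_exhaustion_exists:
  assumes K: "lf_connected K" shows "\<exists>Gs. induced_exhaustion K Gs"
proof -
  have wf: "wf_mgraph K" and lf: "locally_finite K" and con: "connected_mgraph K" using K by (auto simp: lf_connected_def)
  obtain v where v: "v \<in> verts K" using con by (auto simp: connected_mgraph_def)
  let ?X = "graph_ball K v" and ?Gs = "\<lambda>n. induced_on K (graph_ball K v n)"
  have fin_ends: "finite (ends K e)" if "e \<in> edges K" for e
    using wf_ends[OF wf that] by (metis finite.emptyI finite.insertI)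
  have X: "?X n \<subseteq> verts K \<and> finite (?X n)" for n
  proof (induction n)
    case 0 then show ?case using v by simp
  next
    case (Suc n)
    have "finite (\<Union>u\<in>?X n. {e\<in>edges K. u \<in> ends K e})" using Suc lf by (auto simp: locally_finite_def)
    moreover have "{e\<in>edges K. ends K e \<inter> ?X n \<noteq> {}} \<subseteq> (\<Union>u\<in>?X n. {e\<in>edges K. u \<in> ends K e})" by auto
    ultimately have "finite {e\<in>edges K. ends K e \<inter> ?X n \<noteq> {}}" by (rule rev_finite_subset)
    then show ?case using Suc fin_ends wf by (auto simp: wf_mgraph_def)
  qed
  have finE: "finite {e \<in> edges K. ends K e \<subseteq> ?X n}" for n
  proof (rule finite_subset)
    show "{e \<in> edges K. ends K e \<subseteq> ?X n} \<subseteq> (\<Union>u\<in>?X n. {e\<in>edges K. u \<in> ends K e})" using ends_nonempty[OF wf] by auto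
    show "finite (\<Union>u\<in>?X n. {e\<in>edges K. u \<in> ends K e})" using X[of n] lf by (auto simp: locally_finite_def)
  qed
  have wfI: "wf_mgraph (induced_on K X)" for X using wf by (auto simp: wf_mgraph_def induced_on_def)
  have joined_v: "u \<in> ?X n \<Longrightarrow> (v, u) \<in> conn (ends K) {e \<in> edges K. ends K e \<subseteq> ?X n}" for u n
  proof (induction n arbitrary: u)
    case 0 then show ?case by simp
  next
    case (Suc n)
    have mono: "conn (ends K) {e \<in> edges K. ends K e \<subseteq> ?X n} \<subseteq> conn (ends K) {e \<in> edges K. ends K e \<subseteq> ?X (Suc n)}"
      by (intro conn_mono) auto
    show ?case
    proof (cases "u \<in> ?X n")
      case True then show ?thesis using Suc.IH mono by blast
    next
      case False
      then obtain e w where e: "e \<in> edges K" "u \<in> ends K e" "w \<in> ends K e" "w \<in> ?X n" using Suc.prems by auto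
      obtain a b where ab: "ends K e = {a, b}" using wf_ends[OF wf e(1)] .
      have "e \<in> {e \<in> edges K. ends K e \<subseteq> ?X (Suc n)}" using e by auto
      from conn_edge'[where en = "ends K", OF this ab e(3,2)]
      have "(w, u) \<in> conn (ends K) {e \<in> edges K. ends K e \<subseteq> ?X (Suc n)}" .
      with subsetD[OF mono Suc.IH[OF e(4)]] show ?thesis by (rule conn_trans)
    qed
  qed
  have conG: "connected_mgraph (?Gs n)" for n
  proof -
    have "v \<in> ?X n" by (induction n) auto
    moreover have "(u, w) \<in> conn (ends K) {e \<in> edges K. ends K e \<subseteq> ?X n}" if "u \<in> ?X n" "w \<in> ?X n" for u w
      using joined_v[OF that(1)] joined_v[OF that(2)] by (meson conn_sym conn_trans)
    ultimately show ?thesis by (auto simp: connected_mgraph_def joined_iff_conn induced_on_def)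
  qed
  have Xmono: "?X n \<subseteq> ?X m" if "n \<le> m" for n m using that by (induction m rule: dec_induct) auto
  have cover: "u \<in> (\<Union>n. ?X n)" if "u \<in> verts K" for u
  proof -
    have "(v, u) \<in> conn (ends K) (edges K)" using con v that by (auto simp: connected_mgraph_def joined_iff_conn)
    then show ?thesis
    proof (induction rule: conn_induct)
      case refl show ?case by (auto intro: exI[of _ 0])
    next
      case (step y z g)
      then obtain n where "y \<in> ?X n" by auto
      then have "z \<in> ?X (Suc n)" using step by auto
      then show ?case by blast
    qed
  qed
  have coverE: "e \<in> (\<Union>n. {e \<in> edges K. ends K e \<subseteq> ?X n})" if e: "e \<in> edges K" for e
  proof -
    obtain a b where ab: "ends K e = {a, b}" "a \<in> verts K" "b \<in> verts K" using wf_ends[OF wf e] .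
    obtain n m where "a \<in> ?X n" "b \<in> ?X m" using cover ab by blast
    then have "ends K e \<subseteq> ?X (max n m)" using ab Xmono[of n "max n m"] Xmono[of m "max n m"] by auto
    then show ?thesis using e by auto
  qed
  have "exhaustion K ?Gs"
    unfolding exhaustion_def
  proof (intro conjI allI)
    fix n
    show "subgraph (?Gs n) K" using wfI X[of n] by (auto simp: subgraph_def induced_on_def)
    show "finite_mgraph (?Gs n)" using X[of n] finE by (auto simp: finite_mgraph_def induced_on_def)
    show "connected_mgraph (?Gs n)" by (rule conG)
    show "subgraph (?Gs n) (?Gs (Suc n))" using wfI[of "?X n"] by (auto simp: subgraph_def induced_on_def)
    show "(\<Union>n. verts (?Gs n)) = verts K" using X cover by (auto simp: induced_on_def)
    show "(\<Union>n. edges (?Gs n)) = edges K" using coverE by (auto simp: induced_on_def)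
  qed
  moreover have "induced_subgraph (?Gs n) K" for n
    using wfI[of "?X n"] X[of n] by (auto simp: induced_subgraph_def subgraph_def induced_on_def)
  ultimately show ?thesis by (auto simp: induced_exhaustion_def)
qed

lemma countable_edges:
  assumes K: "lf_connected K" shows "countable (edges K)"
proof -
  obtain Gs where "exhaustion K Gs" using induced_exhaustion_exists[OF K] by (auto simp: induced_exhaustion_def)
  then have eq: "edges K = (\<Union>n. edges (Gs n))" and fin: "finite (edges (Gs n))" for n
    by (auto simp: exhaustion_def finite_mgraph_def)
  show ?thesis unfolding eq by (rule countable_UN) (use fin countable_finite in auto)
qed

text \<open>
  Evaluates the definite descriptions that define \<open>FSF\<close> and \<open>WSF\<close>: the limit law exists because the
  probabilities of the generating events converge along one exhaustion, it serves all exhaustions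
  because these limits agree, and it is unique because one exhaustion determines it.
\<close>

lemma unique_limit_measure:
  fixes ok :: "(nat \<Rightarrow> ('v, 'e) mgraph) \<Rightarrow> bool"
  assumes wf: "wf_mgraph K" and "ok Gs0"
    and lim: "\<And>Gs B. ok Gs \<Longrightarrow> finite B \<Longrightarrow> B \<subseteq> edges K \<Longrightarrow>
      (\<lambda>n. measure_pmf.prob (P Gs n) {T. B \<subseteq> T}) \<longlonglongrightarrow> p B"
  defines "\<mu> \<equiv> THE \<mu>. \<forall>Gs. ok Gs \<longrightarrow> local_weak_limit K (P Gs) \<mu>"
  shows "prob_space \<mu>" "sets \<mu> = sets (configs K)" "\<And>B. finite B \<Longrightarrow> B \<subseteq> edges K \<Longrightarrow> incl_prob \<mu> B = p B"
proof -
  have "\<exists>\<nu>. prob_space \<nu> \<and> sets \<nu> = sets (configs K) \<and>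
    (\<forall>B. finite B \<and> B \<subseteq> edges K \<longrightarrow> (\<lambda>n. measure_pmf.prob (P Gs0 n) {T. B \<subseteq> T}) \<longlonglongrightarrow> incl_prob \<nu> B)"
    using lim[OF assms(2)] by (intro configs_measure_exists) (auto simp: convergent_def)
  then obtain \<nu> where \<nu>: "prob_space \<nu>" "sets \<nu> = sets (configs K)"
    "\<And>B. finite B \<Longrightarrow> B \<subseteq> edges K \<Longrightarrow> (\<lambda>n. measure_pmf.prob (P Gs0 n) {T. B \<subseteq> T}) \<longlonglongrightarrow> incl_prob \<nu> B" by blast
  have \<nu>p: "incl_prob \<nu> B = p B" if "finite B" "B \<subseteq> edges K" for B
    by (rule LIMSEQ_unique[OF \<nu>(3)[OF that] lim[OF assms(2) that]])
  have "\<mu> = \<nu>"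
    unfolding \<mu>_def
  proof (rule the_equality)
    show "\<forall>Gs. ok Gs \<longrightarrow> local_weak_limit K (P Gs) \<nu>"
      using local_weak_limit_iff[OF wf \<nu>(1,2)] lim \<nu>p by simp
    fix \<rho> assume "\<forall>Gs. ok Gs \<longrightarrow> local_weak_limit K (P Gs) \<rho>"
    then have L: "local_weak_limit K (P Gs0) \<rho>" using assms(2) by simp
    then have \<rho>: "prob_space \<rho>" "sets \<rho> = sets (configs K)" by (auto simp: local_weak_limit_def)
    show "\<rho> = \<nu>"
    proof (rule configs_measure_eqI[OF \<rho> \<nu>(1,2)])
      fix B assume B: "finite B" "B \<subseteq> edges K"
      then have "(\<lambda>n. measure_pmf.prob (P Gs0 n) {T. B \<subseteq> T}) \<longlonglongrightarrow> incl_prob \<rho> B"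
        using L local_weak_limit_iff[OF wf \<rho>] by blast
      then show "incl_prob \<rho> B = incl_prob \<nu> B" using \<nu>(3)[OF B] by (rule LIMSEQ_unique)
    qed
  qed
  then show "prob_space \<mu>" "sets \<mu> = sets (configs K)" "\<And>B. finite B \<Longrightarrow> B \<subseteq> edges K \<Longrightarrow> incl_prob \<mu> B = p B"
    using \<nu> \<nu>p by auto
qed

lemma FSF_char:
  assumes K: "lf_connected K"
  shows "prob_space (FSF K)" "sets (FSF K) = sets (configs K)"
    "\<And>B. finite B \<Longrightarrow> B \<subseteq> edges K \<Longrightarrow> incl_prob (FSF K) B = free_prob K B"
proof -
  obtain Gs where Gs: "exhaustion K Gs" using induced_exhaustion_exists[OF K] by (auto simp: induced_exhaustion_def)
  have wf: "wf_mgraph K" using K by (simp add: lf_connected_def)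
  note * = unique_limit_measure[where ok = "exhaustion K" and P = "\<lambda>Gs n. UST (Gs n)" and p = "free_prob K",
      OF wf Gs free_limit[OF K, unfolded UST_prob_def], folded FSF_def]
  show "prob_space (FSF K)" "sets (FSF K) = sets (configs K)"
    "\<And>B. finite B \<Longrightarrow> B \<subseteq> edges K \<Longrightarrow> incl_prob (FSF K) B = free_prob K B"
    using * by blast+
qed

lemma WSF_char:
  assumes K: "lf_connected K"
  shows "prob_space (WSF K)" "sets (WSF K) = sets (configs K)"
    "\<And>B. finite B \<Longrightarrow> B \<subseteq> edges K \<Longrightarrow> incl_prob (WSF K) B = wired_prob K B"
proof -
  obtain Gs where Gs: "induced_exhaustion K Gs" using induced_exhaustion_exists[OF K] by auto
  have wf: "wf_mgraph K" using K by (simp add: lf_connected_def)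
  have lim: "(\<lambda>n. measure_pmf.prob (UST (wired K (Gs n))) {T. B \<subseteq> T}) \<longlonglongrightarrow> wired_prob K B"
    if "induced_exhaustion K Gs" "finite B" "B \<subseteq> edges K" for Gs B
    using wired_limit[OF K _ that(2,3), of Gs] that(1) by (simp add: UST_prob_def induced_exhaustion_def)
  note * = unique_limit_measure[where ok = "induced_exhaustion K" and P = "\<lambda>Gs n. UST (wired K (Gs n))" and p = "wired_prob K",
      OF wf Gs lim, folded WSF_def]
  show "prob_space (WSF K)" "sets (WSF K) = sets (configs K)"
    "\<And>B. finite B \<Longrightarrow> B \<subseteq> edges K \<Longrightarrow> incl_prob (WSF K) B = wired_prob K B"
    using * by blast+
qed

lemma wired_prob_le_free_prob:
  assumes K: "lf_connected K" and B: "finite B" "B \<subseteq> edges K"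
  shows "wired_prob K B \<le> free_prob K B"
proof -
  obtain Gs where Gs: "exhaustion K Gs" using induced_exhaustion_exists[OF K] by (auto simp: induced_exhaustion_def)
  show ?thesis
  proof (rule tendsto_le[OF sequentially_bot free_limit[OF K Gs B] wired_limit[OF K Gs B]])
    show "eventually (\<lambda>n. UST_prob (wired K (Gs n)) B \<le> UST_prob (Gs n) B) sequentially"
      using exhaustion_edges[OF Gs B] by eventually_elim (rule UST_prob_wired_le_free[OF K exhaustion_fin_connected[OF Gs]])
  qed
qed

lemma wired_prob_bounds:
  assumes K: "lf_connected K" and B: "finite B" "B \<subseteq> edges K"
  shows "0 \<le> wired_prob K B" "wired_prob K B \<le> 1"
proof -
  interpret prob_space "WSF K" by (rule WSF_char(1)[OF K])
  show "0 \<le> wired_prob K B" "wired_prob K B \<le> 1"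
    unfolding WSF_char(3)[OF K B, symmetric] incl_prob_def by simp_all
qed

section \<open>Approximating the components of an infinite subgraph\<close>

lemma lf_connected_cluster:
  assumes wf: "wf_mgraph G" and lf: "locally_finite G" and F: "F \<subseteq> edges G" and v: "v \<in> verts G"
  shows "lf_connected (cluster G F v)"
  unfolding lf_connected_def
proof (intro conjI)
  have wf': "wf_mgraph (spanning_subgraph G F)" by (rule wf_spanning_subgraph[OF wf F])
  show "wf_mgraph (cluster G F v)" by (rule wf_component_of[OF wf'])
  show "connected_mgraph (cluster G F v)" by (rule connected_component_of[OF wf']) (simp add: v)
  show "locally_finite (cluster G F v)"
    unfolding locally_finite_def
  proof
    fix u assume "u \<in> verts (cluster G F v)"
    then have "finite {e \<in> edges G. u \<in> ends G e}" using lf by (simp add: locally_finite_def)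
    then show "finite {e \<in> edges (cluster G F v). u \<in> ends (cluster G F v) e}"
      by (rule rev_finite_subset) (use F in \<open>auto simp: component_of_simps(2)\<close>)
  qed
qed

lemma conn_Union_incseq:
  assumes "\<And>n m. n \<le> m \<Longrightarrow> Fs n \<subseteq> Fs m" and c: "(u, v) \<in> conn en (\<Union>n::nat. Fs n)"
  shows "\<exists>n. (u, v) \<in> conn en (Fs n)"
  using c
proof (induction rule: conn_induct)
  case refl show ?case by simp
next
  case (step y z g)
  then obtain n m where n: "(u, y) \<in> conn en (Fs n)" "g \<in> Fs m" by auto
  have "(u, y) \<in> conn en (Fs (max n m))" using n conn_mono[OF assms(1)[of n "max n m"], of en] by auto
  moreover have "(y, z) \<in> conn en (Fs (max n m))"
    using n(2) assms(1)[of m "max n m"] step(3) by (intro conn_edge[of g]) auto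
  ultimately have "(u, z) \<in> conn en (Fs (max n m))" by (rule conn_trans)
  then show ?case by blast
qed

lemma exhaustion_vert: "exhaustion G Xs \<Longrightarrow> v \<in> verts G \<Longrightarrow> \<exists>n. v \<in> verts (Xs n)"
  unfolding exhaustion_def by blast

lemma exhaustion_edge: "exhaustion G Xs \<Longrightarrow> e \<in> edges G \<Longrightarrow> \<exists>n. e \<in> edges (Xs n)"
  unfolding exhaustion_def by blast

text \<open>
  The edge set \<open>F\<close> is exhausted by the subsets \<open>Fs n\<close> of the finite pieces \<open>Xs n\<close>; it need not be
  the trace of \<open>F\<close> on the piece.
\<close>

definition approximates :: "('v, 'e) mgraph \<Rightarrow> (nat \<Rightarrow> ('v, 'e) mgraph) \<Rightarrow> (nat \<Rightarrow> 'e set) \<Rightarrow> 'e set \<Rightarrow> bool" where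
  "approximates G Xs Fs F \<longleftrightarrow> wf_mgraph G \<and> exhaustion G Xs \<and> F \<subseteq> edges G \<and>
     (\<forall>n. Fs n \<subseteq> edges (Xs n)) \<and> (\<forall>n m. n \<le> m \<longrightarrow> Fs n \<subseteq> Fs m) \<and> (\<Union>n. Fs n) = F"

text \<open>
  Any vertex joined to \<open>v\<close> in \<open>F\<close> is joined to it by a finite path, hence inside some \<open>Fs n\<close>.
\<close>

lemma cluster_exhaustion:
  assumes ap: "approximates G Xs Fs F" and v: "v \<in> verts (Xs N)"
  shows "exhaustion (cluster G F v) (\<lambda>n. cluster (Xs (n + N)) (Fs (n + N)) v)"
proof -
  have wf: "wf_mgraph G" and ex: "exhaustion G Xs" and F: "F \<subseteq> edges G" and Fs: "\<And>n. Fs n \<subseteq> edges (Xs n)"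
    and mono: "\<And>n m. n \<le> m \<Longrightarrow> Fs n \<subseteq> Fs m" and un: "(\<Union>n. Fs n) = F"
    using ap by (auto simp: approximates_def)
  have X: "wf_mgraph (Xs n)" "verts (Xs n) \<subseteq> verts G" "edges (Xs n) \<subseteq> edges G" "ends (Xs n) = ends G" "finite_mgraph (Xs n)" for n
    using ex by (auto simp: exhaustion_def subgraph_def)
  have Xm: "verts (Xs n) \<subseteq> verts (Xs m)" if "n \<le> m" for n m
    using exhaustion_mono[OF ex that] by (simp add: subgraph_def)
  have vn: "v \<in> verts (Xs (n + N))" for n using v Xm[of N "n + N"] by auto
  let ?K = "cluster G F v" and ?C = "\<lambda>n. cluster (Xs n) (Fs n) v"
  have wfS: "wf_mgraph (spanning_subgraph (Xs n) (Fs n))" for n by (rule wf_spanning_subgraph[OF X(1) Fs])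
  have FsF: "Fs n \<subseteq> F" for n using un by auto
  have c1: "conn (ends G) (Fs n) \<subseteq> conn (ends G) F" for n by (rule conn_mono[OF FsF])
  have c2: "conn (ends G) (Fs n) \<subseteq> conn (ends G) (Fs m)" if "n \<le> m" for n m by (rule conn_mono[OF mono[OF that]])
  have V: "verts (?C n) = {u \<in> verts (Xs n). (v, u) \<in> conn (ends G) (Fs n)}" for n by (simp add: X)
  have E: "edges (?C n) = {e \<in> Fs n. ends G e \<subseteq> verts (?C n)}" for n by (simp add: component_of_simps(2) X)
  have VK: "verts ?K = {u \<in> verts G. (v, u) \<in> conn (ends G) F}" by simp
  have EK: "edges ?K = {e \<in> F. ends G e \<subseteq> verts ?K}" by (simp add: component_of_simps(2))
  have Vm: "verts (?C n) \<subseteq> verts (?C m)" if "n \<le> m" for n m using Xm[OF that] c2[OF that] unfolding V by blast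
  have VinK: "verts (?C n) \<subseteq> verts ?K" for n using X(2) c1 unfolding V VK by blast
  have wfC: "wf_mgraph (?C n)" for n by (rule wf_component_of[OF wfS])
  have "u \<in> (\<Union>n. verts (?C (n + N)))" if u: "u \<in> verts ?K" for u
  proof -
    have "(v, u) \<in> conn (ends G) (\<Union>n. Fs n)" using u un by simp
    from conn_Union_incseq[OF mono this] obtain n where n: "(v, u) \<in> conn (ends G) (Fs n)" by auto
    have "u \<in> verts G" using u by simp
    then obtain m where m: "u \<in> verts (Xs m)" using exhaustion_vert[OF ex] by auto
    let ?k = "max n m"
    have "n \<le> ?k + N" "m \<le> ?k + N" by auto
    then have "u \<in> verts (?C (?k + N))"
      using n m c2[of n "?k + N"] Xm[of m "?k + N"] unfolding V by blast
    then show ?thesis by blast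
  qed
  then have unV: "(\<Union>n. verts (?C (n + N))) = verts ?K" using VinK by blast
  have "e \<in> (\<Union>n. edges (?C (n + N)))" if e: "e \<in> edges ?K" for e
  proof -
    have eF: "e \<in> F" "ends G e \<subseteq> verts ?K" using e EK by auto
    have eG: "e \<in> edges G" using eF F by auto
    obtain n where n: "e \<in> Fs n" using eF un by auto
    obtain a b where ab: "ends G e = {a, b}" using wf_ends[OF wf eG] .
    have "a \<in> (\<Union>n. verts (?C (n + N)))" "b \<in> (\<Union>n. verts (?C (n + N)))" unfolding unV using eF ab by auto
    then obtain i j where ij: "a \<in> verts (?C (i + N))" "b \<in> verts (?C (j + N))" by blast
    let ?k = "max n (max i j)"
    have le: "i + N \<le> ?k + N" "j + N \<le> ?k + N" "n \<le> ?k + N" by auto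
    have "a \<in> verts (?C (?k + N))" "b \<in> verts (?C (?k + N))"
      using subsetD[OF Vm[OF le(1)] ij(1)] subsetD[OF Vm[OF le(2)] ij(2)] .
    moreover have "e \<in> Fs (?k + N)" using n mono[OF le(3)] by auto
    ultimately have "e \<in> edges (?C (?k + N))" unfolding E using ab by auto
    then show ?thesis by blast
  qed
  moreover have EinK: "edges (?C n) \<subseteq> edges ?K" for n using FsF VinK unfolding E EK by blast
  ultimately have unE: "(\<Union>n. edges (?C (n + N))) = edges ?K" by blast
  show ?thesis
    unfolding exhaustion_def
  proof (intro conjI allI)
    fix n
    show "subgraph (?C (n + N)) ?K"
      unfolding subgraph_def using wfC VinK EinK X(4) by simp
    show "finite_mgraph (?C (n + N))"
      by (intro finite_component_of finite_spanning_subgraph X Fs)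
    show "connected_mgraph (?C (n + N))"
      by (rule connected_component_of[OF wfS]) (simp add: vn)
    have "edges (?C (n + N)) \<subseteq> edges (?C (Suc n + N))"
      using mono[of "n + N" "Suc n + N"] Vm[of "n + N" "Suc n + N"] unfolding E by auto
    then show "subgraph (?C (n + N)) (?C (Suc n + N))"
      unfolding subgraph_def using wfC Vm[of "n + N" "Suc n + N"] X(4) by simp
  qed (use unV unE in auto)
qed

text \<open>
  Only these components constrain the event \<open>B \<subseteq> F\<close>, and there are finitely many of them.
\<close>

definition components_meeting :: "('v, 'e) mgraph \<Rightarrow> 'e set \<Rightarrow> 'e set \<Rightarrow> ('v, 'e) mgraph set" where
  "components_meeting G F B = {K \<in> clusters G F. B \<inter> edges K \<noteq> {}}"

lemma finite_components_meeting:
  assumes wf: "wf_mgraph G" and F: "F \<subseteq> edges G" and B: "finite B"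
  shows "finite (components_meeting G F B)"
proof -
  have "\<exists>e\<in>B. K = (THE K. K \<in> clusters G F \<and> e \<in> edges K)" if K: "K \<in> components_meeting G F B" for K
  proof -
    obtain e where e: "e \<in> B" "e \<in> edges K" "K \<in> clusters G F" using K by (auto simp: components_meeting_def)
    have "(THE K. K \<in> clusters G F \<and> e \<in> edges K) = K"
      using e edges_disjoint_components[OF wf_spanning_subgraph[OF wf F]] by (intro the_equality) auto
    then show ?thesis using e by auto
  qed
  then have "components_meeting G F B \<subseteq> (\<lambda>e. THE K. K \<in> clusters G F \<and> e \<in> edges K) ` B" by auto
  then show ?thesis using B by (auto intro: finite_subset)
qed

text \<open>
  Once \<open>n\<close> is large, each component of \<open>F\<close> that meets \<open>B\<close> has its edges of \<open>B\<close> within one cluster of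
  \<open>Fs n\<close>. From then on the product over the clusters of \<open>Fs n\<close> is a product over the fixed finite set of
  components meeting \<open>B\<close>, and it converges factor by factor.
\<close>

lemma cluster_product_limit:
  fixes \<psi> :: "nat \<Rightarrow> ('v, 'e) mgraph \<Rightarrow> 'e set \<Rightarrow> real"
  assumes ap: "approximates G Xs Fs F" and B: "finite B" "B \<subseteq> F"
    and one: "\<And>n K. \<psi> n K {} = 1"
    and lim: "\<And>v N D. v \<in> verts (Xs N) \<Longrightarrow> finite D \<Longrightarrow> D \<subseteq> edges (cluster G F v) \<Longrightarrow>
      (\<lambda>n. \<psi> (n + N) (cluster (Xs (n + N)) (Fs (n + N)) v) D) \<longlonglongrightarrow> \<Psi> (cluster G F v) D"
  shows "(\<lambda>n. \<Prod>K\<in>clusters (Xs n) (Fs n). \<psi> n K (B \<inter> edges K)) \<longlonglongrightarrow>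
    (\<Prod>K\<in>components_meeting G F B. \<Psi> K (B \<inter> edges K))"
proof -
  have wf: "wf_mgraph G" and ex: "exhaustion G Xs" and F: "F \<subseteq> edges G" and Fs: "\<And>n. Fs n \<subseteq> edges (Xs n)"
    and un: "(\<Union>n. Fs n) = F"
    using ap by (auto simp: approximates_def)
  have X: "wf_mgraph (Xs n)" "verts (Xs n) \<subseteq> verts G" "ends (Xs n) = ends G" "finite_mgraph (Xs n)" for n
    using ex by (auto simp: exhaustion_def subgraph_def)
  have wfF: "wf_mgraph (spanning_subgraph G F)" by (rule wf_spanning_subgraph[OF wf F])
  have wfn: "wf_mgraph (spanning_subgraph (Xs n) (Fs n))" for n by (rule wf_spanning_subgraph[OF X(1) Fs])
  let ?J = "components_meeting G F B" and ?GC = "\<lambda>n. clusters (Xs n) (Fs n)"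
  have finJ: "finite ?J" by (rule finite_components_meeting[OF wf F B(1)])
  define r where "r K = (SOME v. v \<in> verts G \<and> K = cluster G F v)" for K
  have r: "r K \<in> verts G \<and> K = cluster G F (r K)" if K: "K \<in> ?J" for K
    unfolding r_def by (rule someI_ex) (use K in \<open>auto simp: components_meeting_def graph_components_def\<close>)
  define C where "C n K = cluster (Xs n) (Fs n) (r K)" for n K
  have Ksub: "edges (C n K) \<subseteq> edges K" if K: "K \<in> ?J" for n K
  proof -
    have "conn (ends G) (Fs n) \<subseteq> conn (ends G) F" using un by (intro conn_mono) auto
    then have "edges (C n K) \<subseteq> edges (cluster G F (r K))" unfolding C_def using X(2,3)[of n] un
      by (auto simp: component_of_simps(2))
    then show ?thesis using r[OF K] by simp
  qed
  have ev1: "eventually (\<lambda>n. r K \<in> verts (Xs n) \<and> B \<inter> edges K \<subseteq> edges (C n K)) sequentially" if K: "K \<in> ?J" for K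
  proof -
    obtain N where N: "r K \<in> verts (Xs N)" using exhaustion_vert[OF ex] r[OF K] by blast
    have "eventually (\<lambda>n. B \<inter> edges K \<subseteq> edges (C (n + N) K)) sequentially"
      unfolding C_def using exhaustion_edges[OF cluster_exhaustion[OF ap N], of "B \<inter> edges K"] B r[OF K] by auto
    then have "eventually (\<lambda>n. B \<inter> edges K \<subseteq> edges (C n K)) sequentially"
      using eventually_sequentially_seg[of "\<lambda>n. B \<inter> edges K \<subseteq> edges (C n K)" N] by simp
    moreover have "eventually (\<lambda>n. {r K} \<subseteq> verts (Xs n)) sequentially" using r[OF K] by (intro exhaustion_verts[OF ex]) auto
    ultimately show ?thesis by eventually_elim auto
  qed
  then have ev: "eventually (\<lambda>n. \<forall>K\<in>?J. r K \<in> verts (Xs n) \<and> B \<inter> edges K \<subseteq> edges (C n K)) sequentially"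
    using finJ by (simp add: eventually_ball_finite_distrib)
  have eq: "(\<Prod>K\<in>?GC n. \<psi> n K (B \<inter> edges K)) = (\<Prod>K\<in>?J. \<psi> n (C n K) (B \<inter> edges K))"
    if n: "\<forall>K\<in>?J. r K \<in> verts (Xs n) \<and> B \<inter> edges K \<subseteq> edges (C n K)" for n
  proof -
    have BK: "B \<inter> edges (C n K) = B \<inter> edges K" if "K \<in> ?J" for K using n Ksub[OF that, of n] that by auto
    have inj: "inj_on (C n) ?J"
    proof (rule inj_onI)
      fix K K' assume K: "K \<in> ?J" "K' \<in> ?J" "C n K = C n K'"
      then have "B \<inter> edges K = B \<inter> edges K'" using BK by metis
      then obtain e where "e \<in> edges K" "e \<in> edges K'" using K by (auto simp: components_meeting_def)
      then show "K = K'" using K edges_disjoint_components[OF wfF] by (auto simp: components_meeting_def)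
    qed
    have fin: "finite (?GC n)"
      using X(4)[of n] by (auto simp: graph_components_def finite_mgraph_def)
    have CGC: "C n K \<in> ?GC n" if "K \<in> ?J" for K using n that by (auto simp: C_def graph_components_def)
    have "K' \<in> C n ` ?J" if K': "K' \<in> ?GC n" "B \<inter> edges K' \<noteq> {}" for K'
    proof -
      obtain e where e: "e \<in> B" "e \<in> edges K'" using K' by auto
      then have "e \<in> edges (spanning_subgraph G F)" using B by auto
      then obtain K where K: "K \<in> clusters G F" "e \<in> edges K"
        using edges_Union_components[OF wfF] by auto
      then have KJ: "K \<in> ?J" using e by (auto simp: components_meeting_def)
      then have "e \<in> edges (C n K)" using n e K by auto
      then have "K' = C n K" using edges_disjoint_components[OF wfn K'(1) CGC[OF KJ] e(2)] by simp
      then show ?thesis using KJ by auto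
    qed
    then have "(\<Prod>K\<in>?GC n. \<psi> n K (B \<inter> edges K)) = (\<Prod>K\<in>C n ` ?J. \<psi> n K (B \<inter> edges K))"
      using fin CGC one by (intro prod.mono_neutral_right) (auto, metis)
    also have "\<dots> = (\<Prod>K\<in>?J. \<psi> n (C n K) (B \<inter> edges (C n K)))" using inj by (simp add: prod.reindex)
    also have "\<dots> = (\<Prod>K\<in>?J. \<psi> n (C n K) (B \<inter> edges K))" using BK by (intro prod.cong) auto
    finally show ?thesis .
  qed
  have "(\<lambda>n. \<psi> n (C n K) (B \<inter> edges K)) \<longlonglongrightarrow> \<Psi> K (B \<inter> edges K)" if K: "K \<in> ?J" for K
  proof -
    obtain N where N: "r K \<in> verts (Xs N)" using exhaustion_vert[OF ex] r[OF K] by blast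
    have "(\<lambda>n. \<psi> (n + N) (C (n + N) K) (B \<inter> edges K)) \<longlonglongrightarrow> \<Psi> K (B \<inter> edges K)"
      unfolding C_def using lim[OF N, of "B \<inter> edges K"] B r[OF K] by auto
    then show ?thesis by (rule LIMSEQ_offset)
  qed
  then have "(\<lambda>n. \<Prod>K\<in>?J. \<psi> n (C n K) (B \<inter> edges K)) \<longlonglongrightarrow> (\<Prod>K\<in>?J. \<Psi> K (B \<inter> edges K))"
    by (rule tendsto_prod)
  then show ?thesis
    by (rule Lim_transform_eventually) (use ev eq in \<open>auto elim: eventually_mono\<close>)
qed

text \<open>
  Two endpoints joined in \<open>F\<close> are joined by a finite path, hence already within some finite piece.
\<close>

lemma closure_approximates:
  assumes wf: "wf_mgraph G" and ex: "exhaustion G Xs" and F: "F \<subseteq> edges G"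
  shows "approximates G Xs (\<lambda>n. closure_edges (Xs n) (F \<inter> edges (Xs n))) (closure_edges G F)"
  unfolding approximates_def
proof (intro conjI allI impI)
  have X: "wf_mgraph (Xs n)" "edges (Xs n) \<subseteq> edges G" "ends (Xs n) = ends G" for n
    using ex by (auto simp: exhaustion_def subgraph_def)
  have Xm: "edges (Xs n) \<subseteq> edges (Xs m)" if "n \<le> m" for n m
    using exhaustion_mono[OF ex that] by (simp add: subgraph_def)
  let ?C = "\<lambda>n. closure_edges (Xs n) (F \<inter> edges (Xs n))"
  have iff: "e \<in> ?C n \<longleftrightarrow> (a, b) \<in> conn (ends G) (F \<inter> edges (Xs n))" if "e \<in> edges (Xs n)" "ends G e = {a, b}" for e n a b
    using closure_edges_iff[OF X(1) that(1)] that(2) X(3) by simp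
  fix n show "?C n \<subseteq> edges (Xs n)" by (rule closure_edges_subset)
  show "?C n \<subseteq> ?C m" if "n \<le> m" for m
  proof
    fix e assume e: "e \<in> ?C n"
    then have en: "e \<in> edges (Xs n)" by (rule subsetD[OF closure_edges_subset])
    then have eG: "e \<in> edges G" using X(2) by auto
    obtain a b where ab: "ends G e = {a, b}" using wf_ends[OF wf eG] .
    have em: "e \<in> edges (Xs m)" using Xm[OF that] en by auto
    have "conn (ends G) (F \<inter> edges (Xs n)) \<subseteq> conn (ends G) (F \<inter> edges (Xs m))" using Xm[OF that] by (intro conn_mono) auto
    then show "e \<in> ?C m" using e iff[OF en ab] iff[OF em ab] by auto
  qed
  have un: "(\<Union>n. F \<inter> edges (Xs n)) = F" using ex F by (auto simp: exhaustion_def)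
  show "(\<Union>n. ?C n) = closure_edges G F"
  proof (intro equalityI subsetI)
    fix e assume "e \<in> (\<Union>n. ?C n)"
    then obtain n where e: "e \<in> ?C n" by auto
    then have en: "e \<in> edges (Xs n)" by (rule subsetD[OF closure_edges_subset])
    then have eG: "e \<in> edges G" using X(2) by auto
    obtain a b where ab: "ends G e = {a, b}" using wf_ends[OF wf eG] .
    have "conn (ends G) (F \<inter> edges (Xs n)) \<subseteq> conn (ends G) F" by (intro conn_mono) auto
    then show "e \<in> closure_edges G F" using e iff[OF en ab] closure_edges_iff[OF wf eG ab] by auto
  next
    fix e assume e: "e \<in> closure_edges G F"
    then have eG: "e \<in> edges G" by (rule subsetD[OF closure_edges_subset])
    obtain a b where ab: "ends G e = {a, b}" using wf_ends[OF wf eG] .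
    have "(a, b) \<in> conn (ends G) (\<Union>n. F \<inter> edges (Xs n))" using e closure_edges_iff[OF wf eG ab] un by simp
    then obtain n where n: "(a, b) \<in> conn (ends G) (F \<inter> edges (Xs n))"
      using conn_Union_incseq[of "\<lambda>n. F \<inter> edges (Xs n)"] Xm by (metis Int_mono order_refl)
    obtain m where m: "e \<in> edges (Xs m)" using exhaustion_edge[OF ex eG] by auto
    let ?k = "max n m"
    have ek: "e \<in> edges (Xs ?k)" using m Xm[of m ?k] by auto
    have "conn (ends G) (F \<inter> edges (Xs n)) \<subseteq> conn (ends G) (F \<inter> edges (Xs ?k))" using Xm[of n ?k] by (intro conn_mono) auto
    then have "e \<in> ?C ?k" using iff[OF ek ab] n by auto
    then show "e \<in> (\<Union>n. ?C n)" by blast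
  qed
qed (use wf ex closure_edges_subset[of G F] in auto)

lemma restriction_approximates:
  assumes wf: "wf_mgraph G" and ex: "exhaustion G Xs" and F: "F \<subseteq> edges G"
  shows "approximates G Xs (\<lambda>n. F \<inter> edges (Xs n)) F"
proof -
  have "edges (Xs n) \<subseteq> edges (Xs m)" if "n \<le> m" for n m
    using exhaustion_mono[OF ex that] by (simp add: subgraph_def)
  then show ?thesis using assms by (auto simp: approximates_def exhaustion_def)
qed

section \<open>Independent forests on the components\<close>

text \<open>
  The probability of containing \<open>B\<close> for the union of independent free forests of the components of
  \<open>F\<close>; below, likewise with wired forests.
\<close>

definition free_product :: "('v, 'e) mgraph \<Rightarrow> 'e set \<Rightarrow> 'e set \<Rightarrow> real" where
  "free_product G F B = (if B \<subseteq> F then \<Prod>K\<in>components_meeting G F B. free_prob K (B \<inter> edges K) else 0)"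

definition wired_product :: "('v, 'e) mgraph \<Rightarrow> 'e set \<Rightarrow> 'e set \<Rightarrow> real" where
  "wired_product G F B = (if B \<subseteq> F then \<Prod>K\<in>components_meeting G F B. wired_prob K (B \<inter> edges K) else 0)"

lemma UST_prob_empty [simp]: "UST_prob G {} = 1"
  by (simp add: UST_prob_def)

lemma free_product_limit:
  assumes G: "lf_connected G" and ex: "exhaustion G Xs" and F: "F \<subseteq> edges G" and B: "finite B" "B \<subseteq> edges G"
  shows "(\<lambda>n. forest_ratio (ends G) (edges (Xs n)) (F \<inter> edges (Xs n)) B) \<longlonglongrightarrow> free_product G (closure_edges G F) B"
proof -
  have wf: "wf_mgraph G" and lf: "locally_finite G" using G by (auto simp: lf_connected_def)
  have X: "wf_mgraph (Xs n)" "ends (Xs n) = ends G" "finite_mgraph (Xs n)" "verts (Xs n) \<subseteq> verts G" for n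
    using ex by (auto simp: exhaustion_def subgraph_def)
  define C where "C n = closure_edges (Xs n) (F \<inter> edges (Xs n))" for n
  note ap = closure_approximates[OF wf ex F, folded C_def]
  have mono: "C n \<subseteq> C m" if "n \<le> m" for n m using ap that by (auto simp: approximates_def)
  have un: "(\<Union>n. C n) = closure_edges G F" using ap by (auto simp: approximates_def)
  have evB: "eventually (\<lambda>n. B \<subseteq> edges (Xs n)) sequentially" by (rule exhaustion_edges[OF ex B])
  have fr: "forest_ratio (ends G) (edges (Xs n)) (F \<inter> edges (Xs n)) B = (if B \<subseteq> C n then
    (\<Prod>K\<in>clusters (Xs n) (C n). UST_prob K (B \<inter> edges K)) else 0)"
    if "B \<subseteq> edges (Xs n)" for n
    using forest_ratio_prod[OF X(1,3) _ that, of "F \<inter> edges (Xs n)"] X(2) unfolding C_def by simp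
  show ?thesis
  proof (cases "B \<subseteq> closure_edges G F")
    case True
    have ev: "eventually (\<lambda>n. B \<subseteq> C n) sequentially"
      by (rule eventually_subset_incseq[OF B(1)]) (use True un mono in auto)
    have "(\<lambda>n. \<Prod>K\<in>clusters (Xs n) (C n). UST_prob K (B \<inter> edges K)) \<longlonglongrightarrow>
        (\<Prod>K\<in>components_meeting G (closure_edges G F) B. free_prob K (B \<inter> edges K))"
    proof (rule cluster_product_limit[OF ap B(1) True, where \<psi> = "\<lambda>n. UST_prob"])
      fix v N D assume v: "v \<in> verts (Xs N)" and D: "finite D" "D \<subseteq> edges (cluster G (closure_edges G F) v)"
      have "lf_connected (cluster G (closure_edges G F) v)"
        using v X(4) by (intro lf_connected_cluster[OF wf lf closure_edges_subset]) auto
      then show "(\<lambda>n. UST_prob (cluster (Xs (n + N)) (C (n + N)) v) D) \<longlonglongrightarrow> free_prob (cluster G (closure_edges G F) v) D"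
        by (rule free_limit[OF _ cluster_exhaustion[OF ap v] D])
    qed simp
    moreover have "eventually (\<lambda>n. (\<Prod>K\<in>clusters (Xs n) (C n). UST_prob K (B \<inter> edges K)) =
        forest_ratio (ends G) (edges (Xs n)) (F \<inter> edges (Xs n)) B) sequentially"
      using ev evB by eventually_elim (simp add: fr)
    ultimately have "(\<lambda>n. forest_ratio (ends G) (edges (Xs n)) (F \<inter> edges (Xs n)) B) \<longlonglongrightarrow>
        (\<Prod>K\<in>components_meeting G (closure_edges G F) B. free_prob K (B \<inter> edges K))"
      by (rule Lim_transform_eventually)
    then show ?thesis using True by (simp add: free_product_def)
  next
    case False
    have "eventually (\<lambda>n. 0 = forest_ratio (ends G) (edges (Xs n)) (F \<inter> edges (Xs n)) B) sequentially"
      using evB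
    proof eventually_elim
      case (elim n)
      have "\<not> B \<subseteq> C n" using False un by auto
      then show ?case using fr[OF elim] by simp
    qed
    then have "(\<lambda>n. forest_ratio (ends G) (edges (Xs n)) (F \<inter> edges (Xs n)) B) \<longlonglongrightarrow> 0"
      by (rule Lim_transform_eventually[OF tendsto_const])
    then show ?thesis using False by (simp add: free_product_def)
  qed
qed

text \<open>
  Here \<open>K\<close> is a finite part of a cluster of \<open>F\<close>; any vertex of \<open>K\<close> gives back the whole cluster.
\<close>

definition wired_factor :: "('v, 'e) mgraph \<Rightarrow> 'e set \<Rightarrow> ('v, 'e) mgraph \<Rightarrow> 'e set \<Rightarrow> real" where
  "wired_factor G F K D = UST_prob (wired (cluster G F (SOME v. v \<in> verts K)) K) D"

definition wired_approx :: "('v, 'e) mgraph \<Rightarrow> ('v, 'e) mgraph \<Rightarrow> 'e set \<Rightarrow> 'e set \<Rightarrow> real" where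
  "wired_approx G X B F = (if B \<subseteq> F then
     \<Prod>K\<in>clusters X (F \<inter> edges X). wired_factor G F K (B \<inter> edges K) else 0)"

lemma wired_approx_limit:
  assumes G: "lf_connected G" and ex: "exhaustion G Xs" and F: "F \<subseteq> edges G" and B: "finite B"
  shows "(\<lambda>n. wired_approx G (Xs n) B F) \<longlonglongrightarrow> wired_product G F B"
proof (cases "B \<subseteq> F")
  case True
  have wf: "wf_mgraph G" and lf: "locally_finite G" using G by (auto simp: lf_connected_def)
  have X: "ends (Xs n) = ends G" "verts (Xs n) \<subseteq> verts G" for n
    using ex by (auto simp: exhaustion_def subgraph_def)
  note ap = restriction_approximates[OF wf ex F]
  have "(\<lambda>n. \<Prod>K\<in>clusters (Xs n) (F \<inter> edges (Xs n)). wired_factor G F K (B \<inter> edges K)) \<longlonglongrightarrow>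
        (\<Prod>K\<in>components_meeting G F B. wired_prob K (B \<inter> edges K))"
  proof (rule cluster_product_limit[OF ap B True, where \<psi> = "\<lambda>n. wired_factor G F"])
    fix v N D assume v: "v \<in> verts (Xs N)" and D: "finite D" "D \<subseteq> edges (cluster G F v)"
    have vG: "v \<in> verts G" using v X(2) by auto
    have K: "lf_connected (cluster G F v)" by (rule lf_connected_cluster[OF wf lf F vG])
    have "wired_factor G F (cluster (Xs (n + N)) (F \<inter> edges (Xs (n + N))) v) D =
        UST_prob (wired (cluster G F v) (cluster (Xs (n + N)) (F \<inter> edges (Xs (n + N))) v)) D" for n
    proof -
      let ?K = "cluster (Xs (n + N)) (F \<inter> edges (Xs (n + N))) v"
      define w where "w = (SOME w. w \<in> verts ?K)"
      have "v \<in> verts ?K" using v exhaustion_mono[OF ex, of N "n + N"] by (auto simp: subgraph_def)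
      then have "w \<in> verts ?K" unfolding w_def by (rule someI)
      then have w: "w \<in> verts G" "(v, w) \<in> conn (ends G) (F \<inter> edges (Xs (n + N)))" using X by auto
      have "(v, w) \<in> conn (ends G) F" using w(2) conn_mono[of "F \<inter> edges (Xs (n + N))" F "ends G"] by auto
      then have "cluster G F v = cluster G F w"
        using component_of_eq_iff[of v "spanning_subgraph G F" w] w vG by simp
      then show ?thesis by (simp add: wired_factor_def w_def)
    qed
    then show "(\<lambda>n. wired_factor G F (cluster (Xs (n + N)) (F \<inter> edges (Xs (n + N))) v) D) \<longlonglongrightarrow> wired_prob (cluster G F v) D"
      using wired_limit[OF K cluster_exhaustion[OF ap v] D] by simp
  qed (simp add: wired_factor_def)
  then show ?thesis using True by (simp add: wired_approx_def wired_product_def)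
qed (simp add: wired_approx_def wired_product_def)

text \<open>
  The wired graph of a finite part \<open>K\<close> of a cluster sees only the edges touching \<open>K\<close>; in particular
  the wired vertex is present exactly if one of these edges leaves \<open>K\<close>.
\<close>

lemma wired_cluster_local:
  assumes wf: "wf_mgraph G" and F: "F \<subseteq> edges G" "F' \<subseteq> F"
    and touch: "\<And>e. e \<in> F \<Longrightarrow> ends G e \<inter> verts K \<noteq> {} \<Longrightarrow> e \<in> F'"
    and K: "verts K \<subseteq> verts (cluster G F' w)" "w \<in> verts K"
  shows "wired (cluster G F w) K = wired (cluster G F' w) K"
proof -
  let ?A = "cluster G F w" and ?A' = "cluster G F' w"
  have cc: "conn (ends G) F' \<subseteq> conn (ends G) F" by (rule conn_mono[OF F(2)])
  then have sub: "verts ?A' \<subseteq> verts ?A" by auto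
  have wG: "w \<in> verts G" using K by auto
  have e1: "e \<in> edges (cluster G H w) \<longleftrightarrow> e \<in> F" if H: "F' \<subseteq> H" "H \<subseteq> F" and t: "ends G e \<inter> verts K \<noteq> {}" for H e
  proof
    assume "e \<in> F"
    then have eF': "e \<in> F'" using touch t by auto
    then have eH: "e \<in> edges (spanning_subgraph G H)" using H by auto
    obtain a where a: "a \<in> ends G e" "a \<in> verts K" using t by auto
    then have "(w, a) \<in> conn (ends G) F'" using K by auto
    then have "(w, a) \<in> conn (ends G) H" using conn_mono[OF H(1), of "ends G"] by auto
    then show "e \<in> edges (cluster G H w)"
      using edge_in_component[OF wf_spanning_subgraph[OF wf, of H] eH] wG a(1) H F by auto
  qed (use H in \<open>auto simp: component_of_simps(2)\<close>)
  have "{e \<in> edges ?A. ends G e \<inter> verts K \<noteq> {}} = {e \<in> edges ?A'. ends G e \<inter> verts K \<noteq> {}}"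
    using e1[of F] e1[of F'] F(2) by auto
  moreover have "wire K ` verts ?A = wire K ` verts ?A'"
  proof -
    have im: "wire K ` V = Some ` verts K \<union> (if V \<subseteq> verts K then {} else {None})" if "verts K \<subseteq> V" for V
      using that by (auto simp: wire_def image_iff)
    have "verts ?A \<subseteq> verts K" if A': "verts ?A' \<subseteq> verts K"
    proof
      fix u assume "u \<in> verts ?A"
      then have "(w, u) \<in> conn (ends G) F" by simp
      then show "u \<in> verts K"
      proof (induction rule: conn_induct)
        case refl show ?case by (rule K(2))
      next
        case (step y z g)
        have gG: "g \<in> edges G" using step F by auto
        have gF': "g \<in> F'" using touch[OF step(2)] step by auto
        have "(w, y) \<in> conn (ends G) F'" using step(4) K by auto
        moreover have "(y, z) \<in> conn (ends G) F'" using gF' step(3) by (intro conn_edge[of g])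
        ultimately have "(w, z) \<in> conn (ends G) F'" by (rule conn_trans)
        moreover have "z \<in> verts G" using wf gG step(3) by (auto simp: wf_mgraph_def)
        ultimately show ?case using A' by auto
      qed
    qed
    then have "verts ?A \<subseteq> verts K \<longleftrightarrow> verts ?A' \<subseteq> verts K" using sub by blast
    then show ?thesis using im[of "verts ?A"] im[of "verts ?A'"] K sub by auto
  qed
  ultimately show ?thesis by (simp add: wired_def Let_def wire_def[abs_def])
qed

lemma wired_approx_local:
  assumes wf: "wf_mgraph G" and X: "subgraph X G" and F: "F \<subseteq> edges G" 
    and S: "S = edges X \<union> {e \<in> edges G. ends G e \<inter> verts X \<noteq> {}} \<union> B"
  shows "wired_approx G X B F = wired_approx G X B (F \<inter> S)"
proof -
  have X': "ends X = ends G" "verts X \<subseteq> verts G" using X by (auto simp: subgraph_def)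
  have i: "F \<inter> S \<inter> edges X = F \<inter> edges X" using S by auto
  have b: "B \<subseteq> F \<inter> S \<longleftrightarrow> B \<subseteq> F" using S by auto
  have "wired_factor G F K D = wired_factor G (F \<inter> S) K D"
    if K: "K \<in> clusters X (F \<inter> edges X)" for K D
  proof -
    obtain v where v: "v \<in> verts X" "K = cluster X (F \<inter> edges X) v" using K by (auto simp: graph_components_def)
    define w where "w = (SOME w. w \<in> verts K)"
    have "v \<in> verts K" using v by simp
    then have w: "w \<in> verts K" unfolding w_def by (rule someI)
    have "conn (ends G) (F \<inter> edges X) \<subseteq> conn (ends G) (F \<inter> S)" using S by (intro conn_mono) auto
    moreover have "(w, u) \<in> conn (ends G) (F \<inter> edges X)" if "u \<in> verts K" for u
    proof -
      have "(v, w) \<in> conn (ends G) (F \<inter> edges X)" "(v, u) \<in> conn (ends G) (F \<inter> edges X)" using w that v(2) X'(1) by simp_all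
      then show ?thesis by (meson conn_sym conn_trans)
    qed
    moreover have KX: "verts K \<subseteq> verts X" using v by auto
    ultimately have "verts K \<subseteq> verts (cluster G (F \<inter> S) w)" using X'(2) by auto
    then have "wired (cluster G F w) K = wired (cluster G (F \<inter> S) w) K"
      using w KX F by (intro wired_cluster_local[OF wf F]) (auto simp: S)
    then show ?thesis by (simp add: wired_factor_def w_def)
  qed
  then have "(\<Prod>K\<in>clusters X (F \<inter> edges X). wired_factor G F K (B \<inter> edges K)) =
      (\<Prod>K\<in>clusters X (F \<inter> edges X). wired_factor G (F \<inter> S) K (B \<inter> edges K))"
    by (intro prod.cong refl)
  then show ?thesis unfolding wired_approx_def i b by simp
qed

lemma measurable_restriction_eq:
  assumes "finite S" "A \<subseteq> S" shows "Measurable.pred (configs G) (\<lambda>F. F \<inter> S = A)"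
proof -
  have "Measurable.pred (configs G) (\<lambda>F. \<forall>e\<in>S. (e \<in> F) = (e \<in> A))" using assms(1) by measurable
  moreover have "(\<lambda>F. \<forall>e\<in>S. (e \<in> F) = (e \<in> A)) = (\<lambda>F. F \<inter> S = A)" using assms(2) by (auto simp: fun_eq_iff)
  ultimately show ?thesis by simp
qed

lemma local_fun_sum:
  fixes f :: "'e set \<Rightarrow> real"
  assumes "finite S" shows "f (F \<inter> S) = (\<Sum>A\<in>Pow S. f A * indicator {F. F \<inter> S = A} F)"
proof -
  have "(\<Sum>A\<in>Pow S. f A * indicator {F. F \<inter> S = A} F) = (\<Sum>A\<in>Pow S. if A = F \<inter> S then f A else 0)"
    by (intro sum.cong) (auto simp: indicator_def)
  also have "\<dots> = f (F \<inter> S)" using assms by (simp add: sum.delta')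
  finally show ?thesis by simp
qed

lemma measurable_local:
  fixes f :: "'e set \<Rightarrow> real"
  assumes "finite S" and f: "\<And>F. F \<subseteq> edges G \<Longrightarrow> f F = f (F \<inter> S)"
  shows "f \<in> borel_measurable (configs G)"
proof -
  have "(\<lambda>F. \<Sum>A\<in>Pow S. f A * indicator {F. F \<inter> S = A} F) \<in> borel_measurable (configs G)"
  proof (intro borel_measurable_sum borel_measurable_times borel_measurable_const)
    fix A assume "A \<in> Pow S"
    then have "Measurable.pred (configs G) (\<lambda>F. F \<inter> S = A)" using assms(1) by (intro measurable_restriction_eq) auto
    then show "(\<lambda>F. indicator {F. F \<inter> S = A} F :: real) \<in> borel_measurable (configs G)"
      by (simp add: borel_measurable_indicator_iff pred_def Int_def conj_commute)
  qed
  then show ?thesis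
    using f local_fun_sum[OF assms(1), of f] by (subst measurable_cong) (auto simp: subset_eq)
qed

lemma pred_local:
  assumes "finite S" and P: "\<And>F. F \<subseteq> edges G \<Longrightarrow> P F = P (F \<inter> S)"
  shows "Measurable.pred (configs G) P"
proof -
  have "(\<lambda>F. of_bool (P F) :: real) \<in> borel_measurable (configs G)"
    by (rule measurable_local[OF assms(1)]) (use P in simp)
  then have "Measurable.pred (configs G) (\<lambda>F. (of_bool (P F) :: real) = 1)" by measurable
  then show ?thesis by simp
qed

text \<open>
  A pointwise limit of functions that depend only on finitely many edges.
\<close>

lemma measurable_wired_product:
  assumes G: "lf_connected G" and B: "finite B"
  shows "(\<lambda>F. wired_product G F B) \<in> borel_measurable (configs G)"
proof -
  have wf: "wf_mgraph G" and lf: "locally_finite G" using G by (auto simp: lf_connected_def)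
  obtain Xs where ex: "exhaustion G Xs" using induced_exhaustion_exists[OF G] by (auto simp: induced_exhaustion_def)
  show ?thesis
  proof (rule borel_measurable_LIMSEQ_real)
    fix F assume "F \<in> space (configs G)"
    then show "(\<lambda>n. wired_approx G (Xs n) B F) \<longlonglongrightarrow> wired_product G F B" by (intro wired_approx_limit[OF G ex _ B]) auto
  next
    fix n
    have X: "subgraph (Xs n) G" "finite_mgraph (Xs n)" using ex by (auto simp: exhaustion_def)
    define S where "S = edges (Xs n) \<union> {e \<in> edges G. ends G e \<inter> verts (Xs n) \<noteq> {}} \<union> B"
    have "finite (\<Union>v\<in>verts (Xs n). {e \<in> edges G. v \<in> ends G e})"
      using X lf by (auto simp: locally_finite_def finite_mgraph_def subgraph_def)
    moreover have "{e \<in> edges G. ends G e \<inter> verts (Xs n) \<noteq> {}} \<subseteq> (\<Union>v\<in>verts (Xs n). {e \<in> edges G. v \<in> ends G e})" by auto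
    ultimately have "finite {e \<in> edges G. ends G e \<inter> verts (Xs n) \<noteq> {}}" by (rule rev_finite_subset)
    then have "finite S" using X B by (auto simp: S_def finite_mgraph_def)
    then show "(\<lambda>F. wired_approx G (Xs n) B F) \<in> borel_measurable (configs G)"
      by (rule measurable_local) (rule wired_approx_local[OF wf X(1) _ S_def])
  qed
qed

text \<open>
  That the endpoints of an edge are joined in \<open>F\<close> is visible in some finite piece.
\<close>

lemma measurable_closure_edges:
  assumes G: "lf_connected G"
  shows "closure_edges G \<in> measurable (configs G) (configs G)"
proof (rule measurable_configsI)
  show "closure_edges G F \<subseteq> edges G" for F by (rule closure_edges_subset)
  fix e assume e: "e \<in> edges G"
  have wf: "wf_mgraph G" using G by (auto simp: lf_connected_def)
  obtain Xs where ex: "exhaustion G Xs" using induced_exhaustion_exists[OF G] by (auto simp: induced_exhaustion_def)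
  obtain a b where ab: "ends G e = {a, b}" using wf_ends[OF wf e] .
  have Xm: "edges (Xs n) \<subseteq> edges (Xs m)" if "n \<le> m" for n m
    using exhaustion_mono[OF ex that] by (simp add: subgraph_def)
  have "Measurable.pred (configs G) (\<lambda>F. (a, b) \<in> conn (ends G) (F \<inter> edges (Xs n)))" for n
  proof (rule pred_local)
    show "finite (edges (Xs n))" using ex by (auto simp: exhaustion_def finite_mgraph_def)
  qed (simp add: Int_assoc)
  then have "Measurable.pred (configs G) (\<lambda>F. \<exists>n. (a, b) \<in> conn (ends G) (F \<inter> edges (Xs n)))"
    by (intro pred_intros_countable)
  moreover have "(\<exists>n. (a, b) \<in> conn (ends G) (F \<inter> edges (Xs n))) \<longleftrightarrow> e \<in> closure_edges G F"
    if F: "F \<in> space (configs G)" for F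
  proof -
    have un: "(\<Union>n. F \<inter> edges (Xs n)) = F" using ex F by (auto simp: exhaustion_def)
    have "conn (ends G) (F \<inter> edges (Xs n)) \<subseteq> conn (ends G) F" for n by (intro conn_mono) auto
    moreover have "(a, b) \<in> conn (ends G) F \<Longrightarrow> \<exists>n. (a, b) \<in> conn (ends G) (F \<inter> edges (Xs n))"
      using conn_Union_incseq[of "\<lambda>n. F \<inter> edges (Xs n)" a b "ends G"] Xm un by auto
    ultimately have "(\<exists>n. (a, b) \<in> conn (ends G) (F \<inter> edges (Xs n))) \<longleftrightarrow> (a, b) \<in> conn (ends G) F" by blast
    then show ?thesis using closure_edges_iff[OF wf e ab] by simp
  qed
  ultimately show "Measurable.pred (configs G) (\<lambda>F. e \<in> closure_edges G F)"
    by (subst measurable_cong[symmetric]) auto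
qed

text \<open>
  The event \<open>B \<subseteq> F\<close> is a finite-dimensional rectangle in the product space.
\<close>

lemma WSF_components_char:
  assumes G: "lf_connected G" and F: "F \<subseteq> edges G"
  defines "\<mu> \<equiv> WSF_components G (spanning_subgraph G F)"
  shows "prob_space \<mu>" "sets \<mu> = sets (configs G)"
    "\<And>B. finite B \<Longrightarrow> B \<subseteq> edges G \<Longrightarrow> incl_prob \<mu> B = wired_product G F B"
proof -
  have wf: "wf_mgraph G" and lf: "locally_finite G" using G by (auto simp: lf_connected_def)
  let ?X = "spanning_subgraph G F"
  let ?C = "graph_components ?X"
  have wfX: "wf_mgraph ?X" by (rule wf_spanning_subgraph[OF wf F])
  have lfK: "lf_connected K" if "K \<in> ?C" for K
    using that lf_connected_cluster[OF wf lf F] by (auto simp: graph_components_def)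
  have P: "prob_space (WSF K)" and S: "sets (WSF K) = sets (configs K)" and sp: "space (WSF K) = Pow (edges K)" if "K \<in> ?C" for K
    using WSF_char[OF lfK[OF that]] sets_eq_imp_space_eq[of "WSF K" "configs K"] by auto
  let ?M = "PiM ?C WSF" and ?U = "\<lambda>\<omega>. \<Union>K\<in>?C. \<omega> K :: 'b set"
  interpret M: prob_space ?M by (rule prob_space_PiM[OF P])
  have EU: "F = (\<Union>K\<in>?C. edges K)" using edges_Union_components[OF wfX] by simp
  have spM: "\<omega> K \<subseteq> edges K" if "\<omega> \<in> space ?M" "K \<in> ?C" for \<omega> K
    using that sp by (auto simp: space_PiM PiE_def Pi_def)
  have Uiff: "e \<in> ?U \<omega> \<longleftrightarrow> e \<in> \<omega> K" if "\<omega> \<in> space ?M" "K \<in> ?C" "e \<in> edges K" for \<omega> K e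
    using that spM edges_disjoint_components[OF wfX] by blast
  have Um: "?U \<in> measurable ?M (configs G)"
  proof (rule measurable_configsI)
    show "?U \<omega> \<subseteq> edges G" if "\<omega> \<in> space ?M" for \<omega> using spM[OF that] EU F by blast
    fix e assume "e \<in> edges G"
    show "Measurable.pred ?M (\<lambda>\<omega>. e \<in> ?U \<omega>)"
    proof (cases "e \<in> F")
      case True
      then obtain K where K: "K \<in> ?C" "e \<in> edges K" using EU by auto
      have "(\<lambda>\<omega>. \<omega> K) \<in> measurable ?M (configs K)"
        using measurable_component_singleton[OF K(1), of WSF] measurable_cong_sets[OF refl S[OF K(1)], of ?M] by simp
      then have "Measurable.pred ?M (\<lambda>\<omega>. e \<in> \<omega> K)" by (rule measurable_compose[OF _ pred_edge])
      then show ?thesis using Uiff[OF _ K] by (subst measurable_cong) auto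
    next
      case False
      have "e \<notin> ?U \<omega>" if "\<omega> \<in> space ?M" for \<omega> using spM[OF that] EU False by blast
      then show ?thesis by (subst measurable_cong[of _ _ "\<lambda>_. False"]) auto
    qed
  qed
  have \<mu>: "\<mu> = distr ?M (configs G) ?U" by (simp add: \<mu>_def WSF_components_def)
  show "prob_space \<mu>" unfolding \<mu> by (rule M.prob_space_distr[OF Um])
  show "sets \<mu> = sets (configs G)" by (simp add: \<mu>)
  show "incl_prob \<mu> B = wired_product G F B" if B: "finite B" "B \<subseteq> edges G" for B
  proof -
    have ev: "{F \<in> space (configs G). B \<subseteq> F} \<in> sets (configs G)" using pred_subset_edges[OF B(1), of G] by (simp add: pred_def)
    have 1: "incl_prob \<mu> B = measure ?M (?U -` {F \<in> space (configs G). B \<subseteq> F} \<inter> space ?M)"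
      unfolding incl_prob_def \<mu> space_distr by (rule measure_distr[OF Um ev])
    show ?thesis
    proof (cases "B \<subseteq> F")
      case False
      have "?U \<omega> \<subseteq> F" if "\<omega> \<in> space ?M" for \<omega> using spM[OF that] EU by blast
      then have "?U -` {F \<in> space (configs G). B \<subseteq> F} \<inter> space ?M = {}" using False by blast
      then show ?thesis using 1 False by (simp add: wired_product_def)
    next
      case True
      let ?J = "components_meeting G F B"
      let ?A = "\<lambda>K. {F' \<in> space (WSF K). B \<inter> edges K \<subseteq> F'}"
      have JC: "?J \<subseteq> ?C" by (auto simp: components_meeting_def)
      have finJ: "finite ?J" by (rule finite_components_meeting[OF wf F B(1)])
      have nn: "0 \<le> wired_prob K (B \<inter> edges K)" if "K \<in> ?J" for K
        using that B JC by (intro wired_prob_bounds(1)[OF lfK]) auto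
      have "B \<subseteq> ?U \<omega> \<longleftrightarrow> (\<forall>K\<in>?J. B \<inter> edges K \<subseteq> \<omega> K)" if \<omega>: "\<omega> \<in> space ?M" for \<omega>
      proof
        assume L: "B \<subseteq> ?U \<omega>"
        show "\<forall>K\<in>?J. B \<inter> edges K \<subseteq> \<omega> K"
        proof (intro ballI subsetI)
          fix K e assume "K \<in> ?J" "e \<in> B \<inter> edges K"
          then show "e \<in> \<omega> K" using L Uiff[OF \<omega>, of K e] JC by blast
        qed
      next
        assume R: "\<forall>K\<in>?J. B \<inter> edges K \<subseteq> \<omega> K"
        show "B \<subseteq> ?U \<omega>"
        proof
          fix e assume e: "e \<in> B"
          then obtain K where K: "K \<in> ?C" "e \<in> edges K" using True EU by blast
          then have "K \<in> ?J" using e by (auto simp: components_meeting_def)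
          then show "e \<in> ?U \<omega>" using R e K by blast
        qed
      qed
      then have "?U -` {F \<in> space (configs G). B \<subseteq> F} \<inter> space ?M = {\<omega> \<in> space ?M. \<forall>K\<in>?J. B \<inter> edges K \<subseteq> \<omega> K}"
        using measurable_space[OF Um] by blast
      also have "\<dots> = prod_emb ?C WSF ?J (\<Pi>\<^sub>E K\<in>?J. ?A K)"
        using JC by (auto simp: prod_emb_def space_PiM PiE_def Pi_def extensional_def restrict_def)
      finally have 2: "?U -` {F \<in> space (configs G). B \<subseteq> F} \<inter> space ?M = prod_emb ?C WSF ?J (\<Pi>\<^sub>E K\<in>?J. ?A K)" .
      have Am: "?A K \<in> sets (WSF K)" if "K \<in> ?J" for K
      proof -
        have K: "K \<in> ?C" using that JC by auto
        have "finite (B \<inter> edges K)" using B by auto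
        then have "{F' \<in> space (configs K). B \<inter> edges K \<subseteq> F'} \<in> sets (configs K)"
          using pred_subset_edges[of "B \<inter> edges K" K] by (simp add: pred_def)
        then show ?thesis using S[OF K] sp[OF K] by simp
      qed
      have "emeasure ?M (prod_emb ?C WSF ?J (\<Pi>\<^sub>E K\<in>?J. ?A K)) = (\<Prod>K\<in>?J. emeasure (WSF K) (?A K))"
        by (rule emeasure_PiM_emb[OF P JC finJ Am])
      also have "\<dots> = (\<Prod>K\<in>?J. ennreal (wired_prob K (B \<inter> edges K)))"
      proof (rule prod.cong[OF refl])
        fix K assume "K \<in> ?J"
        then have K: "K \<in> ?C" using JC by auto
        interpret K: prob_space "WSF K" by (rule P[OF K])
        have "incl_prob (WSF K) (B \<inter> edges K) = wired_prob K (B \<inter> edges K)"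
          using B by (intro WSF_char(3)[OF lfK[OF K]]) auto
        then show "emeasure (WSF K) (?A K) = ennreal (wired_prob K (B \<inter> edges K))"
          by (simp add: K.emeasure_eq_measure incl_prob_def)
      qed
      also have "\<dots> = ennreal (\<Prod>K\<in>?J. wired_prob K (B \<inter> edges K))"
        by (rule prod_ennreal) (use nn in auto)
      finally have e: "emeasure ?M (prod_emb ?C WSF ?J (\<Pi>\<^sub>E K\<in>?J. ?A K)) = ennreal (\<Prod>K\<in>?J. wired_prob K (B \<inter> edges K))" .
      have "measure ?M (prod_emb ?C WSF ?J (\<Pi>\<^sub>E K\<in>?J. ?A K)) = (\<Prod>K\<in>?J. wired_prob K (B \<inter> edges K))"
        using e nn by (simp add: measure_def prod_nonneg)
      then show ?thesis using 1 2 True by (simp add: wired_product_def)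
    qed
  qed
qed

lemma measurable_WSF_components:
  assumes G: "lf_connected G"
  shows "(\<lambda>F. WSF_components G (spanning_subgraph G F)) \<in> measurable (configs G) (prob_algebra (configs G))"
proof (rule measurable_prob_algebra_generated[OF sets_configs_cylinders Int_stable_cylinders cylinders_subset])
  fix F assume "F \<in> space (configs G)"
  then have F: "F \<subseteq> edges G" by simp
  show "prob_space (WSF_components G (spanning_subgraph G F))" "sets (WSF_components G (spanning_subgraph G F)) = sets (configs G)"
    using WSF_components_char[OF G F] by auto
next
  fix A assume "A \<in> cylinders G"
  then obtain B where B: "finite B" "B \<subseteq> edges G" "A = {F \<in> Pow (edges G). B \<subseteq> F}" by (auto simp: cylinders_def)
  have "emeasure (WSF_components G (spanning_subgraph G F)) A = ennreal (wired_product G F B)" if "F \<in> space (configs G)" for F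
  proof -
    have F: "F \<subseteq> edges G" using that by simp
    note c = WSF_components_char[OF G F]
    interpret prob_space "WSF_components G (spanning_subgraph G F)" by (rule c(1))
    have "space (WSF_components G (spanning_subgraph G F)) = Pow (edges G)" using sets_eq_imp_space_eq[OF c(2)] by simp
    then show ?thesis using c(3)[OF B(1,2)] B(3) by (simp add: emeasure_eq_measure incl_prob_def)
  qed
  moreover have "(\<lambda>F. ennreal (wired_product G F B)) \<in> borel_measurable (configs G)"
    using measurable_wired_product[OF G B(1)] by measurable
  ultimately show "(\<lambda>F. emeasure (WSF_components G (spanning_subgraph G F)) A) \<in> borel_measurable (configs G)"
    by (subst measurable_cong) auto
qed

section \<open>The wired forest as free forests of its components\<close>

lemma forest_ratio_bounds: "finite S \<Longrightarrow> 0 \<le> forest_ratio en S A B \<and> forest_ratio en S A B \<le> 1"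
proof -
  assume "finite S"
  then have fin: "finite (forests_clustered_as en S A)"
    by (rule_tac finite_subset[of _ "Pow S"]) (auto simp: forests_clustered_as_def)
  have "card {F \<in> forests_clustered_as en S A. B \<subseteq> F} \<le> card (forests_clustered_as en S A)"
    by (rule card_mono[OF fin]) blast
  then have "forest_ratio en S A B \<le> real (card (forests_clustered_as en S A)) / real (card (forests_clustered_as en S A))"
    unfolding forest_ratio_def by (intro divide_right_mono) simp_all
  also have "\<dots> \<le> 1" by simp
  finally show ?thesis by (simp add: forest_ratio_def)
qed

text \<open>
  The resampling identity for the wired graph of \<open>Xs n\<close>, with the trace on \<open>Xs m\<close> resampled, involves
  only that trace, hence survives the limit in \<open>n\<close> with \<open>m\<close> fixed.
\<close>

lemma WSF_resample:
  assumes G: "lf_connected G" and ex: "induced_exhaustion G Xs" and B: "B \<subseteq> edges (Xs m)"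
  shows "incl_prob (WSF G) B = (\<integral>F. forest_ratio (ends G) (edges (Xs m)) (F \<inter> edges (Xs m)) B \<partial>WSF G)"
proof -
  have exh: "exhaustion G Xs" using ex by (simp add: induced_exhaustion_def)
  have wf: "wf_mgraph G" using G by (auto simp: lf_connected_def)
  let ?S = "edges (Xs m)"
  let ?r = "\<lambda>A. forest_ratio (ends G) ?S A B"
  have X: "subgraph (Xs n) G" "finite_mgraph (Xs n)" "edges (Xs n) \<subseteq> edges G" "ends (Xs n) = ends G" for n
    using exh by (auto simp: exhaustion_def subgraph_def)
  have finS: "finite ?S" using X(2) by (simp add: finite_mgraph_def)
  have BG: "finite B" "B \<subseteq> edges G" using B finS X(3) by (auto intro: finite_subset)
  note W = WSF_char[OF G]
  have lw: "local_weak_limit G (\<lambda>n. UST (wired G (Xs n))) (WSF G)"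
    unfolding local_weak_limit_iff[OF wf W(1,2)] using W(3) wired_limit[OF G exh] by (simp add: UST_prob_def)
  have lim1: "(\<lambda>n. measure_pmf.prob (UST (wired G (Xs n))) {T. T \<inter> ?S = A}) \<longlonglongrightarrow> measure (WSF G) {F \<in> space (WSF G). F \<inter> ?S = A}"
    if "A \<in> Pow ?S" for A
    using lw X that unfolding local_weak_limit_def by blast
  have "(\<lambda>n. UST_prob (wired G (Xs n)) B) \<longlonglongrightarrow> incl_prob (WSF G) B"
    using W(3)[OF BG] wired_limit[OF G exh BG] by simp
  moreover have "eventually (\<lambda>n. UST_prob (wired G (Xs n)) B =
      (\<Sum>A\<in>Pow ?S. measure_pmf.prob (UST (wired G (Xs n))) {T. T \<inter> ?S = A} * ?r A)) sequentially"
    using eventually_ge_at_top[of m]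
  proof eventually_elim
    case (elim n)
    have SX: "?S \<subseteq> edges (Xs n)" using exhaustion_mono[OF exh elim] by (simp add: subgraph_def)
    note t = subgraph_edges_touch[OF X(1)[of n]]
    have "forest_ratio (ends (wired G (Xs n))) ?S A B = ?r A" if "A \<in> Pow ?S" for A
    proof -
      have "ends (wired G (Xs n)) e = Some ` ends G e" if "e \<in> ?S" for e
      proof -
        have "ends G e \<subseteq> verts (Xs n)" using t(2) SX that by auto
        then have "\<forall>v\<in>ends G e. wire (Xs n) v = Some v" by (auto simp: wire_def)
        then show ?thesis by (simp add: wired_simps)
      qed
      then have "forests_clustered_as (ends (wired G (Xs n))) ?S A = forests_clustered_as (ends G) ?S A"
        using that by (intro forests_clustered_as_image[of Some]) auto
      then show ?thesis by (simp add: forest_ratio_def)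
    qed
    moreover have "?S \<subseteq> edges (wired G (Xs n))" using t(1,3) SX by (auto simp: wired_simps)
    ultimately show ?case
      using UST_prob_resample[OF wired_finite_connected[OF G exhaustion_fin_connected[OF exh, of n]] _ B] by simp
  qed
  ultimately have "(\<lambda>n. \<Sum>A\<in>Pow ?S. measure_pmf.prob (UST (wired G (Xs n))) {T. T \<inter> ?S = A} * ?r A) \<longlonglongrightarrow> incl_prob (WSF G) B"
    by (rule Lim_transform_eventually)
  moreover have "(\<lambda>n. \<Sum>A\<in>Pow ?S. measure_pmf.prob (UST (wired G (Xs n))) {T. T \<inter> ?S = A} * ?r A) \<longlonglongrightarrow>
      (\<Sum>A\<in>Pow ?S. measure (WSF G) {F \<in> space (WSF G). F \<inter> ?S = A} * ?r A)"
    by (intro tendsto_sum tendsto_mult lim1 tendsto_const)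
  ultimately have eq: "incl_prob (WSF G) B = (\<Sum>A\<in>Pow ?S. measure (WSF G) {F \<in> space (WSF G). F \<inter> ?S = A} * ?r A)"
    by (rule LIMSEQ_unique)
  interpret prob_space "WSF G" by (rule W(1))
  have spc: "space (WSF G) = space (configs G)" by (rule sets_eq_imp_space_eq[OF W(2)])
  have ev: "{F \<in> space (WSF G). F \<inter> ?S = A} \<in> sets (WSF G)" if "A \<in> Pow ?S" for A
    unfolding W(2) spc using measurable_restriction_eq[OF finS, of A G] that by (simp add: pred_def)
  have "(\<integral>F. ?r (F \<inter> ?S) \<partial>WSF G) = (\<integral>F. (\<Sum>A\<in>Pow ?S. ?r A * indicator {F \<in> space (WSF G). F \<inter> ?S = A} F) \<partial>WSF G)"
    by (intro Bochner_Integration.integral_cong refl, subst local_fun_sum[OF finS, of ?r])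
       (auto intro!: sum.cong simp: indicator_def)
  also have "\<dots> = (\<Sum>A\<in>Pow ?S. \<integral>F. ?r A * indicator {F \<in> space (WSF G). F \<inter> ?S = A} F \<partial>WSF G)"
    using ev by (intro Bochner_Integration.integral_sum integrable_mult_right) (auto intro!: integrable_real_indicator simp: emeasure_eq_measure)
  also have "\<dots> = (\<Sum>A\<in>Pow ?S. measure (WSF G) {F \<in> space (WSF G). F \<inter> ?S = A} * ?r A)"
    using ev by (intro sum.cong refl) (simp add: mult.commute Int_absorb2)
  finally show ?thesis using eq by simp
qed

text \<open>
  The wired spanning forest of \<open>G\<close> arises from itself by resampling a free spanning forest in each
  component of its induced-component graph: in \<open>WSF_resample\<close> the forest is resampled by uniform
  spanning trees of finite clusters, and as \<open>m\<close> grows these clusters exhaust the components.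
\<close>

lemma WSF_eq_free_product:
  assumes G: "lf_connected G" and B: "finite B" "B \<subseteq> edges G"
  shows "integrable (WSF G) (\<lambda>F. free_product G (closure_edges G F) B)" (is ?int)
    and "incl_prob (WSF G) B = (\<integral>F. free_product G (closure_edges G F) B \<partial>WSF G)" (is ?eq)
proof -
  obtain Xs where ex: "induced_exhaustion G Xs" using induced_exhaustion_exists[OF G] by auto
  have exh: "exhaustion G Xs" using ex by (simp add: induced_exhaustion_def)
  note W = WSF_char[OF G]
  interpret prob_space "WSF G" by (rule W(1))
  have spc: "space (WSF G) = space (configs G)" by (rule sets_eq_imp_space_eq[OF W(2)])
  have finX: "finite (edges (Xs n))" for n using exh by (auto simp: exhaustion_def finite_mgraph_def)
  let ?s = "\<lambda>n F. forest_ratio (ends G) (edges (Xs n)) (F \<inter> edges (Xs n)) B"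
  let ?f = "\<lambda>F. free_product G (closure_edges G F) B"
  have m: "?s n \<in> borel_measurable (WSF G)" for n
    unfolding measurable_cong_sets[OF W(2) refl] by (rule measurable_local[OF finX[of n]]) (simp add: Int_assoc)
  have lim: "(\<lambda>n. ?s n F) \<longlonglongrightarrow> ?f F" if "F \<in> space (WSF G)" for F
    using that spc by (intro free_product_limit[OF G exh _ B]) auto
  have mf: "?f \<in> borel_measurable (WSF G)" by (rule borel_measurable_LIMSEQ_real[OF lim m])
  have ae: "AE F in WSF G. (\<lambda>n. ?s n F) \<longlonglongrightarrow> ?f F" using lim by auto
  have "norm (?s n F) \<le> 1" for n F
    using forest_ratio_bounds[OF finX[of n], of "ends G" "F \<inter> edges (Xs n)" B] by simp
  then have bd: "AE F in WSF G. norm (?s n F) \<le> 1" for n by (intro AE_I2)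
  show ?int by (rule integrable_dominated_convergence[OF mf m _ ae bd]) simp
  have "(\<lambda>n. \<integral>F. ?s n F \<partial>WSF G) \<longlonglongrightarrow> (\<integral>F. ?f F \<partial>WSF G)"
    by (rule integral_dominated_convergence[OF mf m _ ae bd]) simp
  moreover have "eventually (\<lambda>n. (\<integral>F. ?s n F \<partial>WSF G) = incl_prob (WSF G) B) sequentially"
    using exhaustion_edges[OF exh B] by eventually_elim (rule WSF_resample[OF G ex, symmetric])
  then have "(\<lambda>n. \<integral>F. ?s n F \<partial>WSF G) \<longlonglongrightarrow> incl_prob (WSF G) B" by (rule tendsto_eventually)
  ultimately show ?eq by (rule LIMSEQ_unique[rotated])
qed

lemma wired_product_bounds:
  assumes G: "lf_connected G" and F: "F \<subseteq> edges G" and B: "finite B"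
  shows "0 \<le> wired_product G F B" "wired_product G F B \<le> free_product G F B" "wired_product G F B \<le> 1"
proof -
  have wf: "wf_mgraph G" and lf: "locally_finite G" using G by (auto simp: lf_connected_def)
  have *: "0 \<le> wired_prob K (B \<inter> edges K)" "wired_prob K (B \<inter> edges K) \<le> free_prob K (B \<inter> edges K)"
    "wired_prob K (B \<inter> edges K) \<le> 1" if "K \<in> components_meeting G F B" for K
  proof -
    have K: "lf_connected K"
      using that lf_connected_cluster[OF wf lf F] by (auto simp: components_meeting_def graph_components_def)
    have D: "finite (B \<inter> edges K)" "B \<inter> edges K \<subseteq> edges K" using B by auto
    show "0 \<le> wired_prob K (B \<inter> edges K)" "wired_prob K (B \<inter> edges K) \<le> 1"
      by (rule wired_prob_bounds[OF K D])+
    show "wired_prob K (B \<inter> edges K) \<le> free_prob K (B \<inter> edges K)"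
      by (rule wired_prob_le_free_prob[OF K D])
  qed
  show "0 \<le> wired_product G F B" using * by (simp add: wired_product_def prod_nonneg)
  show "wired_product G F B \<le> free_product G F B" unfolding wired_product_def free_product_def using * by (simp add: prod_mono)
  show "wired_product G F B \<le> 1" unfolding wired_product_def using * by (simp add: prod_le_1)
qed

text \<open>
  The inclusion probabilities of a mixture are the averages of those of its components.
\<close>

lemma WSF_random_char:
  assumes G: "lf_connected G"
  defines "\<rho> \<equiv> WSF_random G (distr (WSF G) (configs G) (closure_edges G))"
  shows "prob_space \<rho>" "sets \<rho> = sets (configs G)"
    and "\<And>B. finite B \<Longrightarrow> B \<subseteq> edges G \<Longrightarrow> integrable (WSF G) (\<lambda>F. wired_product G (closure_edges G F) B)"
    and "\<And>B. finite B \<Longrightarrow> B \<subseteq> edges G \<Longrightarrow> incl_prob \<rho> B = (\<integral>F. wired_product G (closure_edges G F) B \<partial>WSF G)"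
proof -
  note W = WSF_char[OF G]
  interpret prob_space "WSF G" by (rule W(1))
  let ?cl = "closure_edges G" and ?N = "\<lambda>F. WSF_components G (spanning_subgraph G F)"
  have cl: "?cl \<in> measurable (WSF G) (configs G)"
    unfolding measurable_cong_sets[OF W(2) refl] by (rule measurable_closure_edges[OF G])
  note N = measurable_WSF_components[OF G]
  note Ns = measurable_prob_algebraD[OF N]
  have \<rho>: "\<rho> = WSF G \<bind> (\<lambda>F. ?N (?cl F))"
    unfolding \<rho>_def WSF_random_def by (rule bind_distr[OF cl Ns not_empty])
  have M: "(\<lambda>F. ?N (?cl F)) \<in> measurable (WSF G) (subprob_algebra (configs G))" by (rule measurable_compose[OF cl Ns])
  have clE: "?cl F \<subseteq> edges G" for F by (rule closure_edges_subset)
  have "AE F in WSF G. prob_space (?N (?cl F))" using WSF_components_char(1)[OF G clE] by (intro AE_I2)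
  then show p: "prob_space \<rho>" unfolding \<rho> by (rule prob_space_bind[OF _ M])
  show s: "sets \<rho> = sets (configs G)"
    unfolding \<rho> using WSF_components_char(2)[OF G clE] not_empty by (intro sets_bind) auto
  fix B assume B: "finite B" "B \<subseteq> edges G"
  let ?w = "\<lambda>F. wired_product G (?cl F) B"
  have mw: "?w \<in> borel_measurable (WSF G)" by (rule measurable_compose[OF cl measurable_wired_product[OF G B(1)]])
  have b: "0 \<le> ?w F" "?w F \<le> 1" for F using wired_product_bounds[OF G clE B(1), of F] by auto
  show i: "integrable (WSF G) ?w"
    by (rule integrable_const_bound[where B = 1]) (use b mw in auto)
  let ?A = "{F \<in> space (configs G). B \<subseteq> F}"
  have A: "?A \<in> sets (configs G)" using pred_subset_edges[OF B(1), of G] by (simp add: pred_def)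
  have "emeasure (?N (?cl F)) ?A = ennreal (?w F)" for F
  proof -
    note c = WSF_components_char[OF G clE[of F]]
    interpret N: prob_space "?N (?cl F)" by (rule c(1))
    show ?thesis using c(3)[OF B] sets_eq_imp_space_eq[OF c(2)] by (simp add: N.emeasure_eq_measure incl_prob_def)
  qed
  then have "emeasure \<rho> ?A = (\<integral>\<^sup>+F. ennreal (?w F) \<partial>WSF G)"
    unfolding \<rho> using emeasure_bind[OF not_empty M A] by simp
  also have "\<dots> = ennreal (\<integral>F. ?w F \<partial>WSF G)" using b by (intro nn_integral_eq_integral[OF i]) auto
  finally have "measure \<rho> ?A = (\<integral>F. ?w F \<partial>WSF G)"
    using b by (simp add: measure_def integral_nonneg)
  then show "incl_prob \<rho> B = (\<integral>F. ?w F \<partial>WSF G)"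
    using sets_eq_imp_space_eq[OF s] by (simp add: incl_prob_def)
qed

text \<open>
  A finite set of edges of a single component picks out the factor of that component.
\<close>

lemma FSF_eq_WSF_iff_products:
  assumes G: "lf_connected G" and F: "F \<subseteq> edges G"
  shows "(\<forall>K\<in>clusters G F. FSF K = WSF K) \<longleftrightarrow>
    (\<forall>B\<in>{B. finite B \<and> B \<subseteq> edges G}. wired_product G F B = free_product G F B)"
proof -
  have wf: "wf_mgraph G" and lf: "locally_finite G" using G by (auto simp: lf_connected_def)
  let ?X = "spanning_subgraph G F"
  have wfX: "wf_mgraph ?X" by (rule wf_spanning_subgraph[OF wf F])
  have lfK: "lf_connected K" if "K \<in> graph_components ?X" for K
    using that lf_connected_cluster[OF wf lf F] by (auto simp: graph_components_def)
  show ?thesis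
  proof (intro iffI ballI)
    fix B assume eq: "\<forall>K\<in>graph_components ?X. FSF K = WSF K" and "B \<in> {B. finite B \<and> B \<subseteq> edges G}"
    then have B: "finite B" by simp
    have "wired_prob K (B \<inter> edges K) = free_prob K (B \<inter> edges K)" if "K \<in> components_meeting G F B" for K
    proof -
      have K: "K \<in> graph_components ?X" using that by (simp add: components_meeting_def)
      have D: "finite (B \<inter> edges K)" "B \<inter> edges K \<subseteq> edges K" using B by auto
      show ?thesis using WSF_char(3)[OF lfK[OF K] D] FSF_char(3)[OF lfK[OF K] D] eq K by simp
    qed
    then show "wired_product G F B = free_product G F B" by (simp add: wired_product_def free_product_def)
  next
    fix K assume eq: "\<forall>B\<in>{B. finite B \<and> B \<subseteq> edges G}. wired_product G F B = free_product G F B" and K: "K \<in> graph_components ?X"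
    have KF: "edges K \<subseteq> F" using edges_Union_components[OF wfX] K by auto
    note Fc = FSF_char[OF lfK[OF K]] and Wc = WSF_char[OF lfK[OF K]]
    show "FSF K = WSF K"
    proof (rule configs_measure_eqI[OF Fc(1,2) Wc(1,2)])
      fix D assume D: "finite D" "D \<subseteq> edges K"
      show "incl_prob (FSF K) D = incl_prob (WSF K) D"
      proof (cases "D = {}")
        case True
        then show ?thesis using prob_space.prob_space[OF Fc(1)] prob_space.prob_space[OF Wc(1)] by (simp add: incl_prob_def)
      next
        case False
        have "components_meeting G F D = {K}"
          using K D False edges_disjoint_components[OF wfX K] by (auto simp: components_meeting_def)
        moreover have "D \<inter> edges K = D" "D \<subseteq> F" "D \<subseteq> edges G" using D KF F by auto
        ultimately have "wired_prob K D = free_prob K D"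
          using eq D(1) by (auto simp: wired_product_def free_product_def)
        then show ?thesis using Fc(3)[OF D] Wc(3)[OF D] by simp
      qed
    qed
  qed
qed

text \<open>
  By \<open>WSF_eq_free_product\<close>, the two laws assign to \<open>B \<subseteq> F\<close> the averages of a wired and of a free product.
  The wired product is never larger, so equal averages mean that the two agree almost surely; as there
  are countably many finite \<open>B\<close>, they then agree for all \<open>B\<close> simultaneously.
\<close>

theorem corollary1p6:
  fixes G :: "('v, 'e) mgraph"
  assumes "wf_mgraph G"
    and "locally_finite G"
    and "infinite (verts G)"
    and "connected_mgraph G"
  shows "WSF_random G
           (distr (WSF G) (configs G)
              (\<lambda>F. edges (component_closure G (spanning_subgraph G F)))) = WSF G
     \<longleftrightarrow> (AE F in WSF G.
            \<forall>K \<in> graph_components (component_closure G (spanning_subgraph G F)). FSF K = WSF K)"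
proof -
  have G: "lf_connected G" using assms by (simp add: lf_connected_def)
  let ?cl = "closure_edges G"
  have clE: "?cl F \<subseteq> edges G" for F by (rule closure_edges_subset)
  have comp_eq: "component_closure G (spanning_subgraph G F) = spanning_subgraph G (?cl F)" for F
    by (simp add: closure_edges_def component_closure_def spanning_subgraph_def)
  define \<rho> where "\<rho> = WSF_random G (distr (WSF G) (configs G) ?cl)"
  note R = WSF_random_char[OF G, folded \<rho>_def]
  note W = WSF_char[OF G]
  let ?Fin = "{B. finite B \<and> B \<subseteq> edges G}"
  let ?w = "\<lambda>B F. wired_product G (?cl F) B" and ?f = "\<lambda>B F. free_product G (?cl F) B"
  have "\<rho> = WSF G \<longleftrightarrow> (\<forall>B\<in>?Fin. incl_prob \<rho> B = incl_prob (WSF G) B)"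
    using configs_measure_eqI[OF R(1,2) W(1,2)] by auto
  also have "\<dots> \<longleftrightarrow> (\<forall>B\<in>?Fin. AE F in WSF G. ?w B F = ?f B F)"
  proof (rule ball_cong[OF refl])
    fix B assume "B \<in> ?Fin"
    then have B: "finite B" "B \<subseteq> edges G" by auto
    have iw: "integrable (WSF G) (?w B)" by (rule R(3)[OF B])
    have if': "integrable (WSF G) (?f B)" by (rule WSF_eq_free_product(1)[OF G B])
    have "incl_prob \<rho> B = incl_prob (WSF G) B \<longleftrightarrow> (\<integral>F. ?f B F - ?w B F \<partial>WSF G) = 0"
      using R(4)[OF B] WSF_eq_free_product(2)[OF G B] iw if' by auto
    also have "\<dots> \<longleftrightarrow> (AE F in WSF G. ?f B F - ?w B F = 0)"
      using wired_product_bounds(2)[OF G clE B(1)] iw if'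
      by (intro integral_nonneg_eq_0_iff_AE) auto
    also have "\<dots> \<longleftrightarrow> (AE F in WSF G. ?w B F = ?f B F)" by (intro AE_cong) auto
    finally show "incl_prob \<rho> B = incl_prob (WSF G) B \<longleftrightarrow> (AE F in WSF G. ?w B F = ?f B F)" .
  qed
  also have "\<dots> \<longleftrightarrow> (AE F in WSF G. \<forall>B\<in>?Fin. ?w B F = ?f B F)"
    by (intro AE_ball_countable[symmetric] countable_Collect_finite_subset countable_edges[OF G])
  also have "\<dots> \<longleftrightarrow> (AE F in WSF G. \<forall>K\<in>clusters G (?cl F). FSF K = WSF K)"
    by (intro AE_cong FSF_eq_WSF_iff_products[OF G clE, symmetric])
  finally show ?thesis by (simp add: \<rho>_def comp_eq)
qed

end
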